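(* The associative permutad $\mathrm{permAs}$, presented by a binary operation $\mu$ and the associativity relation $\mu\circ_1\mu=\mu\circ_2\mu$, is one-dimensional in each arity. Hence it is the permutad associated to the nonsymmetric operad $As$.
   Context: $\mathbb{K}$ is a commutative ring; $\underline{n}=\{1,\dots,n\}$; one-dimensional means free of rank one over $\mathbb{K}$. $\mathrm{Sur}(\underline{n},\underline{k})$ is the set of surjections $\underline{n}\to\underline{k}$; the unique element of $\mathrm{Sur}(\underline{n},\underline{1})$ is the corolla $c_{n+1}$. Substitution: for $t\in\mathrm{Sur}(\underline{n},\underline{k})$ and $t_j\in\mathrm{Sur}(\underline{i_j},\underline{m_j})$ with $i_j=\#t^{-1}(j)$, $(t;t_1,\dots,t_k):\underline{n}\to\underline{m_1+\cdots+m_k}$ is the surjection with $(t;t_1,\dots,t_k)(a)=m_1+\cdots+m_{j-1}+t_j(b)$ whenever $t(a)=j$ and $a$ is the $b$-th element of $t^{-1}(j)$ in increasing order. A permutad is an arity-graded module $\mathcal{P}=\{\mathcal{P}_n\}_{n\ge1}$ of $\mathbb{K}$-modules with $\mathcal{P}_1=\mathbb{K}\,\mathrm{id}$ together with, for each surjection $t:\underline{n}\to\underline{k}$ ($1\le k\le n$), a linear map $\Gamma(t;-,\dots,-):\bigotimes_{j=1}^k\mathcal{P}_{\#t^{-1}(j)+1}\to\mathcal{P}_{n+1}$, such that $\Gamma(c_{n+1};\mu)=\mu$ and $$\Gamma\big((t;t_1,\dots,t_k);\lambda^1_1,\dots,\lambda^1_{m_1},\dots,\lambda^k_{m_k}\big)=\Gamma\big(t;\Gamma(t_1;\lambda^1_1,\dots,\lambda^1_{m_1}),\dots,\Gamma(t_k;\lambda^k_1,\dots,\lambda^k_{m_k})\big).$$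 Partial operations: for $\mu\in\mathcal{P}_{m+1},\nu\in\mathcal{P}_{n+1}$ with $m,n\ge1$ and $1\le i\le m+1$, $\mu\circ_i\nu=\Gamma(t;\nu,\mu)$ where $t:\underline{m+n}\to\underline{2}$ is the surjection with $t^{-1}(1)=\{i,\dots,i+n-1\}$. For $\mu$ of arity $2$, $\mu\circ_1\mu=\Gamma(1_2;\mu,\mu)$ and $\mu\circ_2\mu=\Gamma((12);\mu,\mu)$. The free permutad $\mathbb{P}(M)$ on an arity-graded module $M$ with $M_1=0$ is $\mathbb{P}(M)_1=\mathbb{K}\,\mathrm{id}$, $\mathbb{P}(M)_{n+1}=\bigoplus_{k}\bigoplus_{t\in\mathrm{Sur}(\underline{n},\underline{k})}\bigotimes_{j=1}^kM_{\#t^{-1}(j)+1}$ for $n\ge1$, with $\Gamma$ induced by substitution. An ideal is an arity-graded submodule such that any composition $\Gamma(t;\lambda_1,\dots,\lambda_k)$ having at least one entry in it lies in it. The permutad $\mathrm{permAs}$ is the quotient of the free permutad on one generator $\mu$ of arity $2$ by the ideal generated by $\mu\circ_1\mu-\mu\circ_2\mu$. The nonsymmetric operad $As$ has $As_n=\mathbb{K}\mu_n$ for $n\ge1$ ($\mu_1=\mathrm{id}$), with $\mu_m\circ_i\mu_n=\mu_{m+n-1}$. A nonsymmetric operad or a permutad has an underlying pre-permutad (the arity-graded module with its operations $\circ_i$); saying that $\mathrm{permAs}$ is the permutad associated to $As$ means that its underlying pre-permutad is the one underlying $As$. *)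

theory Defs
  imports "HOL-Algebra.Algebra" "HOL-Library.FuncSet"
begin

section \<open>Modules\<close>

text \<open>
  Modules are the \<open>module\<close> records of HOL-Algebra.  Their ring fields \<open>mult\<close> and \<open>one\<close>
  play no role in the locale \<^locale>\<open>module\<close> and are left undefined where they have no meaning.
\<close>

definition regular_module :: "('a, 'm) ring_scheme \<Rightarrow> ('a, 'a) module" where
  "regular_module R = \<lparr>carrier = carrier R, monoid.mult = monoid.mult R, one = \<one>\<^bsub>R\<^esub>,
     ring.zero = \<zero>\<^bsub>R\<^esub>, add = add R, smult = monoid.mult R\<rparr>"

definition free_rank_one :: "('a, 'm) ring_scheme \<Rightarrow> ('a, 'b) module \<Rightarrow> bool" where
  "free_rank_one R M \<longleftrightarrow> module R M \<and>
     (\<exists>e\<in>carrier M. bij_betw (\<lambda>r. r \<odot>\<^bsub>M\<^esub> e) (carrier R) (carrier M))"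

definition module_iso ::
    "('a, 'm) ring_scheme \<Rightarrow> ('a, 'b) module \<Rightarrow> ('a, 'c) module \<Rightarrow> ('b \<Rightarrow> 'c) \<Rightarrow> bool" where
  "module_iso R M N f \<longleftrightarrow> bij_betw f (carrier M) (carrier N) \<and>
     (\<forall>x\<in>carrier M. \<forall>y\<in>carrier M. f (x \<oplus>\<^bsub>M\<^esub> y) = f x \<oplus>\<^bsub>N\<^esub> f y) \<and>
     (\<forall>r\<in>carrier R. \<forall>x\<in>carrier M. f (r \<odot>\<^bsub>M\<^esub> x) = r \<odot>\<^bsub>N\<^esub> f x)"

definition quotient_module :: "('a, 'b) module \<Rightarrow> 'b set \<Rightarrow> ('a, 'b set) module" where
  "quotient_module M N = \<lparr>carrier = a_rcosets\<^bsub>M\<^esub> N, monoid.mult = undefined, one = undefined,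
     ring.zero = N, add = set_add M, smult = (\<lambda>r C. \<Union>x\<in>C. N +>\<^bsub>M\<^esub> (r \<odot>\<^bsub>M\<^esub> x))\<rparr>"

definition direct_sum :: "'i set \<Rightarrow> ('i \<Rightarrow> ('a, 'b) module) \<Rightarrow> ('a, 'i \<Rightarrow> 'b) module" where
  "direct_sum I N = \<lparr>
     carrier = {f \<in> (\<Pi>\<^sub>E i\<in>I. carrier (N i)). finite {i\<in>I. f i \<noteq> \<zero>\<^bsub>N i\<^esub>}},
     monoid.mult = undefined, one = undefined,
     ring.zero = (\<lambda>i\<in>I. \<zero>\<^bsub>N i\<^esub>),
     add = (\<lambda>f g. \<lambda>i\<in>I. f i \<oplus>\<^bsub>N i\<^esub> g i),
     smult = (\<lambda>r f. \<lambda>i\<in>I. r \<odot>\<^bsub>N i\<^esub> f i)\<rparr>"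

definition direct_sum_in :: "'i set \<Rightarrow> ('i \<Rightarrow> ('a, 'b) module) \<Rightarrow> 'i \<Rightarrow> 'b \<Rightarrow> 'i \<Rightarrow> 'b" where
  "direct_sum_in I N i x = (\<lambda>j\<in>I. if j = i then x else \<zero>\<^bsub>N j\<^esub>)"

definition free_module :: "('a, 'm) ring_scheme \<Rightarrow> 'i set \<Rightarrow> ('a, 'i \<Rightarrow> 'a) module" where
  "free_module R B = direct_sum B (\<lambda>_. regular_module R)"

definition basis_vec :: "('a, 'm) ring_scheme \<Rightarrow> 'i set \<Rightarrow> 'i \<Rightarrow> 'i \<Rightarrow> 'a" where
  "basis_vec R B x = direct_sum_in B (\<lambda>_. regular_module R) x \<one>\<^bsub>R\<^esub>"

definition tuples :: "('a, 'b) module list \<Rightarrow> 'b list set" where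
  "tuples Ms = listset (map carrier Ms)"

definition multilinear ::
    "('a, 'm) ring_scheme \<Rightarrow> ('a, 'b) module list \<Rightarrow> ('a, 'c) module \<Rightarrow> ('b list \<Rightarrow> 'c) \<Rightarrow> bool" where
  "multilinear R Ms N f \<longleftrightarrow> f \<in> tuples Ms \<rightarrow> carrier N \<and>
     (\<forall>xs\<in>tuples Ms. \<forall>i<length Ms. \<forall>x\<in>carrier (Ms ! i). \<forall>y\<in>carrier (Ms ! i).
        f (xs[i := x \<oplus>\<^bsub>Ms ! i\<^esub> y]) = f (xs[i := x]) \<oplus>\<^bsub>N\<^esub> f (xs[i := y])) \<and>
     (\<forall>xs\<in>tuples Ms. \<forall>i<length Ms. \<forall>r\<in>carrier R. \<forall>x\<in>carrier (Ms ! i).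
        f (xs[i := r \<odot>\<^bsub>Ms ! i\<^esub> x]) = r \<odot>\<^bsub>N\<^esub> f (xs[i := x]))"

text \<open>
  The tensor product of a list of modules: the free module on tuples modulo the submodule
  generated by the multilinearity relations.  The tensor product of the empty list is the
  free module on the empty tuple.
\<close>

definition tensor_rels ::
    "('a, 'm) ring_scheme \<Rightarrow> ('a, 'b) module list \<Rightarrow> ('b list \<Rightarrow> 'a) set" where
  "tensor_rels R Ms = (let F = free_module R (tuples Ms); e = basis_vec R (tuples Ms) in
     {e (xs[i := x \<oplus>\<^bsub>Ms ! i\<^esub> y]) \<ominus>\<^bsub>F\<^esub> (e (xs[i := x]) \<oplus>\<^bsub>F\<^esub> e (xs[i := y])) | xs i x y.
        xs \<in> tuples Ms \<and> i < length Ms \<and> x \<in> carrier (Ms ! i) \<and> y \<in> carrier (Ms ! i)} \<union>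
     {e (xs[i := r \<odot>\<^bsub>Ms ! i\<^esub> x]) \<ominus>\<^bsub>F\<^esub> (r \<odot>\<^bsub>F\<^esub> e (xs[i := x])) | xs i r x.
        xs \<in> tuples Ms \<and> i < length Ms \<and> r \<in> carrier R \<and> x \<in> carrier (Ms ! i)})"

definition tensor_ker ::
    "('a, 'm) ring_scheme \<Rightarrow> ('a, 'b) module list \<Rightarrow> ('b list \<Rightarrow> 'a) set" where
  "tensor_ker R Ms = (\<lambda>N. submodule N R (free_module R (tuples Ms))) hull tensor_rels R Ms"

definition tensor ::
    "('a, 'm) ring_scheme \<Rightarrow> ('a, 'b) module list \<Rightarrow> ('a, ('b list \<Rightarrow> 'a) set) module" where
  "tensor R Ms = quotient_module (free_module R (tuples Ms)) (tensor_ker R Ms)"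

definition pure_tensor ::
    "('a, 'm) ring_scheme \<Rightarrow> ('a, 'b) module list \<Rightarrow> 'b list \<Rightarrow> ('b list \<Rightarrow> 'a) set" where
  "pure_tensor R Ms xs =
     tensor_ker R Ms +>\<^bsub>free_module R (tuples Ms)\<^esub> basis_vec R (tuples Ms) xs"

text \<open>
  The canonical multilinear map from the tensor products of the lists in \<open>Mss\<close> to the tensor
  product of \<open>concat Mss\<close>, sending pure tensors \<open>xss ! 0, xss ! 1, \<dots>\<close> to the pure tensor of
  \<open>concat xss\<close>.  It is computed on representatives \<open>cs\<close> of the given classes \<open>Cs\<close>; the union
  runs over all representatives, as in the definition of \<^const>\<open>rcoset_mult\<close>.
\<close>

definition tensor_concat ::
    "('a, 'm) ring_scheme \<Rightarrow> ('a, 'b) module list list \<Rightarrow> ('b list \<Rightarrow> 'a) set list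
      \<Rightarrow> ('b list \<Rightarrow> 'a) set" where
  "tensor_concat R Mss Cs = (let Ns = concat Mss; F = free_module R (tuples Ns) in
     \<Union>cs\<in>listset Cs. tensor_ker R Ns +>\<^bsub>F\<^esub>
       (\<Oplus>\<^bsub>F\<^esub> xss \<in> listset (map2 (\<lambda>Ms c. {xs\<in>tuples Ms. c xs \<noteq> \<zero>\<^bsub>R\<^esub>}) Mss cs).
          (\<Otimes>\<^bsub>R\<^esub> j \<in> {..<length cs}. (cs ! j) (xss ! j)) \<odot>\<^bsub>F\<^esub> basis_vec R (tuples Ns) (concat xss)))"


section \<open>Surjections and substitution\<close>

definition Sur :: "nat \<Rightarrow> nat \<Rightarrow> (nat \<Rightarrow> nat) set" where
  "Sur n k = {t \<in> {1..n} \<rightarrow>\<^sub>E {1..k}. t ` {1..n} = {1..k}}"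

text \<open>The number \<open>k\<close> of a surjection in \<open>Sur n k\<close> is recovered as the size of its image.\<close>

definition num_blocks :: "nat \<Rightarrow> (nat \<Rightarrow> nat) \<Rightarrow> nat" where
  "num_blocks n t = card (t ` {1..n})"

definition fibre_size :: "nat \<Rightarrow> (nat \<Rightarrow> nat) \<Rightarrow> nat \<Rightarrow> nat" where
  "fibre_size n t j = card {a\<in>{1..n}. t a = j}"

text \<open>The corolla usually written \<open>c\<^bsub>n+1\<^esub>\<close>, the only element of \<open>Sur n 1\<close>.\<close>

definition corolla :: "nat \<Rightarrow> nat \<Rightarrow> nat" where
  "corolla n = (\<lambda>a\<in>{1..n}. 1)"

text \<open>
  The substitution \<open>(t; t\<^sub>1, \<dots>, t\<^sub>k)\<close>.  Lists are indexed from 0, so \<open>t\<^sub>j\<close> is \<open>ts ! (j - 1)\<close>;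
  the list \<open>ms\<close> collects the sizes \<open>m\<^sub>1, \<dots>, m\<^sub>k\<close> of the codomains of the \<open>t\<^sub>j\<close>, and
  \<open>card {a' \<in> {1..a}. t a' = t a}\<close> is the rank of \<open>a\<close> in its fibre.
\<close>

definition subst_surj :: "nat \<Rightarrow> (nat \<Rightarrow> nat) \<Rightarrow> (nat \<Rightarrow> nat) list \<Rightarrow> nat \<Rightarrow> nat" where
  "subst_surj n t ts =
     (let ms = map (\<lambda>j. num_blocks (fibre_size n t (Suc j)) (ts ! j)) [0..<length ts]
      in (\<lambda>a\<in>{1..n}.
            sum_list (take (t a - 1) ms) + (ts ! (t a - 1)) (card {a'\<in>{1..a}. t a' = t a})))"

text \<open>The surjection onto \<open>{1, 2}\<close> with \<open>{i..i + n - 1}\<close> as the fibre of \<open>1\<close>.\<close>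

definition interval_surj :: "nat \<Rightarrow> nat \<Rightarrow> nat \<Rightarrow> nat \<Rightarrow> nat" where
  "interval_surj m n i = (\<lambda>a\<in>{1..m + n}. if a \<in> {i..i + n - 1} then 1 else 2)"

text \<open>For an arity-graded module \<open>M\<close>, the list of all \<open>M (#t\<^sup>-\<^sup>1(j) + 1)\<close>, \<open>j = 1, \<dots>, k\<close>.\<close>

definition factors :: "(nat \<Rightarrow> ('a, 'b) module) \<Rightarrow> nat \<Rightarrow> (nat \<Rightarrow> nat) \<Rightarrow> ('a, 'b) module list" where
  "factors M n t = map (\<lambda>j. M (fibre_size n t j + 1)) [1..<Suc (num_blocks n t)]"


section \<open>Permutads\<close>

text \<open>
  Gradings are by arity; the value of \<open>grade\<close> at \<open>0\<close> is irrelevant.  The composition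
  \<open>\<Gamma>(t; \<lambda>\<^sub>1, \<dots>, \<lambda>\<^sub>k)\<close> of a surjection \<open>t\<close> from \<open>{1..n}\<close> is \<open>Gam P n t [\<lambda>\<^sub>1, \<dots>, \<lambda>\<^sub>k]\<close>, and a
  linear map on a tensor product is given as a multilinear map.
\<close>

record ('a, 'b) graded =
  grade :: "nat \<Rightarrow> ('a, 'b) module"
  ident :: 'b

record ('a, 'b) permutad = "('a, 'b) graded" +
  Gam :: "nat \<Rightarrow> (nat \<Rightarrow> nat) \<Rightarrow> 'b list \<Rightarrow> 'b"

locale permutad = cring R for R :: "('a, 'm) ring_scheme" (structure) and P :: "('a, 'b) permutad" +
  assumes grade_module: "n \<ge> 1 \<Longrightarrow> module R (grade P n)"
    and ident_closed: "ident P \<in> carrier (grade P 1)"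
    and ident_basis: "bij_betw (\<lambda>r. r \<odot>\<^bsub>grade P 1\<^esub> ident P) (carrier R) (carrier (grade P 1))"
    and Gam_multilinear: "\<lbrakk>n \<ge> 1; t \<in> Sur n k\<rbrakk> \<Longrightarrow>
      multilinear R (factors (grade P) n t) (grade P (n + 1)) (Gam P n t)"
    and Gam_corolla: "\<lbrakk>n \<ge> 1; \<mu> \<in> carrier (grade P (n + 1))\<rbrakk> \<Longrightarrow> Gam P n (corolla n) [\<mu>] = \<mu>"
    and Gam_subst: "\<lbrakk>n \<ge> 1; t \<in> Sur n k; length ms = k; length ts = k; length xss = k;
      \<And>j. j < k \<Longrightarrow> ts ! j \<in> Sur (fibre_size n t (Suc j)) (ms ! j);
      \<And>j. j < k \<Longrightarrow> xss ! j \<in> tuples (factors (grade P) (fibre_size n t (Suc j)) (ts ! j))\<rbrakk> \<Longrightarrow>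
      Gam P n (subst_surj n t ts) (concat xss) =
      Gam P n t (map (\<lambda>j. Gam P (fibre_size n t (Suc j)) (ts ! j) (xss ! j)) [0..<k])"

definition permutad_ideal ::
    "('a, 'm) ring_scheme \<Rightarrow> ('a, 'b) permutad \<Rightarrow> (nat \<Rightarrow> 'b set) \<Rightarrow> bool" where
  "permutad_ideal R P I \<longleftrightarrow> (\<forall>n\<ge>1. submodule (I n) R (grade P n)) \<and>
     (\<forall>n\<ge>1. \<forall>k. \<forall>t\<in>Sur n k. \<forall>xs\<in>tuples (factors (grade P) n t).
        (\<exists>j<k. xs ! j \<in> I (fibre_size n t (Suc j) + 1)) \<longrightarrow> Gam P n t xs \<in> I (n + 1))"

definition generated_ideal ::
    "('a, 'm) ring_scheme \<Rightarrow> ('a, 'b) permutad \<Rightarrow> (nat \<Rightarrow> 'b set) \<Rightarrow> nat \<Rightarrow> 'b set" where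
  "generated_ideal R P S n = \<Inter>{J n | J. permutad_ideal R P J \<and> (\<forall>m. S m \<subseteq> J m)}"

definition quotient_permutad ::
    "('a, 'b) permutad \<Rightarrow> (nat \<Rightarrow> 'b set) \<Rightarrow> ('a, 'b set) permutad" where
  "quotient_permutad P I = \<lparr>
     grade = (\<lambda>n. quotient_module (grade P n) (I n)),
     ident = I 1 +>\<^bsub>grade P 1\<^esub> ident P,
     Gam = (\<lambda>n t Cs. \<Union>xs\<in>listset Cs. I (n + 1) +>\<^bsub>grade P (n + 1)\<^esub> Gam P n t xs)\<rparr>"


subsection \<open>The free permutad\<close>

definition surjections :: "nat \<Rightarrow> (nat \<Rightarrow> nat) set" where
  "surjections n = (\<Union>k. Sur n k)"

text \<open>
  The component of arity \<open>n + 1\<close>.  For \<open>n = 0\<close> the formula yields the tensor product of the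
  empty list, indexed by the unique surjection from the empty set to itself, that is, the free
  module of rank one on the class of the empty tuple; this class is taken as the identity.
  Fibres being nonempty, \<open>M 1\<close> is never used.
\<close>

definition free_component :: "('a, 'm) ring_scheme \<Rightarrow> (nat \<Rightarrow> ('a, 'b) module) \<Rightarrow> nat
      \<Rightarrow> ('a, (nat \<Rightarrow> nat) \<Rightarrow> ('b list \<Rightarrow> 'a) set) module" where
  "free_component R M n = direct_sum (surjections n) (\<lambda>t. tensor R (factors M n t))"

definition free_in :: "('a, 'm) ring_scheme \<Rightarrow> (nat \<Rightarrow> ('a, 'b) module) \<Rightarrow> nat \<Rightarrow> (nat \<Rightarrow> nat)
      \<Rightarrow> ('b list \<Rightarrow> 'a) set \<Rightarrow> (nat \<Rightarrow> nat) \<Rightarrow> ('b list \<Rightarrow> 'a) set" where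
  "free_in R M n = direct_sum_in (surjections n) (\<lambda>t. tensor R (factors M n t))"

text \<open>
  The composition of \<open>Fs = [F\<^sub>1, \<dots>, F\<^sub>k]\<close> along \<open>t\<close> sums, over all families \<open>ts\<close> of surjections
  \<open>t\<^sub>j\<close> from \<open>#t\<^sup>-\<^sup>1(j)\<close> elements, the concatenated tensors \<open>F\<^sub>1(t\<^sub>1) \<otimes> \<dots> \<otimes> F\<^sub>k(t\<^sub>k)\<close> placed in the
  summand indexed by the substitution \<open>(t; t\<^sub>1, \<dots>, t\<^sub>k)\<close>.
\<close>

definition free_Gam :: "('a, 'm) ring_scheme \<Rightarrow> (nat \<Rightarrow> ('a, 'b) module) \<Rightarrow> nat \<Rightarrow> (nat \<Rightarrow> nat)
      \<Rightarrow> ((nat \<Rightarrow> nat) \<Rightarrow> ('b list \<Rightarrow> 'a) set) list \<Rightarrow> (nat \<Rightarrow> nat) \<Rightarrow> ('b list \<Rightarrow> 'a) set" where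
  "free_Gam R M n t Fs =
     (\<Oplus>\<^bsub>free_component R M n\<^esub> ts \<in>
        listset (map (\<lambda>j. surjections (fibre_size n t (Suc j))) [0..<length Fs]).
        free_in R M n (subst_surj n t ts)
          (tensor_concat R
             (map (\<lambda>j. factors M (fibre_size n t (Suc j)) (ts ! j)) [0..<length Fs])
             (map (\<lambda>j. (Fs ! j) (ts ! j)) [0..<length Fs])))"

definition free_permutad :: "('a, 'm) ring_scheme \<Rightarrow> (nat \<Rightarrow> ('a, 'b) module)
      \<Rightarrow> ('a, (nat \<Rightarrow> nat) \<Rightarrow> ('b list \<Rightarrow> 'a) set) permutad" where
  "free_permutad R M = \<lparr>
     grade = (\<lambda>n. free_component R M (n - 1)),
     ident = free_in R M 0 (\<lambda>_. undefined) (pure_tensor R [] []),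
     Gam = free_Gam R M\<rparr>"

text \<open>The canonical map \<open>M n \<rightarrow> grade (free_permutad R M) n\<close>, for \<open>n \<ge> 2\<close>.\<close>

definition free_gen :: "('a, 'm) ring_scheme \<Rightarrow> (nat \<Rightarrow> ('a, 'b) module) \<Rightarrow> nat \<Rightarrow> 'b
      \<Rightarrow> (nat \<Rightarrow> nat) \<Rightarrow> ('b list \<Rightarrow> 'a) set" where
  "free_gen R M n x = free_in R M (n - 1) (corolla (n - 1))
     (pure_tensor R (factors M (n - 1) (corolla (n - 1))) [x])"


subsection \<open>Pre-permutads and nonsymmetric operads\<close>

text \<open>
  In both records the partial operation \<open>x \<circ>\<^sub>i y\<close> with \<open>x\<close> of arity \<open>p\<close> and \<open>y\<close> of arity \<open>q\<close> is
  given by the function with arguments \<open>p q i x y\<close>.  For an operad it is defined for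
  \<open>p, q \<ge> 1\<close>, for a pre-permutad only the operations with \<open>p, q \<ge> 2\<close> are part of the structure.
\<close>

record ('a, 'b) prepermutad = "('a, 'b) graded" +
  circ :: "nat \<Rightarrow> nat \<Rightarrow> nat \<Rightarrow> 'b \<Rightarrow> 'b \<Rightarrow> 'b"

record ('a, 'b) ns_operad = "('a, 'b) graded" +
  pcomp :: "nat \<Rightarrow> nat \<Rightarrow> nat \<Rightarrow> 'b \<Rightarrow> 'b \<Rightarrow> 'b"

definition partial_comp :: "('a, 'b) permutad \<Rightarrow> nat \<Rightarrow> nat \<Rightarrow> nat \<Rightarrow> 'b \<Rightarrow> 'b \<Rightarrow> 'b" where
  "partial_comp P p q i x y =
     (let m = p - 1; n = q - 1 in Gam P (m + n) (interval_surj m n i) [y, x])"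

definition permutad_prepermutad :: "('a, 'b) permutad \<Rightarrow> ('a, 'b) prepermutad" where
  "permutad_prepermutad P = \<lparr>grade = grade P, ident = ident P, circ = partial_comp P\<rparr>"

definition operad_prepermutad :: "('a, 'b) ns_operad \<Rightarrow> ('a, 'b) prepermutad" where
  "operad_prepermutad A = \<lparr>grade = grade A, ident = ident A, circ = pcomp A\<rparr>"

definition prepermutad_iso :: "('a, 'm) ring_scheme \<Rightarrow> ('a, 'b) prepermutad
      \<Rightarrow> ('a, 'c) prepermutad \<Rightarrow> (nat \<Rightarrow> 'b \<Rightarrow> 'c) \<Rightarrow> bool" where
  "prepermutad_iso R P Q f \<longleftrightarrow>
     (\<forall>n\<ge>1. module_iso R (grade P n) (grade Q n) (f n)) \<and>
     f 1 (ident P) = ident Q \<and>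
     (\<forall>p\<ge>2. \<forall>q\<ge>2. \<forall>i\<in>{1..p}. \<forall>x\<in>carrier (grade P p). \<forall>y\<in>carrier (grade P q).
        f (p + q - 1) (circ P p q i x y) = circ Q p q i (f p x) (f q y))"


section \<open>The associative permutad and the operad As\<close>

text \<open>The arity-graded module generated by one element, \<open>\<one>\<close>, in arity 2.\<close>

definition binary_gen :: "('a, 'm) ring_scheme \<Rightarrow> nat \<Rightarrow> ('a, 'a) module" where
  "binary_gen R n =
     (if n = 2 then regular_module R else (regular_module R)\<lparr>carrier := {\<zero>\<^bsub>R\<^esub>}\<rparr>)"

definition assoc_relator ::
    "('a, 'm) ring_scheme \<Rightarrow> (nat \<Rightarrow> nat) \<Rightarrow> ('a list \<Rightarrow> 'a) set" where
  "assoc_relator R =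
     (let P = free_permutad R (binary_gen R); \<mu> = free_gen R (binary_gen R) 2 \<one>\<^bsub>R\<^esub>
      in partial_comp P 2 2 1 \<mu> \<mu> \<ominus>\<^bsub>grade P 3\<^esub> partial_comp P 2 2 2 \<mu> \<mu>)"

definition permAs :: "('a, 'm) ring_scheme
      \<Rightarrow> ('a, ((nat \<Rightarrow> nat) \<Rightarrow> ('a list \<Rightarrow> 'a) set) set) permutad" where
  "permAs R = (let P = free_permutad R (binary_gen R) in
     quotient_permutad P
       (generated_ideal R P (\<lambda>n. if n = 3 then {assoc_relator R} else {})))"

text \<open>Every component of As is a copy of the ring, in which \<open>r\<close> stands for \<open>r \<mu>\<^sub>n\<close>.\<close>

definition As_operad :: "('a, 'm) ring_scheme \<Rightarrow> ('a, 'a) ns_operad" where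
  "As_operad R = \<lparr>grade = (\<lambda>n. regular_module R), ident = \<one>\<^bsub>R\<^esub>,
     pcomp = (\<lambda>p q i x y. x \<otimes>\<^bsub>R\<^esub> y)\<rparr>"

end

(* Let mu_sigma be the basis element of the free permutad on mu indexed by a permutation sigma. The
   free permutad in arity n + 1 is free on these: if t is not bijective, one of its fibres
   contributes a zero module. Summing coordinates is multiplicative for all compositions and kills
   the relator, so its kernel is an ideal containing the relator. Conversely, composing the relator
   along a surjection with one fibre of size 2 gives mu_sigma - mu_tau where sigma and tau differ by
   exchanging two adjacent values, and these moves connect all permutations. Hence the generated
   ideal is the kernel of the sum of coordinates. *)
theory Submission
  imports Defs
begin

section \<open>Linear functionals and direct sums\<close>

text \<open>The modules are raw constructions: a tensor product is a huge free module modulo a hull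
  of relations, and scalar multiplication, concatenation of tensors and composition in a quotient
  are unions over all representatives. The obstacle is to compute with such classes. Every quotient
  that occurs turns out to be the quotient by the kernel of a linear functional to the ring:
  multiplication of the entries for tensors, the sum of coordinates for the free permutad. The
  cosets of such a kernel are the fibres of the functional, so a class is named by one scalar, and a
  union over representatives is a union of copies of one fibre. That the relations generate the
  whole kernel is proved in the same way in both cases: modulo the relations, every generator is a
  multiple of one fixed element \<open>u\<close>. The permutad axioms are then verified in the
  quotient, where \<open>\<Gamma>\<close> is the product of the scalars of its arguments; the
  substitution axiom becomes the fact that the product of a concatenated list is the product of the
  products.\<close>

definition level :: "('a, 'b) module \<Rightarrow> ('b \<Rightarrow> 'c) \<Rightarrow> 'c \<Rightarrow> 'b set" where
  "level M \<phi> r = {x \<in> carrier M. \<phi> x = r}"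

text \<open>The choice does not matter on a nonempty fibre, where \<open>\<phi>\<close> is constant.
  On an empty fibre the value is arbitrary, which is why labels are required to lie in the image of
  \<open>\<phi>\<close>.\<close>

definition level_val :: "('b \<Rightarrow> 'c) \<Rightarrow> 'b set \<Rightarrow> 'c" where
  "level_val \<phi> C = \<phi> (SOME x. x \<in> C)"

locale functional = module R M for R :: "('a, 'm) ring_scheme" (structure) and M :: "('a, 'c) module" (structure) +
  fixes \<phi> :: "'c \<Rightarrow> 'a"
  assumes fun_closed [simp]: "x \<in> carrier M \<Longrightarrow> \<phi> x \<in> carrier R"
    and fun_add: "x \<in> carrier M \<Longrightarrow> y \<in> carrier M \<Longrightarrow> \<phi> (x \<oplus>\<^bsub>M\<^esub> y) = \<phi> x \<oplus> \<phi> y"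
    and fun_smult: "r \<in> carrier R \<Longrightarrow> x \<in> carrier M \<Longrightarrow> \<phi> (r \<odot>\<^bsub>M\<^esub> x) = r \<otimes> \<phi> x"
begin

lemma fun_zero [simp]: "\<phi> \<zero>\<^bsub>M\<^esub> = \<zero>"
  using fun_smult[of \<zero> "\<zero>\<^bsub>M\<^esub>"] by simp

lemma fun_minus: "x \<in> carrier M \<Longrightarrow> \<phi> (\<ominus>\<^bsub>M\<^esub> x) = \<ominus> \<phi> x"
  by (metis M.add.inv_closed M.l_neg R.minus_equality fun_add fun_closed fun_zero)

lemma fun_diff: "x \<in> carrier M \<Longrightarrow> y \<in> carrier M \<Longrightarrow> \<phi> (x \<ominus>\<^bsub>M\<^esub> y) = \<phi> x \<ominus> \<phi> y"
  by (simp add: a_minus_def fun_add fun_minus)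

lemma fun_finsum:
  assumes "finite A" "f \<in> A \<rightarrow> carrier M"
  shows "\<phi> (\<Oplus>\<^bsub>M\<^esub>i\<in>A. f i) = (\<Oplus>i\<in>A. \<phi> (f i))"
  using assms
proof (induction A)
  case (insert x A)
  then have "f \<in> A \<rightarrow> carrier M" "f x \<in> carrier M" by auto
  with insert show ?case
    by (simp add: fun_add Pi_def)
qed simp

lemma ker_submodule: "submodule (level M \<phi> \<zero>) R M"
  by (rule submoduleI) (auto simp: level_def fun_add fun_minus fun_smult)

text \<open>If \<open>y\<close> has the same value as \<open>x\<close>, then \<open>y\<close> is the
  kernel element \<open>y - x\<close> plus \<open>x\<close>. This rewrites the cosets in the
  definitions as sets described by one scalar.\<close>

lemma ker_coset:
  assumes x: "x \<in> carrier M"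
  shows "level M \<phi> \<zero> +>\<^bsub>M\<^esub> x = level M \<phi> (\<phi> x)"
proof -
  have "y \<in> level M \<phi> \<zero> +>\<^bsub>M\<^esub> x" if y: "y \<in> level M \<phi> (\<phi> x)" for y
  proof -
    from y have yM: "y \<in> carrier M" and e: "\<phi> y = \<phi> x" by (auto simp: level_def)
    have "y \<ominus>\<^bsub>M\<^esub> x \<in> level M \<phi> \<zero>"
      using x yM e by (simp add: level_def fun_diff R.r_neg a_minus_def fun_add fun_minus)
    moreover have "y = (y \<ominus>\<^bsub>M\<^esub> x) \<oplus>\<^bsub>M\<^esub> x"
      using x yM by (simp add: a_minus_def M.a_assoc M.l_neg)
    ultimately show ?thesis by (auto simp: a_r_coset_def')
  qed
  then show ?thesis
    using x by (auto simp: a_r_coset_def' level_def fun_add)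
qed

lemma level_val_level [simp]:
  assumes "r \<in> \<phi> ` carrier M"
  shows "level_val \<phi> (level M \<phi> r) = r"
proof -
  have "\<exists>x. x \<in> level M \<phi> r" using assms by (auto simp: level_def)
  from someI_ex[OF this] show ?thesis by (simp add: level_val_def level_def)
qed

text \<open>The map sending \<open>x\<close> to \<open>x - \<phi>(x) u\<close> is linear, and the
  set is the preimage of \<open>N\<close> under it. Hence the congruence of \<open>x\<close> and
  \<open>\<phi>(x) u\<close> modulo \<open>N\<close> only has to be checked on generators.\<close>

lemma reduction_submodule:
  assumes N: "submodule N R M" and u: "u \<in> carrier M"
  shows "submodule {x \<in> carrier M. x \<ominus>\<^bsub>M\<^esub> \<phi> x \<odot>\<^bsub>M\<^esub> u \<in> N} R M" (is "submodule ?S R M")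
proof (rule submoduleI)
  show "\<zero>\<^bsub>M\<^esub> \<in> ?S"
    using u subgroup.one_closed[OF submodule.axioms(1)[OF N]] by (simp add: a_minus_def submoduleE(3)[OF N])
  show "\<ominus>\<^bsub>M\<^esub> a \<in> ?S" if "a \<in> ?S" for a
  proof -
    have "\<ominus>\<^bsub>M\<^esub> (a \<ominus>\<^bsub>M\<^esub> \<phi> a \<odot>\<^bsub>M\<^esub> u) \<in> N"
      using that by (intro submoduleE(3)[OF N]) simp
    then show ?thesis using that u
      by (simp add: fun_minus a_minus_def M.minus_add smult_l_minus)
  qed
  show "a \<oplus>\<^bsub>M\<^esub> b \<in> ?S" if "a \<in> ?S" "b \<in> ?S" for a b
  proof -
    have "(a \<ominus>\<^bsub>M\<^esub> \<phi> a \<odot>\<^bsub>M\<^esub> u) \<oplus>\<^bsub>M\<^esub> (b \<ominus>\<^bsub>M\<^esub> \<phi> b \<odot>\<^bsub>M\<^esub> u) \<in> N"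
      using that by (intro submoduleE(5)[OF N]) simp_all
    then show ?thesis using that u
      by (simp add: fun_add a_minus_def M.minus_add smult_l_distr M.a_ac)
  qed
  show "r \<odot>\<^bsub>M\<^esub> a \<in> ?S" if "r \<in> carrier R" "a \<in> ?S" for r a
  proof -
    have "r \<odot>\<^bsub>M\<^esub> (a \<ominus>\<^bsub>M\<^esub> \<phi> a \<odot>\<^bsub>M\<^esub> u) \<in> N"
      using that by (intro submoduleE(4)[OF N]) simp_all
    then show ?thesis using that u
      by (simp add: fun_smult a_minus_def smult_r_distr smult_r_minus smult_assoc1)
  qed
qed auto

text \<open>An \<open>x\<close> in the kernel is congruent to \<open>0 u = 0\<close> modulo
  \<open>N\<close>. This is how a submodule known only through some of its elements is shown to
  contain a whole kernel.\<close>

lemma ker_subset: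
  assumes N: "submodule N R M" and u: "u \<in> carrier M"
    and red: "carrier M \<subseteq> {x \<in> carrier M. x \<ominus>\<^bsub>M\<^esub> \<phi> x \<odot>\<^bsub>M\<^esub> u \<in> N}"
  shows "level M \<phi> \<zero> \<subseteq> N"
proof
  fix c assume "c \<in> level M \<phi> \<zero>"
  then have c: "c \<in> carrier M" "c \<ominus>\<^bsub>M\<^esub> \<zero> \<odot>\<^bsub>M\<^esub> u \<in> N" using red by (auto simp: level_def)
  have "\<ominus>\<^bsub>M\<^esub> \<zero>\<^bsub>M\<^esub> = \<zero>\<^bsub>M\<^esub>" by (intro M.minus_equality) auto
  with c u show "c \<in> N" by (simp add: a_minus_def)
qed

section \<open>The quotient by the kernel of a functional\<close>

definition "quot = quotient_module M (level M \<phi> \<zero>)"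

lemma carrier_quot: "carrier quot = level M \<phi> ` \<phi> ` carrier M"
  by (auto simp: quot_def quotient_module_def A_RCOSETS_def' ker_coset)

lemma quot_zero: "\<zero>\<^bsub>quot\<^esub> = level M \<phi> \<zero>"
  by (simp add: quot_def quotient_module_def)

text \<open>Addition in the quotient is the elementwise sum of two fibres. An element
  \<open>z\<close> over \<open>r + s\<close> is reached by fixing one \<open>x\<close> over
  \<open>r\<close> and writing \<open>z = x + (z - x)\<close>; this uses that the fibre over
  \<open>r\<close> is nonempty.\<close>

lemma quot_add:
  assumes "r \<in> \<phi> ` carrier M" "s \<in> \<phi> ` carrier M"
  shows "level M \<phi> r \<oplus>\<^bsub>quot\<^esub> level M \<phi> s = level M \<phi> (r \<oplus> s)"
proof -
  obtain x where x: "x \<in> carrier M" "r = \<phi> x" using assms by auto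
  have "z \<in> level M \<phi> r <+>\<^bsub>M\<^esub> level M \<phi> s" if z: "z \<in> level M \<phi> (r \<oplus> s)" for z
  proof -
    have zM: "z \<in> carrier M" "\<phi> z = r \<oplus> s" using z by (auto simp: level_def)
    have rs: "r \<in> carrier R" "s \<in> carrier R" using assms by auto
    have "(r \<oplus> s) \<ominus> r = s"
      using rs by (metis R.add.m_comm R.add.inv_closed R.a_assoc R.r_neg R.r_zero a_minus_def)
    then have "z \<ominus>\<^bsub>M\<^esub> x \<in> level M \<phi> s"
      using x zM by (simp add: level_def fun_diff)
    moreover have "z = x \<oplus>\<^bsub>M\<^esub> (z \<ominus>\<^bsub>M\<^esub> x)"
      using x zM by (metis M.add.m_comm M.add.inv_closed M.a_assoc M.l_neg M.r_zero M.minus_closed a_minus_def)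
    moreover have "x \<in> level M \<phi> r" using x by (simp add: level_def)
    ultimately show ?thesis by (auto simp: set_add_def')
  qed
  then show ?thesis
    using assms
    by (auto simp: quot_def quotient_module_def set_add_def' level_def fun_add)
qed

lemma quot_smult:
  assumes "r \<in> carrier R" "s \<in> \<phi> ` carrier M"
  shows "r \<odot>\<^bsub>quot\<^esub> level M \<phi> s = level M \<phi> (r \<otimes> s)"
proof -
  \<comment> \<open>Every representative \<open>x\<close> contributes the same coset, since
    \<open>\<phi>\<close> takes the value \<open>r s\<close> on \<open>r x\<close>; the union then
    collapses because the fibre over \<open>s\<close> is nonempty.\<close>
  have "(\<Union>x\<in>level M \<phi> s. level M \<phi> \<zero> +>\<^bsub>M\<^esub> (r \<odot>\<^bsub>M\<^esub> x)) = (\<Union>x\<in>level M \<phi> s. level M \<phi> (r \<otimes> s))"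
    using assms by (intro SUP_cong) (auto simp: level_def[of M \<phi> s] ker_coset fun_smult)
  also have "\<dots> = level M \<phi> (r \<otimes> s)"
    using assms by (auto simp: level_def)
  finally show ?thesis by (simp add: quot_def quotient_module_def)
qed

text \<open>The image is an ideal of the ring. It labels the elements of the quotient and need not
  be the whole ring, since \<open>M\<close> may be zero.\<close>

lemma image_closed:
  "\<zero> \<in> \<phi> ` carrier M"
  "r \<in> \<phi> ` carrier M \<Longrightarrow> s \<in> \<phi> ` carrier M \<Longrightarrow> r \<oplus> s \<in> \<phi> ` carrier M"
  "a \<in> carrier R \<Longrightarrow> s \<in> \<phi> ` carrier M \<Longrightarrow> a \<otimes> s \<in> \<phi> ` carrier M"
  "s \<in> \<phi> ` carrier M \<Longrightarrow> s \<in> carrier R"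
  "s \<in> \<phi> ` carrier M \<Longrightarrow> \<ominus> s \<in> \<phi> ` carrier M"
proof -
  show "\<zero> \<in> \<phi> ` carrier M" using fun_zero M.zero_closed by (metis imageI)
  show "r \<in> \<phi> ` carrier M \<Longrightarrow> s \<in> \<phi> ` carrier M \<Longrightarrow> r \<oplus> s \<in> \<phi> ` carrier M"
    by (auto simp flip: fun_add)
  show "a \<in> carrier R \<Longrightarrow> s \<in> \<phi> ` carrier M \<Longrightarrow> a \<otimes> s \<in> \<phi> ` carrier M"
    by (auto simp flip: fun_smult)
  show "s \<in> \<phi> ` carrier M \<Longrightarrow> s \<in> carrier R" by auto
  show "s \<in> \<phi> ` carrier M \<Longrightarrow> \<ominus> s \<in> \<phi> ` carrier M"
    by (auto simp flip: fun_minus)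
qed

lemma quot_cases:
  assumes "x \<in> carrier quot"
  obtains r where "r \<in> \<phi> ` carrier M" "r \<in> carrier R" "x = level M \<phi> r"
  using assms image_closed(4) unfolding carrier_quot by blast

lemma level_in_quot: "r \<in> \<phi> ` carrier M \<Longrightarrow> level M \<phi> r \<in> carrier quot"
  by (auto simp: carrier_quot)

lemma quot_module: "module R quot"
proof (rule moduleI)
  note c = image_closed(1-3) image_closed(5) level_in_quot quot_add quot_smult quot_zero
  show "cring R" by (rule R.cring_axioms)
  show "abelian_group quot"
  proof (rule abelian_groupI)
    show "\<exists>y\<in>carrier quot. y \<oplus>\<^bsub>quot\<^esub> x = \<zero>\<^bsub>quot\<^esub>" if "x \<in> carrier quot" for x
      using that
    proof (cases rule: quot_cases)
      case (1 r)
      then have "level M \<phi> (\<ominus> r) \<oplus>\<^bsub>quot\<^esub> x = \<zero>\<^bsub>quot\<^esub>"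
        by (simp add: c R.l_neg)
      then show ?thesis
        using 1 by (meson image_closed(5) level_in_quot)
    qed
    show "x \<oplus>\<^bsub>quot\<^esub> y \<in> carrier quot" if "x \<in> carrier quot" "y \<in> carrier quot" for x y
      using that by (elim quot_cases) (simp add: c)
    show "\<zero>\<^bsub>quot\<^esub> \<in> carrier quot" by (simp add: c)
    show "x \<oplus>\<^bsub>quot\<^esub> y \<oplus>\<^bsub>quot\<^esub> z = x \<oplus>\<^bsub>quot\<^esub> (y \<oplus>\<^bsub>quot\<^esub> z)"
      if "x \<in> carrier quot" "y \<in> carrier quot" "z \<in> carrier quot" for x y z
      using that by (elim quot_cases) (simp add: c R.a_assoc)
    show "x \<oplus>\<^bsub>quot\<^esub> y = y \<oplus>\<^bsub>quot\<^esub> x" if "x \<in> carrier quot" "y \<in> carrier quot" for x y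
      using that by (elim quot_cases) (simp add: c R.a_comm)
    show "\<zero>\<^bsub>quot\<^esub> \<oplus>\<^bsub>quot\<^esub> x = x" if "x \<in> carrier quot" for x
      using that by (elim quot_cases) (simp add: c)
  qed
  show "a \<odot>\<^bsub>quot\<^esub> x \<in> carrier quot" if "a \<in> carrier R" "x \<in> carrier quot" for a x
    using that by (elim quot_cases) (simp add: c)
  show "(a \<oplus> b) \<odot>\<^bsub>quot\<^esub> x = a \<odot>\<^bsub>quot\<^esub> x \<oplus>\<^bsub>quot\<^esub> b \<odot>\<^bsub>quot\<^esub> x"
    if "a \<in> carrier R" "b \<in> carrier R" "x \<in> carrier quot" for a b x
    using that by (elim quot_cases) (simp add: c R.l_distr)
  show "a \<odot>\<^bsub>quot\<^esub> (x \<oplus>\<^bsub>quot\<^esub> y) = a \<odot>\<^bsub>quot\<^esub> x \<oplus>\<^bsub>quot\<^esub> a \<odot>\<^bsub>quot\<^esub> y"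
    if "a \<in> carrier R" "x \<in> carrier quot" "y \<in> carrier quot" for a x y
    using that by (elim quot_cases) (simp add: c R.r_distr)
  show "(a \<otimes> b) \<odot>\<^bsub>quot\<^esub> x = a \<odot>\<^bsub>quot\<^esub> (b \<odot>\<^bsub>quot\<^esub> x)"
    if "a \<in> carrier R" "b \<in> carrier R" "x \<in> carrier quot" for a b x
    using that by (elim quot_cases) (simp add: c R.m_assoc)
  show "\<one> \<odot>\<^bsub>quot\<^esub> x = x" if "x \<in> carrier quot" for x
    using that by (elim quot_cases) (simp add: c)
qed

lemma quot_functional: "functional R quot (level_val \<phi>)"
proof -
  interpret Q: module R quot by (rule quot_module)
  show ?thesis
  proof
    show "level_val \<phi> x \<in> carrier R" if "x \<in> carrier quot" for x
      using that by (elim quot_cases) simp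
    show "level_val \<phi> (x \<oplus>\<^bsub>quot\<^esub> y) = level_val \<phi> x \<oplus> level_val \<phi> y"
      if "x \<in> carrier quot" "y \<in> carrier quot" for x y
      using that by (elim quot_cases) (simp add: quot_add image_closed)
    show "level_val \<phi> (r \<odot>\<^bsub>quot\<^esub> x) = r \<otimes> level_val \<phi> x"
      if "r \<in> carrier R" "x \<in> carrier quot" for r x
      using that by (elim quot_cases) (simp add: quot_smult image_closed)
  qed
qed

lemma level_level_val: "x \<in> carrier quot \<Longrightarrow> level M \<phi> (level_val \<phi> x) = x"
  by (elim quot_cases) simp

end

section \<open>Direct sums and functionals on them\<close>

lemma direct_sum_simps [simp]:
  "\<zero>\<^bsub>direct_sum I N\<^esub> = (\<lambda>i\<in>I. \<zero>\<^bsub>N i\<^esub>)"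
  "f \<oplus>\<^bsub>direct_sum I N\<^esub> g = (\<lambda>i\<in>I. f i \<oplus>\<^bsub>N i\<^esub> g i)"
  "r \<odot>\<^bsub>direct_sum I N\<^esub> f = (\<lambda>i\<in>I. r \<odot>\<^bsub>N i\<^esub> f i)"
  by (simp_all add: direct_sum_def)

lemma direct_sum_carrierI:
  assumes "f \<in> extensional I" "\<And>i. i \<in> I \<Longrightarrow> f i \<in> carrier (N i)" "finite {i \<in> I. f i \<noteq> \<zero>\<^bsub>N i\<^esub>}"
  shows "f \<in> carrier (direct_sum I N)"
  using assms by (auto simp: direct_sum_def PiE_def)

lemma direct_sum_carrierD:
  assumes "f \<in> carrier (direct_sum I N)"
  shows "f \<in> extensional I" "\<And>i. i \<in> I \<Longrightarrow> f i \<in> carrier (N i)" "finite {i \<in> I. f i \<noteq> \<zero>\<^bsub>N i\<^esub>}"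
  using assms by (auto simp: direct_sum_def PiE_def Pi_def)

lemma direct_sum_eqI:
  assumes "f \<in> carrier (direct_sum I N)" "g \<in> carrier (direct_sum I N)" "\<And>i. i \<in> I \<Longrightarrow> f i = g i"
  shows "f = g"
  by (rule extensionalityI[OF direct_sum_carrierD(1)[OF assms(1)] direct_sum_carrierD(1)[OF assms(2)] assms(3)])

locale module_family = cring R for R :: "('a, 'm) ring_scheme" (structure) +
  fixes I :: "'i set" and N :: "'i \<Rightarrow> ('a, 'b) module"
  assumes modules: "i \<in> I \<Longrightarrow> module R (N i)"
begin

lemma fam_abelian_group: "i \<in> I \<Longrightarrow> abelian_group (N i)"
  using modules module.axioms(2) by blast

lemma dsum_add_closed:
  assumes f: "f \<in> carrier (direct_sum I N)" and g: "g \<in> carrier (direct_sum I N)"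
  shows "(\<lambda>i\<in>I. f i \<oplus>\<^bsub>N i\<^esub> g i) \<in> carrier (direct_sum I N)"
proof (rule direct_sum_carrierI)
  note D = direct_sum_carrierD
  show "(\<lambda>i\<in>I. f i \<oplus>\<^bsub>N i\<^esub> g i) i \<in> carrier (N i)" if i: "i \<in> I" for i
    using i D(2)[OF f i] D(2)[OF g i] abelian_groupE(1)[OF fam_abelian_group] by simp
  have "{i \<in> I. (\<lambda>i\<in>I. f i \<oplus>\<^bsub>N i\<^esub> g i) i \<noteq> \<zero>\<^bsub>N i\<^esub>} \<subseteq> {i \<in> I. f i \<noteq> \<zero>\<^bsub>N i\<^esub>} \<union> {i \<in> I. g i \<noteq> \<zero>\<^bsub>N i\<^esub>}"
    using abelian_groupE(2,5)[OF fam_abelian_group] by auto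
  then show "finite {i \<in> I. (\<lambda>i\<in>I. f i \<oplus>\<^bsub>N i\<^esub> g i) i \<noteq> \<zero>\<^bsub>N i\<^esub>}"
    using D(3)[OF f] D(3)[OF g] finite_subset by blast
qed auto

lemma dsum_smult_closed:
  assumes r: "r \<in> carrier R" and f: "f \<in> carrier (direct_sum I N)"
  shows "(\<lambda>i\<in>I. r \<odot>\<^bsub>N i\<^esub> f i) \<in> carrier (direct_sum I N)"
proof (rule direct_sum_carrierI)
  note D = direct_sum_carrierD
  show "(\<lambda>i\<in>I. r \<odot>\<^bsub>N i\<^esub> f i) i \<in> carrier (N i)" if i: "i \<in> I" for i
    using i r D(2)[OF f i] module.smult_closed[OF modules] by simp
  have "{i \<in> I. (\<lambda>i\<in>I. r \<odot>\<^bsub>N i\<^esub> f i) i \<noteq> \<zero>\<^bsub>N i\<^esub>} \<subseteq> {i \<in> I. f i \<noteq> \<zero>\<^bsub>N i\<^esub>}"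
    using r by (auto simp: module.smult_r_null[OF modules])
  then show "finite {i \<in> I. (\<lambda>i\<in>I. r \<odot>\<^bsub>N i\<^esub> f i) i \<noteq> \<zero>\<^bsub>N i\<^esub>}"
    using D(3)[OF f] finite_subset by blast
qed auto

lemma dsum_zero_closed: "(\<lambda>i\<in>I. \<zero>\<^bsub>N i\<^esub>) \<in> carrier (direct_sum I N)"
  using abelian_groupE(2)[OF fam_abelian_group] by (intro direct_sum_carrierI) auto

lemma direct_sum_module: "module R (direct_sum I N)"
proof (rule moduleI)
  note D = direct_sum_carrierD(2) and G = abelian_groupE[OF fam_abelian_group]
  note C = dsum_add_closed dsum_smult_closed dsum_zero_closed
  show "cring R" by (rule cring_axioms)
  show "abelian_group (direct_sum I N)"
  proof (rule abelian_groupI)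
    fix f g h assume fgh: "f \<in> carrier (direct_sum I N)" "g \<in> carrier (direct_sum I N)"
      "h \<in> carrier (direct_sum I N)"
    show "f \<oplus>\<^bsub>direct_sum I N\<^esub> g \<oplus>\<^bsub>direct_sum I N\<^esub> h = f \<oplus>\<^bsub>direct_sum I N\<^esub> (g \<oplus>\<^bsub>direct_sum I N\<^esub> h)"
      using D[OF fgh(1)] D[OF fgh(2)] D[OF fgh(3)] by (auto simp: fun_eq_iff G(3))
  next
    fix f g assume fg: "f \<in> carrier (direct_sum I N)" "g \<in> carrier (direct_sum I N)"
    show "f \<oplus>\<^bsub>direct_sum I N\<^esub> g \<in> carrier (direct_sum I N)"
      using fg C by simp
    show "f \<oplus>\<^bsub>direct_sum I N\<^esub> g = g \<oplus>\<^bsub>direct_sum I N\<^esub> f"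
      using D[OF fg(1)] D[OF fg(2)] G(4) by (auto simp: fun_eq_iff)
  next
    fix f assume f: "f \<in> carrier (direct_sum I N)"
    have *: "\<zero>\<^bsub>direct_sum I N\<^esub> \<oplus>\<^bsub>direct_sum I N\<^esub> f = f"
      using D[OF f] f direct_sum_carrierD(1)[OF f]
      by (auto simp: fun_eq_iff G(5) extensional_def)
    show "\<zero>\<^bsub>direct_sum I N\<^esub> \<oplus>\<^bsub>direct_sum I N\<^esub> f = f" by (rule *)
    \<comment> \<open>The inverse of \<open>f\<close> is taken to be \<open>(-1) f\<close>, so that
      its finite support comes from closure under scalar multiplication.\<close>
    have "(\<ominus> \<one>) \<odot>\<^bsub>N i\<^esub> f i \<oplus>\<^bsub>N i\<^esub> f i = \<zero>\<^bsub>N i\<^esub>" if i: "i \<in> I" for i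
    proof -
      interpret M: module R "N i" using i by (rule modules)
      show ?thesis using D[OF f i] by (simp add: M.smult_l_minus M.M.l_neg)
    qed
    then show "\<exists>g\<in>carrier (direct_sum I N). g \<oplus>\<^bsub>direct_sum I N\<^esub> f = \<zero>\<^bsub>direct_sum I N\<^esub>"
      using C(2)[OF _ f, of "\<ominus> \<one>"] by (intro bexI[of _ "\<lambda>i\<in>I. (\<ominus> \<one>) \<odot>\<^bsub>N i\<^esub> f i"]) (auto cong: restrict_cong)
  qed (use C in auto)
  fix a b f g assume ab: "a \<in> carrier R" "b \<in> carrier R"
    and f: "f \<in> carrier (direct_sum I N)" and g: "g \<in> carrier (direct_sum I N)"
  show "a \<odot>\<^bsub>direct_sum I N\<^esub> f \<in> carrier (direct_sum I N)"
    using C ab f by simp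
  show "(a \<oplus> b) \<odot>\<^bsub>direct_sum I N\<^esub> f = a \<odot>\<^bsub>direct_sum I N\<^esub> f \<oplus>\<^bsub>direct_sum I N\<^esub> b \<odot>\<^bsub>direct_sum I N\<^esub> f"
    using D[OF f] ab by (auto simp: fun_eq_iff module.smult_l_distr[OF modules])
  show "(a \<otimes> b) \<odot>\<^bsub>direct_sum I N\<^esub> f = a \<odot>\<^bsub>direct_sum I N\<^esub> (b \<odot>\<^bsub>direct_sum I N\<^esub> f)"
    using D[OF f] ab by (auto simp: fun_eq_iff module.smult_assoc1[OF modules])
  show "a \<odot>\<^bsub>direct_sum I N\<^esub> (f \<oplus>\<^bsub>direct_sum I N\<^esub> g) = a \<odot>\<^bsub>direct_sum I N\<^esub> f \<oplus>\<^bsub>direct_sum I N\<^esub> a \<odot>\<^bsub>direct_sum I N\<^esub> g"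
    using D[OF f] D[OF g] ab by (auto simp: fun_eq_iff module.smult_r_distr[OF modules])
next
  fix f assume f: "f \<in> carrier (direct_sum I N)"
  show "\<one> \<odot>\<^bsub>direct_sum I N\<^esub> f = f"
    using direct_sum_carrierD[OF f]
    by (auto simp: fun_eq_iff module.smult_one[OF modules] extensional_def)
qed

lemma direct_sum_in_closed:
  assumes "i \<in> I \<Longrightarrow> x \<in> carrier (N i)"
  shows "direct_sum_in I N i x \<in> carrier (direct_sum I N)"
proof (rule direct_sum_carrierI)
  have "{j \<in> I. direct_sum_in I N i x j \<noteq> \<zero>\<^bsub>N j\<^esub>} \<subseteq> {i}"
    by (auto simp: direct_sum_in_def)
  then show "finite {j \<in> I. direct_sum_in I N i x j \<noteq> \<zero>\<^bsub>N j\<^esub>}"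
    using finite_subset by blast
qed (use assms abelian_groupE(2)[OF fam_abelian_group] in \<open>auto simp: direct_sum_in_def\<close>)

lemma direct_sum_in_add:
  assumes "i \<in> I" "x \<in> carrier (N i)" "y \<in> carrier (N i)"
  shows "direct_sum_in I N i (x \<oplus>\<^bsub>N i\<^esub> y) = direct_sum_in I N i x \<oplus>\<^bsub>direct_sum I N\<^esub> direct_sum_in I N i y"
  using assms abelian_groupE(2,5)[OF fam_abelian_group]
  by (auto simp: direct_sum_in_def fun_eq_iff)

lemma direct_sum_in_smult:
  assumes "i \<in> I" "r \<in> carrier R" "x \<in> carrier (N i)"
  shows "direct_sum_in I N i (r \<odot>\<^bsub>N i\<^esub> x) = r \<odot>\<^bsub>direct_sum I N\<^esub> direct_sum_in I N i x"
  using assms by (auto simp: direct_sum_in_def fun_eq_iff module.smult_r_null[OF modules])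

lemma direct_sum_in_zero: "direct_sum_in I N i \<zero>\<^bsub>N i\<^esub> = \<zero>\<^bsub>direct_sum I N\<^esub>"
  by (auto simp: direct_sum_in_def fun_eq_iff)

text \<open>A finitely supported family is a finite sum of families concentrated at one index, so it
  is enough to peel off one coordinate at a time.\<close>

lemma direct_sum_span:
  assumes S: "submodule S R (direct_sum I N)"
    and gen: "\<And>i x. i \<in> I \<Longrightarrow> x \<in> carrier (N i) \<Longrightarrow> direct_sum_in I N i x \<in> S"
  shows "carrier (direct_sum I N) \<subseteq> S"
proof
  fix f assume f: "f \<in> carrier (direct_sum I N)"
  interpret M: module R "direct_sum I N" by (rule direct_sum_module)
  \<comment> \<open>The induction is over a finite set containing the support: once coordinate
    \<open>a\<close> is cleared, the support lies in the smaller set, whether or not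
    \<open>f a\<close> was zero.\<close>
  have "f \<in> S" if "finite A" "f \<in> carrier (direct_sum I N)" "{i \<in> I. f i \<noteq> \<zero>\<^bsub>N i\<^esub>} \<subseteq> A" for A f
    using that
  proof (induction A arbitrary: f)
    case empty
    then have "f = \<zero>\<^bsub>direct_sum I N\<^esub>"
      by (intro direct_sum_eqI[OF empty(1) M.zero_closed]) auto
    moreover have "\<zero>\<^bsub>direct_sum I N\<^esub> \<in> S"
      using subgroup.one_closed[OF submodule.axioms(1)[OF S]] by (simp del: direct_sum_simps)
    ultimately show ?case by (simp only:)
  next
    case (insert a A)
    note f = insert.prems(1)
    show ?case
    proof (cases "a \<in> I")
      case False
      with insert show ?thesis by (intro insert.IH) auto
    next
      case a: True
      define g where "g = (\<lambda>i\<in>I. if i = a then \<zero>\<^bsub>N i\<^esub> else f i)"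
      have gA: "{i \<in> I. g i \<noteq> \<zero>\<^bsub>N i\<^esub>} \<subseteq> A" using insert.prems(2) by (auto simp: g_def)
      have g: "g \<in> carrier (direct_sum I N)"
        using direct_sum_carrierD[OF f] abelian_groupE(2)[OF fam_abelian_group] finite_subset[OF gA insert.hyps(1)]
        by (intro direct_sum_carrierI) (auto simp: g_def)
      have "f = g \<oplus>\<^bsub>direct_sum I N\<^esub> direct_sum_in I N a (f a)"
      proof (rule direct_sum_eqI[OF f])
        show "g \<oplus>\<^bsub>direct_sum I N\<^esub> direct_sum_in I N a (f a) \<in> carrier (direct_sum I N)"
          using g direct_sum_in_closed[of a "f a"] direct_sum_carrierD(2)[OF f] M.a_closed by blast
        fix i assume i: "i \<in> I"
        interpret Ni: abelian_group "N i" using i by (rule fam_abelian_group)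
        show "f i = (g \<oplus>\<^bsub>direct_sum I N\<^esub> direct_sum_in I N a (f a)) i"
          using i direct_sum_carrierD(2)[OF f i] abelian_groupE(5)[OF fam_abelian_group[OF i], of "f i"]
          by (cases "i = a") (auto simp: g_def direct_sum_in_def)
      qed
      moreover have "direct_sum_in I N a (f a) \<in> S"
        using a direct_sum_carrierD(2)[OF f] by (intro gen) auto
      ultimately show ?thesis
        using M.submoduleE(5)[OF S insert.IH[OF g gA]] by metis
    qed
  qed
  from this[OF direct_sum_carrierD(3)[OF f] f] show "f \<in> S" by simp
qed

end

text \<open>Only the support is summed because the index set can be infinite, as for tuples over an
  infinite ring, where \<open>finsum\<close> would return its default value zero.\<close>

definition dsum_fun :: "('a, 'm) ring_scheme \<Rightarrow> 'i set \<Rightarrow> ('i \<Rightarrow> ('a, 'b) module) \<Rightarrow> ('i \<Rightarrow> 'b \<Rightarrow> 'a)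
    \<Rightarrow> ('i \<Rightarrow> 'b) \<Rightarrow> 'a" where
  "dsum_fun R I N \<phi> f = (\<Oplus>\<^bsub>R\<^esub>i\<in>{i \<in> I. f i \<noteq> \<zero>\<^bsub>N i\<^esub>}. \<phi> i (f i))"

locale functional_family = cring R for R :: "('a, 'm) ring_scheme" (structure) +
  fixes I :: "'i set" and N :: "'i \<Rightarrow> ('a, 'b) module" and \<phi> :: "'i \<Rightarrow> 'b \<Rightarrow> 'a"
  assumes functionals: "i \<in> I \<Longrightarrow> functional R (N i) (\<phi> i)"

sublocale functional_family \<subseteq> module_family
  by (intro module_family.intro cring_axioms module_family_axioms.intro)
    (rule functional.axioms(1)[OF functionals])

context functional_family begin

text \<open>The supports of \<open>f\<close>, \<open>g\<close> and \<open>f + g\<close> differ. A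
  common finite set \<open>A\<close> makes their sums comparable, the additional terms being
  zero.\<close>

lemma dsum_fun_eq:
  assumes "finite A" "A \<subseteq> I" "{i \<in> I. f i \<noteq> \<zero>\<^bsub>N i\<^esub>} \<subseteq> A" "f \<in> carrier (direct_sum I N)"
  shows "dsum_fun R I N \<phi> f = (\<Oplus>i\<in>A. \<phi> i (f i))"
  unfolding dsum_fun_def using assms direct_sum_carrierD(2)[OF assms(4)] functional.fun_closed[OF functionals]
  by (intro add.finprod_mono_neutral_cong_left) (auto simp: functional.fun_zero[OF functionals])

lemma dsum_fun_in:
  assumes "i \<in> I" "x \<in> carrier (N i)"
  shows "dsum_fun R I N \<phi> (direct_sum_in I N i x) = \<phi> i x"
proof -
  have "dsum_fun R I N \<phi> (direct_sum_in I N i x) = (\<Oplus>j\<in>{i}. \<phi> j (direct_sum_in I N i x j))"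
    using assms by (intro dsum_fun_eq direct_sum_in_closed) (auto simp: direct_sum_in_def)
  also have "\<dots> = \<phi> i x"
    using assms functional.fun_closed[OF functionals] by (simp add: direct_sum_in_def)
  finally show ?thesis .
qed

lemma dsum_functional: "functional R (direct_sum I N) (dsum_fun R I N \<phi>)"
proof -
  interpret M: module R "direct_sum I N" by (rule direct_sum_module)
  note D = direct_sum_carrierD
  show ?thesis
  proof
    fix f assume f: "f \<in> carrier (direct_sum I N)"
    show "dsum_fun R I N \<phi> f \<in> carrier R"
      unfolding dsum_fun_def using D(2)[OF f] functional.fun_closed[OF functionals]
      by (intro finsum_closed) auto
    fix r assume r: "r \<in> carrier R"
    let ?A = "{i \<in> I. f i \<noteq> \<zero>\<^bsub>N i\<^esub>}"
    have "dsum_fun R I N \<phi> (r \<odot>\<^bsub>direct_sum I N\<^esub> f) = (\<Oplus>i\<in>?A. \<phi> i ((r \<odot>\<^bsub>direct_sum I N\<^esub> f) i))"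
      using D(3)[OF f] r f M.smult_closed by (intro dsum_fun_eq) (auto simp: module.smult_r_null[OF modules])
    also have "\<dots> = (\<Oplus>i\<in>?A. r \<otimes> \<phi> i (f i))"
      using D(2)[OF f] r by (intro finsum_cong') (auto simp: functional.fun_smult[OF functionals] functional.fun_closed[OF functionals])
    also have "\<dots> = r \<otimes> dsum_fun R I N \<phi> f"
      unfolding dsum_fun_def using D(2)[OF f] D(3)[OF f] r
      by (intro finsum_rdistr[symmetric]) (auto simp: functional.fun_closed[OF functionals])
    finally show "dsum_fun R I N \<phi> (r \<odot>\<^bsub>direct_sum I N\<^esub> f) = r \<otimes> dsum_fun R I N \<phi> f" .
  next
    fix f g assume f: "f \<in> carrier (direct_sum I N)" and g: "g \<in> carrier (direct_sum I N)"
    let ?A = "{i \<in> I. f i \<noteq> \<zero>\<^bsub>N i\<^esub>} \<union> {i \<in> I. g i \<noteq> \<zero>\<^bsub>N i\<^esub>}"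
    have A: "finite ?A" "?A \<subseteq> I" using D(3)[OF f] D(3)[OF g] by auto
    have "dsum_fun R I N \<phi> (f \<oplus>\<^bsub>direct_sum I N\<^esub> g) = (\<Oplus>i\<in>?A. \<phi> i ((f \<oplus>\<^bsub>direct_sum I N\<^esub> g) i))"
      using A f g M.a_closed abelian_groupE(2,5)[OF fam_abelian_group] by (intro dsum_fun_eq) auto
    also have "\<dots> = (\<Oplus>i\<in>?A. \<phi> i (f i) \<oplus> \<phi> i (g i))"
      using D(2)[OF f] D(2)[OF g]
      by (intro finsum_cong') (auto simp: functional.fun_add[OF functionals] functional.fun_closed[OF functionals])
    also have "\<dots> = (\<Oplus>i\<in>?A. \<phi> i (f i)) \<oplus> (\<Oplus>i\<in>?A. \<phi> i (g i))"
      using D(2)[OF f] D(2)[OF g] by (intro finsum_addf) (auto simp: functional.fun_closed[OF functionals])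
    also have "\<dots> = dsum_fun R I N \<phi> f \<oplus> dsum_fun R I N \<phi> g"
      using A f g dsum_fun_eq[of ?A f] dsum_fun_eq[of ?A g] by auto
    finally show "dsum_fun R I N \<phi> (f \<oplus>\<^bsub>direct_sum I N\<^esub> g) = dsum_fun R I N \<phi> f \<oplus> dsum_fun R I N \<phi> g" .
  qed
qed

end

section \<open>Lists of choices and products of scalars along lists\<close>

lemma listset_iff: "xs \<in> listset As \<longleftrightarrow> length xs = length As \<and> (\<forall>i<length As. xs ! i \<in> As ! i)"
proof -
  have "xs \<in> listset As \<longleftrightarrow> list_all2 (\<in>) xs As"
    by (induction As arbitrary: xs) (auto simp: set_Cons_def list_all2_Cons2)
  then show ?thesis by (auto simp: list_all2_conv_all_nth)
qed

lemma finite_listset: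
  assumes "\<And>A. A \<in> set As \<Longrightarrow> finite A"
  shows "finite (listset As)"
  using assms
proof (induction As)
  case (Cons A As)
  have "set_Cons A (listset As) = (\<lambda>(x, xs). x # xs) ` (A \<times> listset As)"
    by (auto simp: set_Cons_def)
  with Cons show ?case by simp
qed simp

lemma listset_nonempty:
  assumes "\<And>A. A \<in> set As \<Longrightarrow> A \<noteq> {}"
  shows "listset As \<noteq> {}"
  using assms by (induction As) (auto simp: set_Cons_def)

lemma tuples_iff:
  "xs \<in> tuples Ms \<longleftrightarrow> length xs = length Ms \<and> (\<forall>i<length Ms. xs ! i \<in> carrier (Ms ! i))"
  by (simp add: tuples_def listset_iff)

lemma tuples_append: "xs \<in> tuples Ms \<Longrightarrow> ys \<in> tuples Ns \<Longrightarrow> xs @ ys \<in> tuples (Ms @ Ns)"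
  by (auto simp: tuples_iff nth_append)

lemma tuples_concat:
  assumes "length xss = length Mss" "\<And>j. j < length Mss \<Longrightarrow> xss ! j \<in> tuples (Mss ! j)"
  shows "concat xss \<in> tuples (concat Mss)"
  using assms
proof (induction xss Mss rule: list_induct2)
  case Nil show ?case by (simp add: tuples_def)
next
  case (Cons x xs y ys)
  have "x \<in> tuples y" using Cons.prems[of 0] by simp
  moreover have "xs ! j \<in> tuples (ys ! j)" if "j < length ys" for j
    using Cons.prems[of "Suc j"] that by simp
  ultimately show ?case using Cons.IH tuples_append by auto
qed

text \<open>Arguments of a composition come as lists, so products are taken along lists;
  concatenating arguments then multiplies their products.\<close>

definition lprod :: "('a, 'm) ring_scheme \<Rightarrow> 'a list \<Rightarrow> 'a" where
  "lprod R xs = foldr (monoid.mult R) xs \<one>\<^bsub>R\<^esub>"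

lemma lprod_simps [simp]: "lprod R [] = \<one>\<^bsub>R\<^esub>" "lprod R (x # xs) = x \<otimes>\<^bsub>R\<^esub> lprod R xs"
  by (simp_all add: lprod_def)

context cring begin

lemma lprod_closed [simp]: "set xs \<subseteq> carrier R \<Longrightarrow> lprod R xs \<in> carrier R"
  by (induction xs) auto

lemma lprod_append:
  "set xs \<subseteq> carrier R \<Longrightarrow> set ys \<subseteq> carrier R \<Longrightarrow> lprod R (xs @ ys) = lprod R xs \<otimes> lprod R ys"
  by (induction xs) (auto simp: m_assoc)

lemma lprod_concat:
  "(\<And>xs. xs \<in> set xss \<Longrightarrow> set xs \<subseteq> carrier R) \<Longrightarrow> lprod R (concat xss) = lprod R (map (lprod R) xss)"
proof (induction xss)
  case (Cons xs xss)
  then have "set xs \<subseteq> carrier R" "set (concat xss) \<subseteq> carrier R" by auto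
  with Cons show ?case by (simp add: lprod_append)
qed simp

lemma lprod_update_add:
  "set xs \<subseteq> carrier R \<Longrightarrow> i < length xs \<Longrightarrow> x \<in> carrier R \<Longrightarrow> y \<in> carrier R \<Longrightarrow>
    lprod R (xs[i := x \<oplus> y]) = lprod R (xs[i := x]) \<oplus> lprod R (xs[i := y])"
proof (induction xs arbitrary: i)
  case (Cons z zs)
  then show ?case
    by (cases i) (simp_all add: l_distr r_distr lprod_closed set_update_subsetI)
qed simp

lemma lprod_update_smult:
  "set xs \<subseteq> carrier R \<Longrightarrow> i < length xs \<Longrightarrow> r \<in> carrier R \<Longrightarrow> x \<in> carrier R \<Longrightarrow>
    lprod R (xs[i := r \<otimes> x]) = r \<otimes> lprod R (xs[i := x])"
proof (induction xs arbitrary: i)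
  case (Cons z zs)
  then show ?case
    by (cases i) (simp_all add: m_assoc m_lcomm lprod_closed set_update_subsetI)
qed simp

lemma lprod_zero: "set xs \<subseteq> carrier R \<Longrightarrow> \<zero> \<in> set xs \<Longrightarrow> lprod R xs = \<zero>"
  by (induction xs) auto

lemma lprod_replicate_one [simp]: "lprod R (replicate n \<one>) = \<one>"
  by (induction n) auto

lemma lprod_map_mult:
  "(\<And>i. i \<in> set is \<Longrightarrow> f i \<in> carrier R) \<Longrightarrow> (\<And>i. i \<in> set is \<Longrightarrow> g i \<in> carrier R) \<Longrightarrow>
    lprod R (map (\<lambda>i. f i \<otimes> g i) is) = lprod R (map f is) \<otimes> lprod R (map g is)"
proof (induction "is")
  case (Cons i "is")
  then have "lprod R (map f is) \<in> carrier R" "lprod R (map g is) \<in> carrier R"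
    by (auto intro!: lprod_closed)
  with Cons show ?case by (simp add: m_assoc m_lcomm)
qed simp

lemma finprod_lessThan_lprod:
  "(\<And>i. i < n \<Longrightarrow> f i \<in> carrier R) \<Longrightarrow> (\<Otimes>i\<in>{..<n}. f i) = lprod R (map f [0..<n])"
proof (induction n)
  case (Suc n)
  then have c: "f \<in> {..<n} \<rightarrow> carrier R" "f n \<in> carrier R" "set (map f [0..<n]) \<subseteq> carrier R" by auto
  have "(\<Otimes>i\<in>{..<Suc n}. f i) = f n \<otimes> (\<Otimes>i\<in>{..<n}. f i)"
    unfolding lessThan_Suc using c by (intro finprod_insert) auto
  also have "\<dots> = lprod R (map f [0..<Suc n])"
    using Suc c by (simp add: lprod_append m_comm)
  finally show ?case .
qed simp

text \<open>One step of expanding a product of sums: a choice from \<open>A\<close> and a choice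
  from \<open>B\<close> are the head and the tail of a list.\<close>

lemma finsum_set_Cons:
  assumes "finite A" and B: "finite B" and f: "f \<in> A \<rightarrow> carrier R" and h: "h \<in> B \<rightarrow> carrier R"
  shows "(\<Oplus>z\<in>set_Cons A B. f (hd z) \<otimes> h (tl z)) = finsum R f A \<otimes> finsum R h B"
  using assms(1) f
proof (induction A)
  case empty
  have "set_Cons {} B = {}" by (auto simp: set_Cons_def)
  then show ?case using finsum_closed[OF h] by simp
next
  case (insert a A)
  have eq: "set_Cons (insert a A) B = (#) a ` B \<union> set_Cons A B"
    by (auto simp: set_Cons_def)
  have "set_Cons A B = (\<lambda>(x, xs). x # xs) ` (A \<times> B)"
    by (auto simp: set_Cons_def)
  then have fin: "finite (set_Cons A B)" using insert B by simp
  have fa: "f a \<in> carrier R" "f \<in> A \<rightarrow> carrier R" using insert.prems by auto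
  note hB = finsum_closed[OF h] and fA = finsum_closed[OF fa(2)]
  have "(\<Oplus>z\<in>set_Cons (insert a A) B. f (hd z) \<otimes> h (tl z))
      = (\<Oplus>z\<in>(#) a ` B. f (hd z) \<otimes> h (tl z)) \<oplus> (\<Oplus>z\<in>set_Cons A B. f (hd z) \<otimes> h (tl z))"
    unfolding eq using fin B fa h insert.hyps funcset_mem[OF fa(2)] funcset_mem[OF h]
    by (intro finsum_Un_disjoint) (auto simp: set_Cons_def)
  also have "(\<Oplus>z\<in>(#) a ` B. f (hd z) \<otimes> h (tl z)) = (\<Oplus>z\<in>B. f a \<otimes> h z)"
    using fa funcset_mem[OF h] by (subst finsum_reindex) (auto simp: inj_on_def)
  also have "\<dots> = f a \<otimes> finsum R h B"
    using B fa h by (intro finsum_rdistr[symmetric]) auto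
  also have "(\<Oplus>z\<in>set_Cons A B. f (hd z) \<otimes> h (tl z)) = finsum R f A \<otimes> finsum R h B"
    using insert.IH fa by simp
  also have "f a \<otimes> finsum R h B \<oplus> finsum R f A \<otimes> finsum R h B = (f a \<oplus> finsum R f A) \<otimes> finsum R h B"
    using fa hB fA by (simp add: l_distr)
  also have "f a \<oplus> finsum R f A = finsum R f (insert a A)"
    using insert fa by (intro finsum_insert[symmetric]) auto
  finally show ?case .
qed

text \<open>Distributivity in general form, by induction on the number of factors. It serves twice:
  for the concatenation of tensors and for the multiplicativity of the sum of coordinates.\<close>

lemma finsum_listset_lprod:
  assumes "\<And>i. i < length As \<Longrightarrow> finite (As ! i)"
    and "\<And>i x. i < length As \<Longrightarrow> x \<in> As ! i \<Longrightarrow> g i x \<in> carrier R"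
  shows "(\<Oplus>xs\<in>listset As. lprod R (map (\<lambda>i. g i (xs ! i)) [0..<length As]))
    = lprod R (map (\<lambda>i. \<Oplus>x\<in>As ! i. g i x) [0..<length As])"
  using assms
proof (induction As arbitrary: g)
  case Nil then show ?case by simp
next
  case (Cons A As)
  define h where "h = (\<lambda>xs. lprod R (map (\<lambda>i. g (Suc i) (xs ! i)) [0..<length As]))"
  have upt: "[0..<Suc n] = 0 # map Suc [0..<n]" for n
    by (simp add: map_Suc_upt upt_conv_Cons)
  have A: "finite A" "g 0 \<in> A \<rightarrow> carrier R" using Cons.prems(1)[of 0] Cons.prems(2)[of 0] by auto
  have As: "finite (As ! i)" "x \<in> As ! i \<Longrightarrow> g (Suc i) x \<in> carrier R" if "i < length As" for i x
    using Cons.prems(1)[of "Suc i"] Cons.prems(2)[of "Suc i"] that by auto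
  have fin: "finite (listset As)"
    using As by (intro finite_listset) (auto simp: in_set_conv_nth)
  have h: "h \<in> listset As \<rightarrow> carrier R"
    using As(2) by (auto simp: h_def listset_iff intro!: lprod_closed)
  have "(\<Oplus>xs\<in>listset (A # As). lprod R (map (\<lambda>i. g i (xs ! i)) [0..<length (A # As)]))
      = (\<Oplus>z\<in>set_Cons A (listset As). g 0 (hd z) \<otimes> h (tl z))"
    using funcset_mem[OF A(2)] funcset_mem[OF h, unfolded h_def]
    by (intro finsum_cong') (auto simp: set_Cons_def upt h_def comp_def simp del: upt_Suc)
  also have "\<dots> = finsum R (g 0) A \<otimes> finsum R h (listset As)"
    by (rule finsum_set_Cons[OF A(1) fin A(2) h])
  also have "finsum R h (listset As) = lprod R (map (\<lambda>i. \<Oplus>x\<in>As ! i. g (Suc i) x) [0..<length As])"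
    unfolding h_def using As by (intro Cons.IH)
  finally show ?case by (simp add: upt comp_def del: upt_Suc)
qed

end

section \<open>Tensor products of trivial and regular modules\<close>

lemma regular_module_simps [simp]:
  "carrier (regular_module R) = carrier R" "\<zero>\<^bsub>regular_module R\<^esub> = \<zero>\<^bsub>R\<^esub>"
  "add (regular_module R) = add R" "smult (regular_module R) = monoid.mult R"
  by (simp_all add: regular_module_def)

text \<open>The two modules that \<open>binary_gen\<close> can produce. The zero module keeps the
  operations of the ring, so computations in either take place in the ring itself.\<close>

definition scalar_module :: "('a, 'm) ring_scheme \<Rightarrow> ('a, 'a) module \<Rightarrow> bool" where
  "scalar_module R N \<longleftrightarrow> N = regular_module R \<or> N = (regular_module R)\<lparr>carrier := {\<zero>\<^bsub>R\<^esub>}\<rparr>"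

text \<open>The basis vector of \<open>xs\<close> is sent to the product of its entries: this is the
  multiplication map out of the tensor product, before the relations are divided out.\<close>

definition tensor_fun :: "('a, 'm) ring_scheme \<Rightarrow> ('a, 'a) module list \<Rightarrow> ('a list \<Rightarrow> 'a) \<Rightarrow> 'a" where
  "tensor_fun R Ms = dsum_fun R (tuples Ms) (\<lambda>_. regular_module R) (\<lambda>xs r. r \<otimes>\<^bsub>R\<^esub> lprod R xs)"

definition tensor_level :: "('a, 'm) ring_scheme \<Rightarrow> ('a, 'a) module list \<Rightarrow> 'a \<Rightarrow> ('a list \<Rightarrow> 'a) set" where
  "tensor_level R Ms = level (free_module R (tuples Ms)) (tensor_fun R Ms)"

definition tensor_val :: "('a, 'm) ring_scheme \<Rightarrow> ('a, 'a) module list \<Rightarrow> ('a list \<Rightarrow> 'a) set \<Rightarrow> 'a" where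
  "tensor_val R Ms = level_val (tensor_fun R Ms)"

text \<open>The image of the multiplication map: the ring if all factors are the ring, and zero if
  some factor is zero. Fibres over other scalars are empty, so this is the set of admissible
  labels.\<close>

definition scalar_values :: "('a, 'm) ring_scheme \<Rightarrow> ('a, 'a) module list \<Rightarrow> 'a set" where
  "scalar_values R Ms = tensor_fun R Ms ` carrier (free_module R (tuples Ms))"

context cring begin

lemma scalar_module_simps:
  assumes "scalar_module R N"
  shows "add N = add R" "smult N = monoid.mult R" "\<zero>\<^bsub>N\<^esub> = \<zero>" "carrier N \<subseteq> carrier R"
  using assms by (auto simp: scalar_module_def regular_module_def)

lemma module_regular: "module R (regular_module R)"
proof (rule moduleI)
  show "abelian_group (regular_module R)"
  proof (rule abelian_groupI)
    show "\<exists>y\<in>carrier (regular_module R). y \<oplus>\<^bsub>regular_module R\<^esub> x = \<zero>\<^bsub>regular_module R\<^esub>"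
      if "x \<in> carrier (regular_module R)" for x
      using that l_neg by auto
  qed (auto simp: a_ac)
qed (auto simp: l_distr r_distr m_assoc cring_axioms)

lemma functional_scale: "w \<in> carrier R \<Longrightarrow> functional R (regular_module R) (\<lambda>r. r \<otimes> w)"
  by (intro functional.intro functional_axioms.intro module_regular)
    (auto simp: l_distr m_assoc)

end

locale scalar_tensor = cring R for R :: "('a, 'm) ring_scheme" (structure) +
  fixes Ms :: "('a, 'a) module list"
  assumes scalar: "N \<in> set Ms \<Longrightarrow> scalar_module R N"
begin

lemma scalar_nth: "i < length Ms \<Longrightarrow> scalar_module R (Ms ! i)"
  using scalar by simp

lemma tuples_carrier: "xs \<in> tuples Ms \<Longrightarrow> set xs \<subseteq> carrier R"
  using scalar_module_simps(4)[OF scalar_nth] by (fastforce simp: tuples_iff in_set_conv_nth)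

sublocale FF: functional_family R "tuples Ms" "\<lambda>_. regular_module R" "\<lambda>xs r. r \<otimes> lprod R xs"
  by (intro functional_family.intro functional_family_axioms.intro cring_axioms functional_scale
      lprod_closed tuples_carrier)

sublocale TF: functional R "free_module R (tuples Ms)" "tensor_fun R Ms"
  unfolding tensor_fun_def free_module_def by (rule FF.dsum_functional)

lemma basis_vec_closed [simp]: "xs \<in> tuples Ms \<Longrightarrow> basis_vec R (tuples Ms) xs \<in> carrier (free_module R (tuples Ms))"
  unfolding basis_vec_def free_module_def by (intro FF.direct_sum_in_closed) auto

lemma tensor_fun_basis_vec [simp]:
  assumes "xs \<in> tuples Ms" shows "tensor_fun R Ms (basis_vec R (tuples Ms) xs) = lprod R xs"
  using assms tuples_carrier[OF assms] unfolding basis_vec_def tensor_fun_def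
  by (subst FF.dsum_fun_in) auto

lemma free_module_span:
  assumes S: "submodule S R (free_module R (tuples Ms))"
    and "\<And>xs. xs \<in> tuples Ms \<Longrightarrow> basis_vec R (tuples Ms) xs \<in> S"
  shows "carrier (free_module R (tuples Ms)) \<subseteq> S"
  unfolding free_module_def
proof (rule FF.direct_sum_span)
  show "submodule S R (direct_sum (tuples Ms) (\<lambda>_. regular_module R))"
    using S by (simp add: free_module_def)
  fix xs r assume xs: "xs \<in> tuples Ms" and r: "r \<in> carrier (regular_module R)"
  have "r \<odot>\<^bsub>free_module R (tuples Ms)\<^esub> basis_vec R (tuples Ms) xs \<in> S"
    using assms xs r TF.submoduleE(4)[OF S] by auto
  then show "direct_sum_in (tuples Ms) (\<lambda>_. regular_module R) xs r \<in> S"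
    using FF.direct_sum_in_smult[OF xs, of r \<one>] xs r by (simp add: free_module_def basis_vec_def)
qed

text \<open>Modulo the multilinearity relations every basis vector is a multiple of a single one, which
  is why the relations generate the whole kernel of \<^const>\<open>tensor_fun\<close>.\<close>

lemma basis_vec_reduce:
  assumes N: "submodule N R (free_module R (tuples Ms))" and rels: "tensor_rels R Ms \<subseteq> N"
  shows "\<exists>u\<in>carrier (free_module R (tuples Ms)). \<forall>xs\<in>tuples Ms.
    basis_vec R (tuples Ms) xs \<ominus>\<^bsub>free_module R (tuples Ms)\<^esub> lprod R xs \<odot>\<^bsub>free_module R (tuples Ms)\<^esub> u \<in> N"
proof -
  let ?F = "free_module R (tuples Ms)" and ?e = "basis_vec R (tuples Ms)"
  have scale: "?e (xs[i := r \<otimes> x]) \<ominus>\<^bsub>?F\<^esub> (r \<odot>\<^bsub>?F\<^esub> ?e (xs[i := x])) \<in> N"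
    if "xs \<in> tuples Ms" "i < length Ms" "r \<in> carrier R" "x \<in> carrier (Ms ! i)" for xs i r x
  proof -
    have "?e (xs[i := r \<odot>\<^bsub>Ms ! i\<^esub> x]) \<ominus>\<^bsub>?F\<^esub> (r \<odot>\<^bsub>?F\<^esub> ?e (xs[i := x])) \<in> tensor_rels R Ms"
      using that unfolding tensor_rels_def Let_def by blast
    then show ?thesis using rels scalar_module_simps(2)[OF scalar_nth] that(2) by auto
  qed
  show ?thesis
  proof (cases "\<forall>N\<in>set Ms. N = regular_module R")
    case True
    then have reg: "Ms ! i = regular_module R" if "i < length Ms" for i using that by simp
    \<comment> \<open>\<open>?o k xs\<close> has its first \<open>k\<close> entries replaced by one.
      Pulling entries out of the basis vector from left to right makes all tuples end at the same
      tuple of ones, whose basis vector is \<open>u\<close>.\<close>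
    let ?o = "\<lambda>k xs. replicate k \<one> @ drop k xs"
    have mem: "?o k xs \<in> tuples Ms" if "xs \<in> tuples Ms" "k \<le> length Ms" for k xs
      using that reg by (auto simp: tuples_iff nth_append)
    have P: "?e xs \<ominus>\<^bsub>?F\<^esub> lprod R (take k xs) \<odot>\<^bsub>?F\<^esub> ?e (?o k xs) \<in> N"
      if xs: "xs \<in> tuples Ms" and k: "k \<le> length Ms" for xs k
      using k
    proof (induction k)
      case 0
      then show ?case using xs subgroup.one_closed[OF submodule.axioms(1)[OF N]]
        by (simp add: TF.M.r_neg a_minus_def)
    next
      case (Suc k)
      have len: "length xs = length Ms" using xs by (simp add: tuples_iff)
      have c: "set (take k xs) \<subseteq> carrier R" "xs ! k \<in> carrier R"
        using tuples_carrier[OF xs] Suc.prems len set_take_subset[of k xs] by (auto)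
      let ?p = "lprod R (take k xs)"
      have p: "?p \<in> carrier R" using c by simp
      have ok: "?o k xs = (?o k xs)[k := xs ! k \<otimes> \<one>]"
        using c Suc.prems len by (simp add: list_update_append drop_update_swap Cons_nth_drop_Suc[symmetric])
      have ok': "?o (Suc k) xs = (?o k xs)[k := \<one>]"
        using Suc.prems len by (simp add: list_update_append Cons_nth_drop_Suc[symmetric] replicate_app_Cons_same)
      have "?e ((?o k xs)[k := xs ! k \<otimes> \<one>]) \<ominus>\<^bsub>?F\<^esub> (xs ! k \<odot>\<^bsub>?F\<^esub> ?e ((?o k xs)[k := \<one>])) \<in> N"
        using Suc.prems reg c xs by (intro scale mem) auto
      then have 1: "?e (?o k xs) \<ominus>\<^bsub>?F\<^esub> (xs ! k \<odot>\<^bsub>?F\<^esub> ?e (?o (Suc k) xs)) \<in> N"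
        using ok ok' by simp
      have cl: "?e xs \<in> carrier ?F" "?e (?o k xs) \<in> carrier ?F" "?e (?o (Suc k) xs) \<in> carrier ?F"
        using basis_vec_closed[OF mem[OF xs Suc.prems]] basis_vec_closed[OF mem[OF xs, of k]] xs Suc.prems
        by auto
      \<comment> \<open>Telescoping: the congruence for \<open>k\<close> is added to
        \<open>?p\<close> times the relation that pulls out entry \<open>k\<close>.\<close>
      have "(?e xs \<ominus>\<^bsub>?F\<^esub> ?p \<odot>\<^bsub>?F\<^esub> ?e (?o k xs))
          \<oplus>\<^bsub>?F\<^esub> ?p \<odot>\<^bsub>?F\<^esub> (?e (?o k xs) \<ominus>\<^bsub>?F\<^esub> (xs ! k \<odot>\<^bsub>?F\<^esub> ?e (?o (Suc k) xs))) \<in> N"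
        using Suc 1 p by (intro TF.submoduleE(4,5)[OF N]) auto
      also have "(?e xs \<ominus>\<^bsub>?F\<^esub> ?p \<odot>\<^bsub>?F\<^esub> ?e (?o k xs))
          \<oplus>\<^bsub>?F\<^esub> ?p \<odot>\<^bsub>?F\<^esub> (?e (?o k xs) \<ominus>\<^bsub>?F\<^esub> (xs ! k \<odot>\<^bsub>?F\<^esub> ?e (?o (Suc k) xs)))
        = ?e xs \<ominus>\<^bsub>?F\<^esub> (?p \<otimes> xs ! k) \<odot>\<^bsub>?F\<^esub> ?e (?o (Suc k) xs)"
        using cl p c
        by (simp add: a_minus_def TF.smult_r_distr TF.smult_r_minus TF.smult_assoc1 TF.M.a_assoc TF.M.r_neg1)
      also have "?p \<otimes> xs ! k = lprod R (take (Suc k) xs)"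
        using c Suc.prems len by (simp add: take_Suc_conv_app_nth lprod_append)
      finally show ?case .
    qed
    have "?e xs \<ominus>\<^bsub>?F\<^esub> lprod R xs \<odot>\<^bsub>?F\<^esub> ?e (replicate (length Ms) \<one>) \<in> N" if xs: "xs \<in> tuples Ms" for xs
      using P[OF xs order.refl] xs by (simp add: tuples_iff)
    moreover have "replicate (length Ms) \<one> \<in> tuples Ms" using reg by (simp add: tuples_iff)
    ultimately show ?thesis using basis_vec_closed by blast
  next
    case False
    then obtain i where i: "i < length Ms" "Ms ! i \<noteq> regular_module R"
      by (auto simp: in_set_conv_nth)
    then have Mi: "carrier (Ms ! i) = {\<zero>}" using scalar_nth[of i] by (auto simp: scalar_module_def)
    have "?e xs \<ominus>\<^bsub>?F\<^esub> lprod R xs \<odot>\<^bsub>?F\<^esub> \<zero>\<^bsub>?F\<^esub> \<in> N" if xs: "xs \<in> tuples Ms" for xs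
    proof -
      have xi: "xs ! i = \<zero>" "i < length xs" using xs i Mi by (auto simp: tuples_iff)
      \<comment> \<open>The entry in a zero factor is \<open>0 = 0 * 0\<close>, so the scaling
        relation with \<open>r = 0\<close> puts the basis vector itself into \<open>N\<close>, and
        \<open>u = 0\<close> serves.\<close>
      have "?e (xs[i := \<zero> \<otimes> \<zero>]) \<ominus>\<^bsub>?F\<^esub> (\<zero> \<odot>\<^bsub>?F\<^esub> ?e (xs[i := \<zero>])) \<in> N"
        using xs i Mi by (intro scale) auto
      moreover have "xs[i := \<zero>] = xs" using xi by (metis list_update_id)
      ultimately show ?thesis using xs tuples_carrier[OF xs] by simp
    qed
    then show ?thesis by (intro bexI[of _ "\<zero>\<^bsub>?F\<^esub>"]) auto
  qed
qed

text \<open>The product of a list is multilinear in its entries, and each factor has the operations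
  of the ring.\<close>

lemma tensor_rels_ker: "tensor_rels R Ms \<subseteq> tensor_level R Ms \<zero>"
proof -
  let ?F = "free_module R (tuples Ms)" and ?e = "basis_vec R (tuples Ms)"
  have upd: "xs[i := x] \<in> tuples Ms" "i < length xs" if "xs \<in> tuples Ms" "i < length Ms" "x \<in> carrier (Ms ! i)" for xs i x
    using that by (auto simp: tuples_iff nth_list_update)
  have md: "x \<oplus> y \<in> carrier (Ms ! i)" if "i < length Ms" "x \<in> carrier (Ms ! i)" "y \<in> carrier (Ms ! i)" for i x y
    using that scalar_nth[of i] by (auto simp: scalar_module_def)
  have sm: "r \<otimes> x \<in> carrier (Ms ! i)" if "i < length Ms" "r \<in> carrier R" "x \<in> carrier (Ms ! i)" for i x r
    using that scalar_nth[of i] by (auto simp: scalar_module_def)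
  have 1: "?e (xs[i := x \<oplus>\<^bsub>Ms ! i\<^esub> y]) \<ominus>\<^bsub>?F\<^esub> (?e (xs[i := x]) \<oplus>\<^bsub>?F\<^esub> ?e (xs[i := y])) \<in> tensor_level R Ms \<zero>"
    if t: "xs \<in> tuples Ms" "i < length Ms" "x \<in> carrier (Ms ! i)" "y \<in> carrier (Ms ! i)" for xs i x y
  proof -
    have xy: "x \<in> carrier R" "y \<in> carrier R" "set xs \<subseteq> carrier R"
      using t scalar_module_simps(4)[OF scalar_nth[OF t(2)]] tuples_carrier by auto
    note u = upd[OF t(1,2) md[OF t(2-4)]] upd[OF t(1-3)] upd[OF t(1,2,4)]
    have "lprod R (xs[i := x]) \<in> carrier R" "lprod R (xs[i := y]) \<in> carrier R"
      using u tuples_carrier by auto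
    then show ?thesis
      using u xy by (simp add: tensor_level_def level_def scalar_module_simps(1)[OF scalar_nth[OF t(2)]]
          TF.fun_add TF.fun_minus lprod_update_add r_neg a_minus_def)
  qed
  have 2: "?e (xs[i := r \<odot>\<^bsub>Ms ! i\<^esub> x]) \<ominus>\<^bsub>?F\<^esub> (r \<odot>\<^bsub>?F\<^esub> ?e (xs[i := x])) \<in> tensor_level R Ms \<zero>"
    if t: "xs \<in> tuples Ms" "i < length Ms" "r \<in> carrier R" "x \<in> carrier (Ms ! i)" for xs i r x
  proof -
    have xy: "x \<in> carrier R" "set xs \<subseteq> carrier R"
      using t scalar_module_simps(4)[OF scalar_nth[OF t(2)]] tuples_carrier by auto
    note u = upd[OF t(1,2) sm[OF t(2-4)]] upd[OF t(1,2,4)]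
    have "lprod R (xs[i := x]) \<in> carrier R"
      using u tuples_carrier by auto
    then show ?thesis
      using u xy t(3) by (simp add: tensor_level_def level_def scalar_module_simps(2)[OF scalar_nth[OF t(2)]]
          TF.fun_add TF.fun_minus TF.fun_smult lprod_update_smult r_neg a_minus_def)
  qed
  show ?thesis unfolding tensor_rels_def Let_def using 1 2 by blast
qed

text \<open>One inclusion is the minimality of the hull. For the other, a submodule \<open>N\<close>
  containing the relations reduces every element of the free module to its value times
  \<open>u\<close>, so it contains the kernel.\<close>

lemma tensor_ker_eq: "tensor_ker R Ms = tensor_level R Ms \<zero>"
proof
  let ?F = "free_module R (tuples Ms)"
  show "tensor_ker R Ms \<subseteq> tensor_level R Ms \<zero>"
    unfolding tensor_ker_def using tensor_rels_ker TF.ker_submodule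
    by (intro hull_minimal) (auto simp: tensor_level_def)
  show "tensor_level R Ms \<zero> \<subseteq> tensor_ker R Ms"
    unfolding tensor_ker_def hull_def
  proof (intro Inter_greatest subsetI)
    fix N c assume "N \<in> {t. submodule t R ?F \<and> tensor_rels R Ms \<subseteq> t}"
      and c: "c \<in> tensor_level R Ms \<zero>"
    then have N: "submodule N R ?F" "tensor_rels R Ms \<subseteq> N" by auto
    from basis_vec_reduce[OF N] obtain u where u: "u \<in> carrier ?F"
      "\<And>xs. xs \<in> tuples Ms \<Longrightarrow> basis_vec R (tuples Ms) xs \<ominus>\<^bsub>?F\<^esub> lprod R xs \<odot>\<^bsub>?F\<^esub> u \<in> N" by auto
    have "carrier ?F \<subseteq> {x \<in> carrier ?F. x \<ominus>\<^bsub>?F\<^esub> tensor_fun R Ms x \<odot>\<^bsub>?F\<^esub> u \<in> N}"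
      using u by (intro free_module_span TF.reduction_submodule N) auto
    from TF.ker_subset[OF N(1) u(1) this] c show "c \<in> N" by (auto simp: tensor_level_def)
  qed
qed

lemma tensor_eq: "tensor R Ms = TF.quot"
  by (simp add: tensor_def TF.quot_def tensor_ker_eq tensor_level_def)

sublocale T: functional R "tensor R Ms" "tensor_val R Ms"
  unfolding tensor_eq tensor_val_def by (rule TF.quot_functional)

lemma carrier_tensor: "carrier (tensor R Ms) = tensor_level R Ms ` scalar_values R Ms"
  by (simp add: tensor_eq TF.carrier_quot tensor_level_def scalar_values_def)

lemma tensor_level_closed: "r \<in> scalar_values R Ms \<Longrightarrow> tensor_level R Ms r \<in> carrier (tensor R Ms)"
  by (simp add: carrier_tensor)

lemma tensor_val_level: "r \<in> scalar_values R Ms \<Longrightarrow> tensor_val R Ms (tensor_level R Ms r) = r"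
  by (simp add: tensor_val_def tensor_level_def scalar_values_def)

lemma tensor_level_val: "C \<in> carrier (tensor R Ms) \<Longrightarrow> tensor_level R Ms (tensor_val R Ms C) = C"
  by (simp add: tensor_eq tensor_val_def tensor_level_def TF.level_level_val)

text \<open>A class is recovered from its scalar by \<open>tensor_level_val\<close>. Equations
  between tensors are proved through this.\<close>

lemma tensor_val_inj:
  "C \<in> carrier (tensor R Ms) \<Longrightarrow> D \<in> carrier (tensor R Ms) \<Longrightarrow> tensor_val R Ms C = tensor_val R Ms D \<Longrightarrow> C = D"
  using tensor_level_val by metis

lemma tensor_elem: 
  assumes "C \<in> carrier (tensor R Ms)" "c \<in> C"
  shows "c \<in> carrier (free_module R (tuples Ms))" "tensor_fun R Ms c = tensor_val R Ms C"
  using assms tensor_level_val[OF assms(1)] by (auto simp: tensor_level_def level_def)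

text \<open>Labels lie in the image of the functional, so their fibres are inhabited. Without this,
  a union over representatives could be empty.\<close>

lemma tensor_elem_nonempty: "C \<in> carrier (tensor R Ms) \<Longrightarrow> C \<noteq> {}"
  by (auto simp: carrier_tensor tensor_level_def level_def scalar_values_def)

lemma lprod_scalar_values: "xs \<in> tuples Ms \<Longrightarrow> lprod R xs \<in> scalar_values R Ms"
  by (auto simp: scalar_values_def image_iff intro!: bexI[of _ "basis_vec R (tuples Ms) xs"])

lemma pure_tensor_eq: "xs \<in> tuples Ms \<Longrightarrow> pure_tensor R Ms xs = tensor_level R Ms (lprod R xs)"
  by (simp add: pure_tensor_def tensor_ker_eq tensor_level_def TF.ker_coset)

lemma scalar_values_regular:
  assumes "\<forall>N\<in>set Ms. N = regular_module R"
  shows "scalar_values R Ms = carrier R"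
proof
  show "scalar_values R Ms \<subseteq> carrier R" by (auto simp: scalar_values_def)
  show "carrier R \<subseteq> scalar_values R Ms"
  proof
    fix r assume r: "r \<in> carrier R"
    have "Ms ! i = regular_module R" if "i < length Ms" for i using assms that by simp
    then have "replicate (length Ms) \<one> \<in> tuples Ms" by (simp add: tuples_iff)
    from lprod_scalar_values[OF this] have "\<one> \<in> scalar_values R Ms" by simp
    then show "r \<in> scalar_values R Ms" using TF.image_closed(3)[OF r, of \<one>] r by (simp add: scalar_values_def)
  qed
qed

text \<open>A tuple has entry zero at the position of the zero factor, so the product of its entries
  vanishes.\<close>

lemma scalar_values_zero:
  assumes "\<exists>N\<in>set Ms. carrier N = {\<zero>}"
  shows "scalar_values R Ms = {\<zero>}"
proof -
  obtain i where i: "i < length Ms" "carrier (Ms ! i) = {\<zero>}" using assms by (auto simp: in_set_conv_nth)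
  have "lprod R xs = \<zero>" if "xs \<in> tuples Ms" for xs
    using that i tuples_carrier[OF that] by (intro lprod_zero) (auto simp: tuples_iff in_set_conv_nth)
  then have "tensor_fun R Ms c = \<zero>" if "c \<in> carrier (free_module R (tuples Ms))" for c
    using that direct_sum_carrierD(2)[of c "tuples Ms" "\<lambda>_. regular_module R"] unfolding tensor_fun_def dsum_fun_def
    by (intro add.finprod_one_eqI) (auto simp: free_module_def)
  then show ?thesis
    using TF.M.zero_closed unfolding scalar_values_def by (auto simp del: TF.M.zero_closed)
qed

end

section \<open>Concatenation of tensors\<close>

context cring begin

text \<open>For each choice of representatives, the inner sum has as value the product of the values
  of the classes. So the union runs over copies of one coset, and the product is an admissible label
  because it is attained.\<close>

lemma tensor_concat_eq:
  assumes len: "length Cs = length Mss"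
    and scalar: "\<And>Ms N. Ms \<in> set Mss \<Longrightarrow> N \<in> set Ms \<Longrightarrow> scalar_module R N"
    and Cs: "\<And>j. j < length Mss \<Longrightarrow> Cs ! j \<in> carrier (tensor R (Mss ! j))"
  shows "tensor_concat R Mss Cs
      = tensor_level R (concat Mss) (lprod R (map (\<lambda>j. tensor_val R (Mss ! j) (Cs ! j)) [0..<length Mss]))"
    and "lprod R (map (\<lambda>j. tensor_val R (Mss ! j) (Cs ! j)) [0..<length Mss]) \<in> scalar_values R (concat Mss)"
proof -
  let ?k = "length Mss"
  let ?N = "concat Mss"
  let ?F = "free_module R (tuples ?N)"
  let ?v = "lprod R (map (\<lambda>j. tensor_val R (Mss ! j) (Cs ! j)) [0..<?k])"
  have st: "scalar_tensor R (Mss ! j)" if "j < ?k" for j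
    using scalar[OF nth_mem[OF that]] by (intro scalar_tensor.intro scalar_tensor_axioms.intro cring_axioms)
  interpret N: scalar_tensor R ?N
    using scalar by unfold_locales auto
  let ?A = "\<lambda>cs. map2 (\<lambda>Ms c. {xs \<in> tuples Ms. c xs \<noteq> \<zero>}) Mss cs"
  let ?X = "\<lambda>cs. \<Oplus>\<^bsub>?F\<^esub>xss\<in>listset (?A cs).
      (\<Otimes>j\<in>{..<length cs}. (cs ! j) (xss ! j)) \<odot>\<^bsub>?F\<^esub> basis_vec R (tuples ?N) (concat xss)"
  \<comment> \<open>For a fixed list \<open>cs\<close> of representatives, the inner sum is an
    element of the free module whose value depends only on the classes.\<close>
  have X: "?X cs \<in> carrier ?F \<and> tensor_fun R ?N (?X cs) = ?v" if cs: "cs \<in> listset Cs" for cs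
  proof -
    have lcs: "length cs = ?k" using cs len by (simp add: listset_iff)
    have cj: "cs ! j \<in> carrier (free_module R (tuples (Mss ! j)))"
      "tensor_fun R (Mss ! j) (cs ! j) = tensor_val R (Mss ! j) (Cs ! j)" if "j < ?k" for j
      using scalar_tensor.tensor_elem[OF st Cs, of j "cs ! j"] that cs len by (auto simp: listset_iff)
    note cD = direct_sum_carrierD[OF cj(1)[unfolded free_module_def]]
    have A: "?A cs ! j = {xs \<in> tuples (Mss ! j). (cs ! j) xs \<noteq> \<zero>}" if "j < ?k" for j
      using that lcs by simp
    have xsD: "length xss = ?k" "\<And>j. j < ?k \<Longrightarrow> xss ! j \<in> tuples (Mss ! j)"
      "\<And>j. j < ?k \<Longrightarrow> (cs ! j) (xss ! j) \<in> carrier R"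
      "concat xss \<in> tuples ?N" "\<And>j. j < ?k \<Longrightarrow> set (xss ! j) \<subseteq> carrier R" if "xss \<in> listset (?A cs)" for xss
    proof -
      show l: "length xss = ?k" using that lcs by (simp add: listset_iff)
      show t: "xss ! j \<in> tuples (Mss ! j)" if "j < ?k" for j
        using that \<open>xss \<in> listset (?A cs)\<close> lcs by (auto simp: listset_iff)
      show "(cs ! j) (xss ! j) \<in> carrier R" if "j < ?k" for j
        using t[OF that] cD(2)[OF that] by simp
      show "concat xss \<in> tuples ?N" using l t by (rule tuples_concat)
      show "set (xss ! j) \<subseteq> carrier R" if "j < ?k" for j
        using scalar_tensor.tuples_carrier[OF st[OF that] t[OF that]] .
    qed
    have fin: "finite (?A cs ! j)" if "j < ?k" for j
      using cD(3)[OF that] by (simp add: A[OF that])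
    have finL: "finite (listset (?A cs))"
      using fin lcs by (intro finite_listset) (auto simp: in_set_conv_nth)
    define P where "P = (\<lambda>xss. lprod R (map (\<lambda>j. (cs ! j) (xss ! j)) [0..<?k]))"
    have Pc: "P xss \<in> carrier R" if "xss \<in> listset (?A cs)" for xss
      unfolding P_def using xsD(3)[OF that] by (intro lprod_closed) auto
    have XP: "?X cs = (\<Oplus>\<^bsub>?F\<^esub>xss\<in>listset (?A cs). P xss \<odot>\<^bsub>?F\<^esub> basis_vec R (tuples ?N) (concat xss))"
      using xsD Pc finprod_lessThan_lprod lcs
      by (intro N.TF.finsum_cong') (auto simp: P_def)
    have "tensor_fun R ?N (?X cs) = (\<Oplus>xss\<in>listset (?A cs). P xss \<otimes> lprod R (concat xss))"
      unfolding XP using finL Pc xsD(4) N.tuples_carrier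
      by (subst N.TF.fun_finsum)
        (auto simp: N.TF.fun_smult intro!: finsum_cong' m_closed lprod_closed dest: subsetD)
    also have "\<dots> = (\<Oplus>xss\<in>listset (?A cs). lprod R (map (\<lambda>j. (cs ! j) (xss ! j) \<otimes> lprod R (xss ! j)) [0..<?k]))"
    proof (rule finsum_cong')
      fix xss assume x: "xss \<in> listset (?A cs)"
      note D = xsD[OF x]
      have xss: "xss = map (\<lambda>j. xss ! j) [0..<?k]" using D(1) by (metis map_nth)
      have "lprod R (concat xss) = lprod R (map (lprod R) xss)"
        using D(5) D(1) by (intro lprod_concat) (auto simp: in_set_conv_nth)
      also have "map (lprod R) xss = map (\<lambda>j. lprod R (xss ! j)) [0..<?k]"
        by (subst xss) simp
      finally show "P xss \<otimes> lprod R (concat xss) = lprod R (map (\<lambda>j. (cs ! j) (xss ! j) \<otimes> lprod R (xss ! j)) [0..<?k])"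
        unfolding P_def using D by (subst lprod_map_mult) auto
    qed (use xsD in \<open>auto intro!: lprod_closed\<close>)
    \<comment> \<open>The sum over all choices factors into a product, with one sum over the support
      of each \<open>cs ! j\<close>.\<close>
    also have "\<dots> = lprod R (map (\<lambda>j. \<Oplus>xs\<in>?A cs ! j. (cs ! j) xs \<otimes> lprod R xs) [0..<?k])"
      using finsum_listset_lprod[of "?A cs" "\<lambda>j xs. (cs ! j) xs \<otimes> lprod R xs"] fin lcs cD(2)
        scalar_tensor.tuples_carrier[OF st]
      by (simp add: A)
    also have "map (\<lambda>j. \<Oplus>xs\<in>?A cs ! j. (cs ! j) xs \<otimes> lprod R xs) [0..<?k]
        = map (\<lambda>j. tensor_val R (Mss ! j) (Cs ! j)) [0..<?k]"
      using A by (auto simp: cj(2)[symmetric] tensor_fun_def dsum_fun_def)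
    finally have "tensor_fun R ?N (?X cs) = ?v" .
    moreover have "?X cs \<in> carrier ?F"
      unfolding XP using Pc xsD(4) by (intro N.TF.finsum_closed) auto
    ultimately show ?thesis by blast
  qed
  have ne: "listset Cs \<noteq> {}"
    using scalar_tensor.tensor_elem_nonempty[OF st Cs] len
    by (intro listset_nonempty) (auto simp: in_set_conv_nth)
  then obtain cs where cs: "cs \<in> listset Cs" by blast
  show "?v \<in> scalar_values R ?N"
    unfolding scalar_values_def
    using imageI[OF conjunct1[OF X[OF cs]], of "tensor_fun R ?N"] unfolding conjunct2[OF X[OF cs]] .
  have "tensor_concat R Mss Cs = (\<Union>cs\<in>listset Cs. tensor_ker R ?N +>\<^bsub>?F\<^esub> ?X cs)"
    by (simp add: tensor_concat_def Let_def)
  also have "\<dots> = (\<Union>cs\<in>listset Cs. tensor_level R ?N ?v)"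
    using X by (intro SUP_cong) (simp_all add: N.tensor_ker_eq tensor_level_def N.TF.ker_coset)
  also have "\<dots> = tensor_level R ?N ?v" using ne by auto
  finally show "tensor_concat R Mss Cs = tensor_level R ?N ?v" .
qed

end

section \<open>Substitution of surjections\<close>

lemma SurD:
  assumes "t \<in> Sur n k"
  shows "\<And>a. a \<in> {1..n} \<Longrightarrow> t a \<in> {1..k}" "t \<in> extensional {1..n}" "t ` {1..n} = {1..k}"
  using assms by (auto simp: Sur_def PiE_def)

lemma Sur_surj:
  assumes "t \<in> Sur n k" "j \<in> {1..k}"
  obtains a where "a \<in> {1..n}" "t a = j"
proof -
  have "j \<in> t ` {1..n}" unfolding SurD(3)[OF assms(1)] by (rule assms(2))
  then show thesis by (rule imageE) (use that in simp)
qed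

lemma SurI:
  assumes "t \<in> extensional {1..n}" "\<And>a. a \<in> {1..n} \<Longrightarrow> t a \<in> {1..k}"
    "\<And>j. j \<in> {1..k} \<Longrightarrow> \<exists>a\<in>{1..n}. t a = j"
  shows "t \<in> Sur n k"
  using assms by (fastforce simp: Sur_def PiE_def Pi_def image_iff)

lemma num_blocks_Sur [simp]: "t \<in> Sur n k \<Longrightarrow> num_blocks n t = k"
  using SurD(3)[of t n k] by (simp add: num_blocks_def)

lemma Sur_le: "t \<in> Sur n k \<Longrightarrow> k \<le> n"
  using SurD(3)[of t n k] card_image_le[of "{1..n}" t] by simp

lemma fibre_size_pos:
  assumes "t \<in> Sur n k" "j \<in> {1..k}"
  shows "fibre_size n t j \<ge> 1"
proof -
  obtain a where "a \<in> {1..n}" "t a = j" using Sur_surj[OF assms] .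
  then have "{a \<in> {1..n}. t a = j} \<noteq> {}" by blast
  then show ?thesis by (simp add: fibre_size_def card_gt_0_iff Suc_le_eq)
qed

lemma sum_fibre_size:
  assumes "t \<in> Sur n k"
  shows "(\<Sum>j\<in>{1..k}. fibre_size n t j) = n"
proof -
  have "(\<Sum>j\<in>{1..k}. fibre_size n t j) = card (\<Union>j\<in>{1..k}. {a \<in> {1..n}. t a = j})"
    unfolding fibre_size_def by (intro card_UN_disjoint[symmetric]) auto
  also have "(\<Union>j\<in>{1..k}. {a \<in> {1..n}. t a = j}) = {1..n}" using SurD(1)[OF assms] by auto
  finally show ?thesis by simp
qed

lemma surjections_iff: "t \<in> surjections n \<longleftrightarrow> t \<in> Sur n (num_blocks n t)"
  by (auto simp: surjections_def)

lemma surjectionsI: "t \<in> Sur n k \<Longrightarrow> t \<in> surjections n"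
  by (auto simp: surjections_def)

lemma finite_surjections: "finite (surjections n)"
proof -
  have "surjections n \<subseteq> {1..n} \<rightarrow>\<^sub>E {1..n}"
  proof
    fix t assume "t \<in> surjections n"
    then obtain k where t: "t \<in> Sur n k" by (auto simp: surjections_def)
    then show "t \<in> {1..n} \<rightarrow>\<^sub>E {1..n}" using SurD(1,2)[OF t] Sur_le[OF t] by (force simp: PiE_def)
  qed
  then show ?thesis by (meson finite_PiE finite_atLeastAtMost finite_subset)
qed

text \<open>\<open>factors\<close> depends on a surjection only through this list, so statements
  about lists of modules reduce to lists of numbers.\<close>

definition fibre_sizes :: "nat \<Rightarrow> (nat \<Rightarrow> nat) \<Rightarrow> nat list" where
  "fibre_sizes n t = map (fibre_size n t) [1..<Suc (num_blocks n t)]"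

lemma factors_eq: "factors M n t = map (\<lambda>m. M (m + 1)) (fibre_sizes n t)"
  by (simp add: factors_def fibre_sizes_def comp_def del: upt_Suc)

lemma length_fibre_sizes: "t \<in> Sur n k \<Longrightarrow> length (fibre_sizes n t) = k"
  by (simp add: fibre_sizes_def)

lemma fibre_sizes_nth: "t \<in> Sur n k \<Longrightarrow> j < k \<Longrightarrow> fibre_sizes n t ! j = fibre_size n t (Suc j)"
  by (simp add: fibre_sizes_def del: upt_Suc)

lemma length_factors: "t \<in> Sur n k \<Longrightarrow> length (factors M n t) = k"
  by (simp add: factors_def)

lemma factors_nth: "t \<in> Sur n k \<Longrightarrow> j < k \<Longrightarrow> factors M n t ! j = M (fibre_size n t (Suc j) + 1)"
  by (simp add: factors_def del: upt_Suc)

lemma corolla_Sur: "n \<ge> 1 \<Longrightarrow> corolla n \<in> Sur n 1"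
  by (rule SurI) (auto simp: corolla_def)

lemma fibre_size_corolla: "fibre_size n (corolla n) 1 = n"
proof -
  have "{a \<in> {1..n}. corolla n a = 1} = {1..n}" by (auto simp: corolla_def)
  then show ?thesis by (simp add: fibre_size_def)
qed

text \<open>Surjectivity is read off from the sizes of the two fibres, the interval and its
  complement, both of which are positive.\<close>

lemma interval_surj_Sur:
  assumes "m \<ge> 1" "n \<ge> 1" "i \<in> {1..m + 1}"
  shows "interval_surj m n i \<in> Sur (m + n) 2"
    "fibre_size (m + n) (interval_surj m n i) 1 = n" "fibre_size (m + n) (interval_surj m n i) 2 = m"
proof -
  let ?t = "interval_surj m n i" and ?I = "{i..i + n - 1}"
  have I: "?I \<subseteq> {1..m + n}" "card ?I = n" using assms by auto
  have 1: "{a \<in> {1..m + n}. ?t a = 1} = ?I" using I by (auto simp: interval_surj_def)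
  have 2: "{a \<in> {1..m + n}. ?t a = 2} = {1..m + n} - ?I" using I by (auto simp: interval_surj_def)
  show f: "fibre_size (m + n) ?t 1 = n" "fibre_size (m + n) ?t 2 = m"
    unfolding fibre_size_def 1 2 using I by (simp_all add: card_Diff_subset)
  show "?t \<in> Sur (m + n) 2"
  proof (rule SurI)
    show "?t \<in> extensional {1..m + n}" by (simp add: interval_surj_def)
    show "?t a \<in> {1..2}" if "a \<in> {1..m + n}" for a using that by (simp add: interval_surj_def)
    show "\<exists>a\<in>{1..m + n}. ?t a = j" if "j \<in> {1..2}" for j
    proof -
      have "j = 1 \<or> j = 2" using that by auto
      then have "card {a \<in> {1..m + n}. ?t a = j} \<noteq> 0"
        using f assms(1,2) unfolding fibre_size_def by (elim disjE) simp_all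
      then have "{a \<in> {1..m + n}. ?t a = j} \<noteq> {}" by (metis card.empty)
      then show ?thesis by blast
    qed
  qed
qed

text \<open>Ranking is strictly increasing, hence injective, and its values lie in a set of the same
  cardinality.\<close>

lemma rank_bij:
  fixes A :: "nat set"
  assumes "finite A"
  shows "bij_betw (\<lambda>a. card {b \<in> A. b \<le> a}) A {1..card A}"
proof -
  let ?r = "\<lambda>a. card {b \<in> A. b \<le> a}"
  have lt: "?r a < ?r b" if "a \<in> A" "b \<in> A" "a < b" for a b
  proof -
    have "b \<in> {c \<in> A. c \<le> b}" "b \<notin> {c \<in> A. c \<le> a}" "{c \<in> A. c \<le> a} \<subseteq> {c \<in> A. c \<le> b}"
      using that by auto
    then have "{c \<in> A. c \<le> a} \<subset> {c \<in> A. c \<le> b}" by blast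
    then show ?thesis using assms by (intro psubset_card_mono) auto
  qed
  have inj: "inj_on ?r A"
    by (rule inj_onI) (metis lt nat_neq_iff)
  have "?r ` A \<subseteq> {1..card A}"
  proof
    fix x assume "x \<in> ?r ` A"
    then obtain a where a: "a \<in> A" "x = ?r a" by auto
    then have "{b \<in> A. b \<le> a} \<noteq> {}" by auto
    then show "x \<in> {1..card A}"
      using a assms by (simp add: Suc_le_eq card_gt_0_iff card_mono)
  qed
  moreover have "card (?r ` A) = card {1..card A}" using inj by (simp add: card_image)
  ultimately have "?r ` A = {1..card A}" by (intro card_subset_eq) auto
  with inj show ?thesis by (simp add: bij_betw_def)
qed

section \<open>Cutting an interval into consecutive blocks\<close>

lemma sum_list_take_Suc: "j < length ms \<Longrightarrow> sum_list (take (Suc j) ms) = sum_list (take j ms) + (ms ! j :: nat)"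
  by (simp add: take_Suc_conv_app_nth)

lemma sum_list_take_mono: "i \<le> j \<Longrightarrow> sum_list (take i ms) \<le> sum_list (take j (ms :: nat list))"
proof -
  assume "i \<le> j"
  then have "take j ms = take i ms @ drop i (take j ms)"
    by (metis append_take_drop_id min.absorb1 take_take)
  then show ?thesis by (metis le_add1 sum_list_append)
qed

text \<open>Consecutive blocks are disjoint: every position in block \<open>j\<close> is at most the
  partial sum that precedes any later block.\<close>

lemma block_unique:
  fixes ms :: "nat list"
  assumes "j < length ms" "i < length ms" "l \<in> {1..ms ! j}" "l' \<in> {1..ms ! i}"
    "sum_list (take j ms) + l = sum_list (take i ms) + l'"
  shows "j = i" "l = l'"
proof -
  have *: False if "j < i" "j < length ms" "l \<in> {1..ms ! j}" "l' \<ge> 1"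
    "sum_list (take j ms) + l = sum_list (take i ms) + l'" for i j l l'
    using sum_list_take_mono[of "Suc j" i ms] sum_list_take_Suc[of j ms] that by auto
  show "j = i"
    using *[of j i l l'] *[of i j l' l] assms by (metis atLeastAtMost_iff nat_neq_iff)
  with assms(5) show "l = l'" by simp
qed

text \<open>Induction on the list from the right: a position beyond the sum of the earlier entries
  lies in the last block.\<close>

lemma block_exists:
  fixes ms :: "nat list"
  assumes "v \<in> {1..sum_list ms}"
  shows "\<exists>j<length ms. \<exists>l\<in>{1..ms ! j}. v = sum_list (take j ms) + l"
  using assms
proof (induction ms rule: rev_induct)
  case (snoc m ms)
  show ?case
  proof (cases "v \<le> sum_list ms")
    case True
    with snoc obtain j l where "j < length ms" "l \<in> {1..ms ! j}" "v = sum_list (take j ms) + l" by auto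
    then show ?thesis by (intro exI[of _ j]) (auto simp: nth_append)
  next
    case False
    with snoc.prems show ?thesis
      by (intro exI[of _ "length ms"]) (auto intro!: bexI[of _ "v - sum_list ms"])
  qed
qed simp

text \<open>Sorts the values of a substitution by the inner surjection they come from; in this way
  the fibre sizes of a substitution become a concatenation.\<close>

lemma map_upt_blocks:
  "map f [1..<Suc (sum_list ms)] =
    concat (map (\<lambda>j. map (\<lambda>l. f (sum_list (take j ms) + l)) [1..<Suc (ms ! j)]) [0..<length ms])"
proof (induction ms rule: rev_induct)
  case (snoc m ms)
  define G where "G = (\<lambda>ms j. map (\<lambda>l. f (sum_list (take j ms) + l)) [1..<Suc (ms ! j)])"
  have "map (\<lambda>l. sum_list ms + l) [1..<Suc m] = [Suc (sum_list ms)..<Suc (sum_list ms) + m]"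
    by (rule nth_equalityI) (simp_all del: upt_Suc)
  then have "[1..<Suc (sum_list (ms @ [m]))] = [1..<Suc (sum_list ms)] @ map (\<lambda>l. sum_list ms + l) [1..<Suc m]"
    using upt_add_eq_append[of 1 "Suc (sum_list ms)" m] by (simp del: upt_Suc)
  then have 1: "map f [1..<Suc (sum_list (ms @ [m]))]
      = map f [1..<Suc (sum_list ms)] @ map (\<lambda>l. f (sum_list ms + l)) [1..<Suc m]"
    by (simp only: map_append map_map comp_def)
  have 2: "map (G (ms @ [m])) [0..<length ms] = map (G ms) [0..<length ms]"
    by (rule map_cong) (auto simp: G_def nth_append simp del: upt_Suc)
  have "G (ms @ [m]) (length ms) = map (\<lambda>l. f (sum_list ms + l)) [1..<Suc m]"
    by (simp add: G_def nth_append del: upt_Suc)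
  then have 3: "map (G (ms @ [m])) [0..<length (ms @ [m])]
      = map (G ms) [0..<length ms] @ [map (\<lambda>l. f (sum_list ms + l)) [1..<Suc m]]"
    using 2 by simp
  have "map f [1..<Suc (sum_list ms)] = concat (map (G ms) [0..<length ms])"
    using snoc by (simp only: G_def)
  then have "map f [1..<Suc (sum_list (ms @ [m]))] = concat (map (G (ms @ [m])) [0..<length (ms @ [m])])"
    unfolding 1 3 by (simp only: concat_append concat.simps append_Nil2)
  then show ?case by (simp only: G_def)
qed simp

section \<open>Fibres of a substitution\<close>

locale substitution =
  fixes n k :: nat and t :: "nat \<Rightarrow> nat" and ts :: "(nat \<Rightarrow> nat) list" and ms :: "nat list"
  assumes t: "t \<in> Sur n k" and length_ts: "length ts = k" and length_ms: "length ms = k"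
    and ts: "j < k \<Longrightarrow> ts ! j \<in> Sur (fibre_size n t (Suc j)) (ms ! j)"
begin

text \<open>Lists start at 0 while the values of surjections start at 1, so \<open>ts ! j\<close>
  belongs to \<open>fibre (Suc j)\<close>.\<close>

abbreviation fibre where "fibre j \<equiv> {a \<in> {1..n}. t a = j}"
abbreviation rank where "rank j a \<equiv> card {b \<in> fibre j. b \<le> a}"

lemma rank_fibre: "bij_betw (rank j) (fibre j) {1..fibre_size n t j}"
  unfolding fibre_size_def by (rule rank_bij) simp

text \<open>The sizes that \<open>subst_surj\<close> recomputes from the images are the given
  \<open>ms\<close>, and its count of elements up to \<open>a\<close> with the same value is the
  rank of \<open>a\<close> in its fibre.\<close>

lemma subst_surj_eval:
  assumes "j < k" "a \<in> fibre (Suc j)"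
  shows "subst_surj n t ts a = sum_list (take j ms) + (ts ! j) (rank (Suc j) a)"
proof -
  have "map (\<lambda>j. num_blocks (fibre_size n t (Suc j)) (ts ! j)) [0..<length ts] = ms"
    using ts length_ts length_ms by (intro nth_equalityI) auto
  moreover have "{a' \<in> {1..a}. t a' = t a} = {b \<in> fibre (Suc j). b \<le> a}"
    using assms by auto
  ultimately show ?thesis using assms by (simp add: subst_surj_def Let_def)
qed

lemma rank_mem: "a \<in> fibre j \<Longrightarrow> rank j a \<in> {1..fibre_size n t j}"
  using rank_fibre[of j] by (rule bij_betwE[rule_format])

text \<open>By \<open>block_unique\<close> a value determines both its block and its position in the
  block.\<close>

lemma subst_surj_fibre:
  assumes j: "j < k" and l: "l \<in> {1..ms ! j}"
  shows "{a \<in> {1..n}. subst_surj n t ts a = sum_list (take j ms) + l}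
      = {a \<in> fibre (Suc j). (ts ! j) (rank (Suc j) a) = l}"
proof (intro Set.set_eqI iffI)
  fix a assume "a \<in> {a \<in> {1..n}. subst_surj n t ts a = sum_list (take j ms) + l}"
  then have a: "a \<in> {1..n}" "subst_surj n t ts a = sum_list (take j ms) + l" by auto
  obtain i where i: "t a = Suc i" "i < k" using SurD(1)[OF t a(1)] by (cases "t a") auto
  then have ai: "a \<in> fibre (Suc i)" using a by simp
  have *: "(ts ! i) (rank (Suc i) a) \<in> {1..ms ! i}" 
    by (rule SurD(1)[OF ts[OF i(2)] rank_mem[OF ai]])
  note e = subst_surj_eval[OF i(2) ai]
  note u = block_unique[of j ms i l, OF _ _ l *]
  have "j = i" "l = (ts ! i) (rank (Suc i) a)"
    using u j i(2) a(2) e length_ms by auto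
  then show "a \<in> {a \<in> fibre (Suc j). (ts ! j) (rank (Suc j) a) = l}" using ai by simp
next
  fix a assume "a \<in> {a \<in> fibre (Suc j). (ts ! j) (rank (Suc j) a) = l}"
  then have a: "a \<in> fibre (Suc j)" "(ts ! j) (rank (Suc j) a) = l" by blast+
  then show "a \<in> {a \<in> {1..n}. subst_surj n t ts a = sum_list (take j ms) + l}"
    using subst_surj_eval[OF j a(1)] by simp
qed

text \<open>The fibre of the substitution is a part of \<open>fibre (Suc j)\<close>, and ranking
  carries it bijectively onto the fibre of \<open>ts ! j\<close> over \<open>l\<close>.\<close>

lemma fibre_size_subst_surj:
  assumes j: "j < k" and l: "l \<in> {1..ms ! j}"
  shows "fibre_size n (subst_surj n t ts) (sum_list (take j ms) + l)
      = fibre_size (fibre_size n t (Suc j)) (ts ! j) l"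
proof -
  note bij = rank_fibre[of "Suc j"]
  have "bij_betw (rank (Suc j)) {a \<in> fibre (Suc j). (ts ! j) (rank (Suc j) a) = l}
    {b \<in> {1..fibre_size n t (Suc j)}. (ts ! j) b = l}"
  proof (rule bij_betw_subset[OF bij])
    show "rank (Suc j) ` {a \<in> fibre (Suc j). (ts ! j) (rank (Suc j) a) = l} =
      {b \<in> {1..fibre_size n t (Suc j)}. (ts ! j) b = l}"
      unfolding bij_betw_imp_surj_on[OF bij, symmetric] by blast
  qed blast
  then show ?thesis
    using bij_betw_same_card subst_surj_fibre[OF assms] by (simp add: fibre_size_def) blast
qed

text \<open>Every value is attained because its fibre has the size of a nonempty fibre of some
  \<open>ts ! j\<close>.\<close>

lemma subst_surj_Sur: "subst_surj n t ts \<in> Sur n (sum_list ms)"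
proof (rule SurI)
  show "subst_surj n t ts \<in> extensional {1..n}" by (simp add: subst_surj_def Let_def)
next
  fix a assume a: "a \<in> {1..n}"
  obtain i where i: "t a = Suc i" "i < k" using SurD(1)[OF t a(1)] by (cases "t a") auto
  then have ai: "a \<in> fibre (Suc i)" using a by simp
  have "(ts ! i) (rank (Suc i) a) \<in> {1..ms ! i}" 
    by (rule SurD(1)[OF ts[OF i(2)] rank_mem[OF ai]])
  then show "subst_surj n t ts a \<in> {1..sum_list ms}"
    using sum_list_take_mono[of "Suc i" k ms] sum_list_take_Suc[of i ms] i(2) length_ms
    by (simp add: subst_surj_eval[OF i(2) ai])
next
  fix v assume "v \<in> {1..sum_list ms}"
  from block_exists[OF this] obtain j l
    where jl: "j < k" "l \<in> {1..ms ! j}" "v = sum_list (take j ms) + l" using length_ms by auto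
  have "fibre_size n (subst_surj n t ts) v \<ge> 1"
    using fibre_size_pos[OF ts[OF jl(1)] jl(2)] fibre_size_subst_surj[OF jl(1,2)] jl(3) by simp
  then have "{a \<in> {1..n}. subst_surj n t ts a = v} \<noteq> {}"
    unfolding fibre_size_def by (metis card.empty not_one_le_zero)
  then show "\<exists>a\<in>{1..n}. subst_surj n t ts a = v" by blast
qed

lemma fibre_sizes_subst_surj:
  "fibre_sizes n (subst_surj n t ts) = concat (map (\<lambda>j. fibre_sizes (fibre_size n t (Suc j)) (ts ! j)) [0..<k])"
proof -
  have "fibre_sizes n (subst_surj n t ts) = map (fibre_size n (subst_surj n t ts)) [1..<Suc (sum_list ms)]"
    by (simp only: fibre_sizes_def num_blocks_Sur[OF subst_surj_Sur])
  also have "\<dots> = concat (map (\<lambda>j. map (\<lambda>l. fibre_size n (subst_surj n t ts) (sum_list (take j ms) + l))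
      [1..<Suc (ms ! j)]) [0..<k])"
    using map_upt_blocks[of _ ms] length_ms by (simp del: upt_Suc)
  also have "\<dots> = concat (map (\<lambda>j. fibre_sizes (fibre_size n t (Suc j)) (ts ! j)) [0..<k])"
    by (intro arg_cong[where f = concat] map_cong refl)
      (auto simp: fibre_sizes_def num_blocks_Sur[OF ts] fibre_size_subst_surj simp del: upt_Suc intro!: map_cong)
  finally show ?thesis .
qed

text \<open>This makes concatenated tensors land in the summand of the substituted surjection, and
  concatenated arguments fit the substituted composition.\<close>

lemma factors_subst_surj:
  "factors M n (subst_surj n t ts) = concat (map (\<lambda>j. factors M (fibre_size n t (Suc j)) (ts ! j)) [0..<k])"
  by (simp add: factors_eq fibre_sizes_subst_surj map_concat comp_def)

end

section \<open>Sorting a permutation by adjacent transpositions of values\<close>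

lemma Sur_bij:
  assumes "\<sigma> \<in> Sur n n"
  shows "bij_betw \<sigma> {1..n} {1..n}"
  using SurD(3)[OF assms] by (simp add: bij_betw_def eq_card_imp_inj_on)

lemma fibre_size_perm:
  assumes "\<sigma> \<in> Sur n n" "j \<in> {1..n}"
  shows "fibre_size n \<sigma> j = 1"
proof -
  obtain a where a: "a \<in> {1..n}" "\<sigma> a = j" using Sur_surj[OF assms] .
  then have "{b \<in> {1..n}. \<sigma> b = j} = {a}"
    using inj_onD[OF bij_betw_imp_inj_on[OF Sur_bij[OF assms(1)]]] by auto
  then show ?thesis by (simp add: fibre_size_def)
qed

text \<open>Each value occurs before the next larger one, so the positions of
  \<open>1, ..., n\<close> increase strictly within \<open>{1..n}\<close>. Counting upwards from 1
  gives \<open>j \<le> pos j\<close>, counting downwards from \<open>n\<close> gives the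
  converse.\<close>

lemma perm_without_descent:
  assumes \<sigma>: "\<sigma> \<in> Sur n n"
    and asc: "\<And>p q. p \<in> {1..n} \<Longrightarrow> q \<in> {1..n} \<Longrightarrow> \<sigma> p = Suc (\<sigma> q) \<Longrightarrow> q < p"
  shows "\<sigma> = (\<lambda>a\<in>{1..n}. a)"
proof -
  define pos where "pos = inv_into {1..n} \<sigma>"
  have pos: "pos j \<in> {1..n}" "\<sigma> (pos j) = j" if "j \<in> {1..n}" for j
    using that SurD(3)[OF \<sigma>] unfolding pos_def by (metis inv_into_into, metis f_inv_into_f)
  have step: "pos j < pos (Suc j)" if "j \<ge> 1" "Suc j \<le> n" for j
    using that pos[of j] pos[of "Suc j"] by (intro asc) auto
  have ge: "j \<le> pos j" if "1 \<le> j" "j \<le> n" for j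
    using that
  proof (induction j rule: dec_induct)
    case base then show ?case using pos[of 1] by auto
  next
    case (step i) then show ?case using \<open>\<And>j. j \<ge> 1 \<Longrightarrow> Suc j \<le> n \<Longrightarrow> pos j < pos (Suc j)\<close>[of i] by auto
  qed
  have le: "pos j \<le> j" if "1 \<le> j" "j \<le> n" for j
    using that(2,1)
  proof (induction j rule: inc_induct)
    case base then show ?case using pos[of n] that by auto
  next
    case (step i) then show ?case using \<open>\<And>j. j \<ge> 1 \<Longrightarrow> Suc j \<le> n \<Longrightarrow> pos j < pos (Suc j)\<close>[of i] by auto
  qed
  have "\<sigma> a = a" if "a \<in> {1..n}" for a
    using pos(2)[of a] ge[of a] le[of a] that by auto
  then show ?thesis using SurD(2)[OF \<sigma>] by (intro extensionalityI[of _ "{1..n}"]) auto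
qed

text \<open>Both \<open>\<sigma>\<close> and the permutation with the values \<open>j\<close> and \<open>j + 1\<close> exchanged arise by substitution into
  the surjection that merges these values.\<close>

definition merge_values :: "nat \<Rightarrow> nat \<Rightarrow> (nat \<Rightarrow> nat) \<Rightarrow> nat \<Rightarrow> nat" where
  "merge_values n j \<sigma> = (\<lambda>a\<in>{1..n}. if \<sigma> a \<le> j then \<sigma> a else \<sigma> a - 1)"

text \<open>Only the fibre over \<open>j\<close> has two elements and receives
  \<open>\<rho>\<close>; the others are singletons and receive a corolla. The index is
  \<open>j - 1\<close> because lists start at 0.\<close>

definition split_blocks :: "nat \<Rightarrow> nat \<Rightarrow> (nat \<Rightarrow> nat) \<Rightarrow> (nat \<Rightarrow> nat) list" where
  "split_blocks n j \<rho> = (replicate (n - 1) (corolla 1))[j - 1 := \<rho>]"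

text \<open>A descent of the inverse permutation: the value \<open>j + 1\<close> stands to the left
  of \<open>j\<close>.\<close>

locale descent =
  fixes n j p q :: nat and \<sigma> :: "nat \<Rightarrow> nat"
  assumes \<sigma>: "\<sigma> \<in> Sur n n" and p: "p \<in> {1..n}" and q: "q \<in> {1..n}"
    and \<sigma>p: "\<sigma> p = Suc j" and \<sigma>q: "\<sigma> q = j" and pq: "p < q"
begin

lemma j_bounds: "1 \<le> j" "j < n"
  using SurD(1)[OF \<sigma> q] SurD(1)[OF \<sigma> p] \<sigma>q \<sigma>p by auto

lemma inj: "a \<in> {1..n} \<Longrightarrow> b \<in> {1..n} \<Longrightarrow> \<sigma> a = \<sigma> b \<Longrightarrow> a = b"
  using bij_betw_imp_inj_on[OF Sur_bij[OF \<sigma>]] by (rule inj_onD)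

lemma merge_fibre:
  assumes "a \<in> {1..n}"
  shows "{b \<in> {1..n}. merge_values n j \<sigma> b = merge_values n j \<sigma> a} = (if a = p \<or> a = q then {p, q} else {a})"
proof (intro Set.set_eqI)
  fix b
  have r: "\<sigma> a \<ge> 1" using SurD(1)[OF \<sigma> assms] by simp
  show "b \<in> {b \<in> {1..n}. merge_values n j \<sigma> b = merge_values n j \<sigma> a} \<longleftrightarrow> b \<in> (if a = p \<or> a = q then {p, q} else {a})"
  proof (cases "b \<in> {1..n}")
    case True
    have "\<sigma> a = j \<longleftrightarrow> a = q" "\<sigma> a = Suc j \<longleftrightarrow> a = p" "\<sigma> b = j \<longleftrightarrow> b = q" "\<sigma> b = Suc j \<longleftrightarrow> b = p"
      "\<sigma> a = \<sigma> b \<longleftrightarrow> a = b"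
      using inj p q \<sigma>p \<sigma>q assms True by metis+
    moreover have "merge_values n j \<sigma> b = merge_values n j \<sigma> a \<longleftrightarrow> \<sigma> a = \<sigma> b \<or> {\<sigma> a, \<sigma> b} = {j, Suc j}"
      using True assms r SurD(1)[OF \<sigma> True] by (auto simp: merge_values_def doubleton_eq_iff)
    ultimately show ?thesis using True by (auto simp: doubleton_eq_iff)
  qed (use p q assms in auto)
qed

lemma merge_Sur: "merge_values n j \<sigma> \<in> Sur n (n - 1)"
proof (rule SurI)
  show "merge_values n j \<sigma> \<in> extensional {1..n}" by (simp add: merge_values_def)
  show "merge_values n j \<sigma> a \<in> {1..n - 1}" if "a \<in> {1..n}" for a
    using SurD(1)[OF \<sigma> that] j_bounds that by (auto simp: merge_values_def)
  show "\<exists>a\<in>{1..n}. merge_values n j \<sigma> a = i" if "i \<in> {1..n - 1}" for i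
  proof -
    have "(if i \<le> j then i else Suc i) \<in> \<sigma> ` {1..n}"
      unfolding SurD(3)[OF \<sigma>] using that by auto
    then obtain a where a: "a \<in> {1..n}" "\<sigma> a = (if i \<le> j then i else Suc i)" by (metis imageE)
    then show ?thesis by (intro bexI[of _ a]) (auto simp: merge_values_def)
  qed
qed

lemma merge_pq: "merge_values n j \<sigma> p = j" "merge_values n j \<sigma> q = j"
  using p q \<sigma>p \<sigma>q by (auto simp: merge_values_def)

lemma fibre_size_merge:
  assumes i: "i \<in> {1..n - 1}"
  shows "fibre_size n (merge_values n j \<sigma>) i = (if i = j then 2 else 1)"
proof -
  obtain a where a: "a \<in> {1..n}" "merge_values n j \<sigma> a = i"
    using SurD(3)[OF merge_Sur] i by (metis imageE)
  have "a = p \<or> a = q \<longleftrightarrow> i = j"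
    using merge_pq a merge_fibre[OF p] merge_fibre[OF a(1)] by (auto split: if_splits)
  then show ?thesis
    using merge_fibre[OF a(1)] a(2) pq by (simp add: fibre_size_def)
qed

lemma split_substitution:
  assumes "\<rho> \<in> Sur 2 2"
  shows "substitution n (n - 1) (merge_values n j \<sigma>) (split_blocks n j \<rho>) ((replicate (n - 1) 1)[j - 1 := 2])"
proof
  show "split_blocks n j \<rho> ! i \<in> Sur (fibre_size n (merge_values n j \<sigma>) (Suc i)) ((replicate (n - 1) 1)[j - 1 := 2] ! i)"
    if "i < n - 1" for i
    using that assms j_bounds corolla_Sur[of 1] by (auto simp: split_blocks_def nth_list_update fibre_size_merge)
qed (use merge_Sur in \<open>simp_all add: split_blocks_def\<close>)

text \<open>Every block but one has a single value, so the offset is \<open>i\<close>, plus one as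
  soon as the block of size two has been passed.\<close>

lemma sum_take_split:
  "i < n - 1 \<Longrightarrow> sum_list (take i ((replicate (n - 1) 1)[j - 1 := 2])) = (if j \<le> i then Suc i else i)"
  using j_bounds by (induction i) (auto simp: sum_list_take_Suc nth_list_update)

text \<open>In the merged fibre \<open>p\<close> has rank 1 and \<open>q\<close> has rank 2, since
  \<open>p < q\<close>, so there \<open>\<rho>\<close> decides the order. Elsewhere the offset
  undoes the shift of the values above \<open>j\<close>.\<close>

lemma subst_split:
  assumes \<rho>: "\<rho> \<in> Sur 2 2" and a: "a \<in> {1..n}"
  shows "subst_surj n (merge_values n j \<sigma>) (split_blocks n j \<rho>) a
    = (if a = p then j - 1 + \<rho> 1 else if a = q then j - 1 + \<rho> 2 else \<sigma> a)"
proof -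
  interpret substitution n "n - 1" "merge_values n j \<sigma>" "split_blocks n j \<rho>" "(replicate (n - 1) 1)[j - 1 := 2]"
    by (rule split_substitution[OF \<rho>])
  obtain i where i: "merge_values n j \<sigma> a = Suc i" "i < n - 1"
    using SurD(1)[OF merge_Sur a] by (cases "merge_values n j \<sigma> a") auto
  have ev: "subst_surj n (merge_values n j \<sigma>) (split_blocks n j \<rho>) a
      = (if j \<le> i then Suc i else i) + (split_blocks n j \<rho> ! i) (card {b \<in> fibre (Suc i). b \<le> a})"
    using subst_surj_eval[OF i(2), of a] a i sum_take_split[OF i(2)] by simp
  have fib: "fibre (Suc i) = (if a = p \<or> a = q then {p, q} else {a})"
    using merge_fibre[OF a] i(1) by simp
  show ?thesis
  proof (cases "a = p \<or> a = q")
    case True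
    then have ij: "Suc i = j" using merge_pq i(1) by auto
    have "{b \<in> {p, q}. b \<le> a} = (if a = p then {p} else {p, q})" using True pq by auto
    then have "card {b \<in> {p, q}. b \<le> a} = (if a = p then 1 else 2)" using pq by simp
    then have ce: "card {b \<in> fibre (Suc i). b \<le> a} = (if a = p then 1 else 2)"
      unfolding fib using True by simp
    have nth: "split_blocks n j \<rho> ! i = \<rho>" and ji: "\<not> j \<le> i" "j - 1 = i"
      using i(2) ij by (auto simp: split_blocks_def)
    show ?thesis
      unfolding ev nth ce using True ji pq by (elim disjE) simp_all
  next
    case False
    have "{b \<in> {a}. b \<le> a} = {a}" by auto
    then have ce: "card {b \<in> fibre (Suc i). b \<le> a} = 1" unfolding fib using False by simp
    have "Suc i \<noteq> j"
    proof
      assume "Suc i = j"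
      then have "p \<in> {b \<in> {1..n}. merge_values n j \<sigma> b = merge_values n j \<sigma> a}" using p merge_pq i(1) by simp
      then show False unfolding merge_fibre[OF a] using False by simp
    qed
    then have nth: "(split_blocks n j \<rho> ! i) 1 = 1"
      using i(2) j_bounds by (simp add: split_blocks_def nth_list_update corolla_def)
    have "\<sigma> a \<noteq> j" "\<sigma> a \<noteq> Suc j" using False inj a p q \<sigma>p \<sigma>q by metis+
    then have "(if j \<le> i then Suc i else i) + 1 = \<sigma> a"
      using i(1) a SurD(1)[OF \<sigma> a] by (auto simp: merge_values_def split: if_splits)
    then show ?thesis
      unfolding ev ce nth using False by simp
  qed
qed

text \<open>The identity and the transposition of \<open>{1, 2}\<close>; they index the two
  composites in the associativity relation.\<close>

lemma interval_surj_2: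
  "interval_surj 1 1 1 \<in> Sur 2 2" "interval_surj 1 1 2 \<in> Sur 2 2"
  "interval_surj 1 1 1 1 = 1" "interval_surj 1 1 1 2 = 2"
  "interval_surj 1 1 2 1 = 2" "interval_surj 1 1 2 2 = 1"
  using interval_surj_Sur(1)[of 1 1 1] interval_surj_Sur(1)[of 1 1 2]
  by (simp_all add: interval_surj_def numeral_2_eq_2)

definition swapped where "swapped = \<sigma>(p := j, q := Suc j)"

text \<open>At a descent the earlier position \<open>p\<close> carries the larger value, so
  \<open>\<sigma>\<close> comes from the transposition, and the exchanged permutation from the
  identity.\<close>

lemma subst_split_swap: "subst_surj n (merge_values n j \<sigma>) (split_blocks n j (interval_surj 1 1 2)) = \<sigma>"
proof (rule extensionalityI)
  show "\<sigma> \<in> extensional {1..n}" by (rule SurD(2)[OF \<sigma>])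
  show "subst_surj n (merge_values n j \<sigma>) (split_blocks n j (interval_surj 1 1 2)) \<in> extensional {1..n}"
    by (simp add: subst_surj_def Let_def)
  show "subst_surj n (merge_values n j \<sigma>) (split_blocks n j (interval_surj 1 1 2)) a = \<sigma> a" if "a \<in> {1..n}" for a
    using subst_split[OF interval_surj_2(2) that] j_bounds \<sigma>p \<sigma>q unfolding interval_surj_2 by simp
qed

lemma subst_split_id: "subst_surj n (merge_values n j \<sigma>) (split_blocks n j (interval_surj 1 1 1)) = swapped"
proof (rule extensionalityI)
  show "swapped \<in> extensional {1..n}" using SurD(2)[OF \<sigma>] p q by (auto simp: swapped_def extensional_def)
  show "subst_surj n (merge_values n j \<sigma>) (split_blocks n j (interval_surj 1 1 1)) \<in> extensional {1..n}"
    by (simp add: subst_surj_def Let_def)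
  show "subst_surj n (merge_values n j \<sigma>) (split_blocks n j (interval_surj 1 1 1)) a = swapped a" if "a \<in> {1..n}" for a
    using subst_split[OF interval_surj_2(1) that] j_bounds pq unfolding interval_surj_2 by (simp add: swapped_def)
qed

text \<open>The exchanged permutation is a substitution whose block sizes add up to
  \<open>n\<close>.\<close>

lemma swapped_Sur: "swapped \<in> Sur n n"
proof -
  interpret substitution n "n - 1" "merge_values n j \<sigma>" "split_blocks n j (interval_surj 1 1 1)" "(replicate (n - 1) 1)[j - 1 := 2]"
    by (rule split_substitution[OF interval_surj_2(1)])
  have "sum_list ((replicate (n - 1) 1)[j - 1 := 2]) = n"
    using j_bounds by (simp add: sum_list_update sum_list_replicate)
  then show ?thesis using subst_surj_Sur by (simp only: subst_split_id)
qed

text \<open>The sum grows by exactly \<open>q - p\<close>, because the larger value moves to the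
  later position. It drives the induction that sorts a permutation.\<close>

lemma swapped_moment: "(\<Sum>a\<in>{1..n}. a * swapped a) > (\<Sum>a\<in>{1..n}. a * \<sigma> a)"
proof -
  have eq: "(\<Sum>a\<in>{1..n}. a * f a) = p * f p + (q * f q + (\<Sum>a\<in>{1..n} - {p} - {q}. a * f a))" for f :: "nat \<Rightarrow> nat"
    using p q pq by (subst sum.remove[of _ p]) (auto simp: sum.remove[of _ q])
  have "(\<Sum>a\<in>{1..n} - {p} - {q}. a * swapped a) = (\<Sum>a\<in>{1..n} - {p} - {q}. a * \<sigma> a)"
    by (intro sum.cong) (auto simp: swapped_def)
  then show ?thesis
    unfolding eq[of swapped] eq[of \<sigma>] using \<sigma>p \<sigma>q pq by (simp add: swapped_def algebra_simps)
qed

end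

section \<open>The free permutad on a binary operation\<close>

text \<open>A unit law for permutations: all fibres are singletons, every rank is 1, and block
  \<open>i\<close> is offset by \<open>i\<close>.\<close>

lemma subst_surj_corollas:
  assumes s: "s \<in> Sur n n"
  shows "subst_surj n s (replicate n (corolla 1)) = s"
proof -
  interpret substitution n n s "replicate n (corolla 1)" "replicate n 1"
    using s corolla_Sur[of 1] by unfold_locales (auto simp: fibre_size_perm)
  show ?thesis
  proof (rule extensionalityI)
    show "s \<in> extensional {1..n}" by (rule SurD(2)[OF s])
    show "subst_surj n s (replicate n (corolla 1)) \<in> extensional {1..n}"
      by (simp add: subst_surj_def Let_def)
    fix a assume a: "a \<in> {1..n}"
    obtain i where i: "s a = Suc i" "i < n" using SurD(1)[OF s a] by (cases "s a") auto
    then have af: "a \<in> fibre (Suc i)" using a by simp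
    have "rank (Suc i) a \<in> {1..1}"
      using rank_mem[OF af] fibre_size_perm[OF s, of "Suc i"] i by simp
    then have "corolla 1 (rank (Suc i) a) = 1" by (simp add: corolla_def)
    then show "subst_surj n s (replicate n (corolla 1)) a = s a"
      using subst_surj_eval[OF i(2) af] i by (simp add: sum_list_replicate)
  qed
qed

definition bfactors :: "('a, 'm) ring_scheme \<Rightarrow> nat \<Rightarrow> (nat \<Rightarrow> nat) \<Rightarrow> ('a, 'a) module list" where
  "bfactors R n t = factors (binary_gen R) n t"

definition bfree :: "('a, 'm) ring_scheme \<Rightarrow> nat \<Rightarrow> ('a, (nat \<Rightarrow> nat) \<Rightarrow> ('a list \<Rightarrow> 'a) set) module" where
  "bfree R n = free_component R (binary_gen R) n"

definition coord :: "('a, 'm) ring_scheme \<Rightarrow> nat \<Rightarrow> ((nat \<Rightarrow> nat) \<Rightarrow> ('a list \<Rightarrow> 'a) set) \<Rightarrow> (nat \<Rightarrow> nat) \<Rightarrow> 'a" where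
  "coord R n F t = tensor_val R (bfactors R n t) (F t)"

definition augment :: "('a, 'm) ring_scheme \<Rightarrow> nat \<Rightarrow> ((nat \<Rightarrow> nat) \<Rightarrow> ('a list \<Rightarrow> 'a) set) \<Rightarrow> 'a" where
  "augment R n = dsum_fun R (surjections n) (\<lambda>t. tensor R (bfactors R n t)) (\<lambda>t. tensor_val R (bfactors R n t))"

text \<open>The class of value one in the summand of \<open>s\<close>, that is, the tensor of
  \<open>n\<close> copies of the generator. It is used for permutations only, where one is an
  admissible label.\<close>

definition perm_vec :: "('a, 'm) ring_scheme \<Rightarrow> nat \<Rightarrow> (nat \<Rightarrow> nat) \<Rightarrow> (nat \<Rightarrow> nat) \<Rightarrow> ('a list \<Rightarrow> 'a) set" where
  "perm_vec R n s = direct_sum_in (surjections n) (\<lambda>t. tensor R (bfactors R n t)) s (tensor_level R (bfactors R n s) \<one>\<^bsub>R\<^esub>)"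

definition Gam_index :: "nat \<Rightarrow> (nat \<Rightarrow> nat) \<Rightarrow> nat \<Rightarrow> (nat \<Rightarrow> nat) list set" where
  "Gam_index n t k = listset (map (\<lambda>j. surjections (fibre_size n t (Suc j))) [0..<k])"

text \<open>The scalar with which the family \<open>ts\<close> contributes to a composition: tensors
  are concatenated, so their scalars multiply.\<close>

definition Gam_coeff :: "('a, 'm) ring_scheme \<Rightarrow> nat \<Rightarrow> (nat \<Rightarrow> nat) \<Rightarrow> ((nat \<Rightarrow> nat) \<Rightarrow> ('a list \<Rightarrow> 'a) set) list
    \<Rightarrow> (nat \<Rightarrow> nat) list \<Rightarrow> 'a" where
  "Gam_coeff R n t Fs ts = lprod R (map (\<lambda>j. coord R (fibre_size n t (Suc j)) (Fs ! j) (ts ! j)) [0..<length Fs])"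

definition Gam_term :: "('a, 'm) ring_scheme \<Rightarrow> nat \<Rightarrow> (nat \<Rightarrow> nat) \<Rightarrow> ((nat \<Rightarrow> nat) \<Rightarrow> ('a list \<Rightarrow> 'a) set) list
    \<Rightarrow> (nat \<Rightarrow> nat) list \<Rightarrow> (nat \<Rightarrow> nat) \<Rightarrow> ('a list \<Rightarrow> 'a) set" where
  "Gam_term R n t Fs ts = direct_sum_in (surjections n) (\<lambda>s. tensor R (bfactors R n s)) (subst_surj n t ts)
     (tensor_level R (bfactors R n (subst_surj n t ts)) (Gam_coeff R n t Fs ts))"

context cring begin

lemma scalar_binary_gen: "scalar_module R (binary_gen R m)"
  by (simp add: scalar_module_def binary_gen_def)

lemma scalar_tensor_bfactors: "scalar_tensor R (bfactors R n t)"
  using scalar_binary_gen by (intro scalar_tensor.intro scalar_tensor_axioms.intro cring_axioms)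
    (auto simp: bfactors_def factors_def)

interpretation ST: scalar_tensor R "bfactors R n t" for n t
  by (rule scalar_tensor_bfactors)

lemma functional_family_bfactors:
  "functional_family R (surjections n) (\<lambda>t. tensor R (bfactors R n t)) (\<lambda>t. tensor_val R (bfactors R n t))"
  by (intro functional_family.intro functional_family_axioms.intro cring_axioms ST.T.functional_axioms)

interpretation FF: functional_family R "surjections n" "\<lambda>t. tensor R (bfactors R n t)" "\<lambda>t. tensor_val R (bfactors R n t)" for n
  by (rule functional_family_bfactors)

lemma bfree_eq: "bfree R n = direct_sum (surjections n) (\<lambda>t. tensor R (bfactors R n t))"
  by (simp add: bfree_def free_component_def bfactors_def)

lemma augment_functional: "functional R (bfree R n) (augment R n)"
  unfolding augment_def bfree_eq by (rule FF.dsum_functional)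

interpretation AU: functional R "bfree R n" "augment R n" for n
  by (rule augment_functional)

lemma bfree_apply: "F \<in> carrier (bfree R n) \<Longrightarrow> t \<in> surjections n \<Longrightarrow> F t \<in> carrier (tensor R (bfactors R n t))"
  unfolding bfree_eq by (rule direct_sum_carrierD(2)[where N = "\<lambda>t. tensor R (bfactors R n t)"])

lemma coord_closed: "F \<in> carrier (bfree R n) \<Longrightarrow> t \<in> surjections n \<Longrightarrow> coord R n F t \<in> carrier R"
  by (simp add: coord_def bfree_apply)

lemma augment_eq: "F \<in> carrier (bfree R n) \<Longrightarrow> augment R n F = (\<Oplus>t\<in>surjections n. coord R n F t)"
  unfolding augment_def coord_def bfree_eq
  by (intro FF.dsum_fun_eq finite_surjections) auto

lemma coord_add:
  "F \<in> carrier (bfree R n) \<Longrightarrow> G \<in> carrier (bfree R n) \<Longrightarrow> t \<in> surjections n \<Longrightarrow>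
    coord R n (F \<oplus>\<^bsub>bfree R n\<^esub> G) t = coord R n F t \<oplus> coord R n G t"
  using bfree_apply[of F n t] bfree_apply[of G n t] by (simp add: coord_def bfree_eq ST.T.fun_add)

lemma bfactors_perm:
  assumes "s \<in> Sur n n"
  shows "bfactors R n s = replicate n (regular_module R)"
  using fibre_size_perm[OF assms]
  by (intro nth_equalityI)
    (simp_all add: bfactors_def binary_gen_def length_factors[OF assms] factors_nth[OF assms])

lemma scalar_values_perm: "s \<in> Sur n n \<Longrightarrow> scalar_values R (bfactors R n s) = carrier R"
  by (intro ST.scalar_values_regular) (simp add: bfactors_perm)

text \<open>The sizes of \<open>k < n\<close> fibres add up to \<open>n\<close>, so some fibre is
  not a singleton; the generating module vanishes outside arity 2, so the corresponding factor is
  zero.\<close>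

lemma scalar_values_non_perm:
  assumes t: "t \<in> Sur n k" and "k \<noteq> n"
  shows "scalar_values R (bfactors R n t) = {\<zero>}"
proof -
  have "k < n" using Sur_le[OF t] assms(2) by simp
  have "\<exists>j\<in>{1..k}. fibre_size n t j \<noteq> 1"
  proof (rule ccontr)
    assume "\<not> ?thesis"
    then have "(\<Sum>j\<in>{1..k}. fibre_size n t j) = (\<Sum>j\<in>{1..k}. 1)" by (intro sum.cong) auto
    then show False using sum_fibre_size[OF t] \<open>k < n\<close> by simp
  qed
  then obtain j where "j \<in> {1..k}" "fibre_size n t j \<noteq> 1" by blast
  then have "binary_gen R (fibre_size n t j + 1) = bfactors R n t ! (j - 1)" "j - 1 < length (bfactors R n t)"
    by (auto simp: bfactors_def factors_nth[OF t] length_factors[OF t])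
  moreover have "carrier (binary_gen R (fibre_size n t j + 1)) = {\<zero>}"
    using \<open>fibre_size n t j \<noteq> 1\<close> by (simp add: binary_gen_def)
  ultimately have "binary_gen R (fibre_size n t j + 1) \<in> set (bfactors R n t)"
    "carrier (binary_gen R (fibre_size n t j + 1)) = {\<zero>}"
    by auto
  then show ?thesis by (intro ST.scalar_values_zero) blast
qed

lemma perm_vec_closed [simp]: "s \<in> Sur n n \<Longrightarrow> perm_vec R n s \<in> carrier (bfree R n)"
  unfolding perm_vec_def bfree_eq
  by (intro FF.direct_sum_in_closed ST.tensor_level_closed) (simp add: scalar_values_perm)

lemma augment_perm_vec [simp]:
  assumes "s \<in> Sur n n" shows "augment R n (perm_vec R n s) = \<one>"
proof -
  have "\<one> \<in> scalar_values R (bfactors R n s)" using assms by (simp add: scalar_values_perm)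
  then show ?thesis unfolding perm_vec_def augment_def
    by (simp add: FF.dsum_fun_in surjectionsI[OF assms] ST.tensor_level_closed ST.tensor_val_level)
qed

text \<open>The identity permutation has value one, and its multiples attain every scalar. Hence
  classes modulo the kernel are labelled by the whole ring.\<close>

lemma augment_surj: "augment R n ` carrier (bfree R n) = carrier R"
proof
  have id: "(\<lambda>a\<in>{1..n}. a) \<in> Sur n n" by (rule SurI) auto
  show "carrier R \<subseteq> augment R n ` carrier (bfree R n)"
  proof
    fix r assume r: "r \<in> carrier R"
    then have "augment R n (r \<odot>\<^bsub>bfree R n\<^esub> perm_vec R n (\<lambda>a\<in>{1..n}. a)) = r"
      using id by (simp add: AU.fun_smult)
    then show "r \<in> augment R n ` carrier (bfree R n)"
      using id r by (metis AU.smult_closed imageI perm_vec_closed)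
  qed
qed auto

lemma tensor_zero: "\<zero>\<^bsub>tensor R (bfactors R n t)\<^esub> = tensor_level R (bfactors R n t) \<zero>"
  by (metis ST.T.M.zero_closed ST.T.fun_zero ST.tensor_level_val)

lemma coord_perm_vec:
  assumes "s \<in> Sur n n" "t \<in> surjections n"
  shows "coord R n (perm_vec R n s) t = (if t = s then \<one> else \<zero>)"
  using assms by (auto simp: coord_def perm_vec_def direct_sum_in_def ST.tensor_val_level scalar_values_perm)

text \<open>Only permutations contribute to an element of the free permutad, so modulo a submodule
  identifying them all, it is determined by its augmentation.\<close>

lemma ker_augment_subset:
  assumes J: "submodule J R (bfree R n)" and \<tau>: "\<tau> \<in> Sur n n"
    and eq: "\<And>s. s \<in> Sur n n \<Longrightarrow> perm_vec R n s \<ominus>\<^bsub>bfree R n\<^esub> perm_vec R n \<tau> \<in> J"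
  shows "level (bfree R n) (augment R n) \<zero> \<subseteq> J"
proof (rule AU.ker_subset[OF J perm_vec_closed[OF \<tau>]])
  let ?S = "{F \<in> carrier (bfree R n). F \<ominus>\<^bsub>bfree R n\<^esub> augment R n F \<odot>\<^bsub>bfree R n\<^esub> perm_vec R n \<tau> \<in> J}"
  have S: "submodule ?S R (bfree R n)"
    by (rule AU.reduction_submodule[OF J perm_vec_closed[OF \<tau>]])
  show "carrier (bfree R n) \<subseteq> ?S"
    unfolding bfree_eq
  proof (rule FF.direct_sum_span, fold bfree_eq)
    show "submodule ?S R (bfree R n)" by (rule S)
    fix t C assume t: "t \<in> surjections n" and C: "C \<in> carrier (tensor R (bfactors R n t))"
    let ?r = "tensor_val R (bfactors R n t) C"
    let ?F = "direct_sum_in (surjections n) (\<lambda>t. tensor R (bfactors R n t)) t C"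
    show "?F \<in> ?S"
    proof (cases "t \<in> Sur n n")
      case True
      have r: "?r \<in> carrier R" using C by simp
      have L: "tensor_level R (bfactors R n t) \<one> \<in> carrier (tensor R (bfactors R n t))"
        using scalar_values_perm[OF True] by (intro ST.tensor_level_closed) simp
      \<comment> \<open>A tensor power of the ring is generated by the class of value one, so the
        summand of \<open>t\<close> is generated by \<open>perm_vec R n t\<close>.\<close>
      have "C = ?r \<odot>\<^bsub>tensor R (bfactors R n t)\<^esub> tensor_level R (bfactors R n t) \<one>"
      proof (rule ST.tensor_val_inj[OF C ST.T.smult_closed[OF r L]])
        show "?r = tensor_val R (bfactors R n t) (?r \<odot>\<^bsub>tensor R (bfactors R n t)\<^esub> tensor_level R (bfactors R n t) \<one>)"
          unfolding ST.T.fun_smult[OF r L] using r by (simp add: ST.tensor_val_level scalar_values_perm[OF True])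
      qed
      then have F: "?F = ?r \<odot>\<^bsub>bfree R n\<^esub> perm_vec R n t"
        using FF.direct_sum_in_smult[OF t r L]
        unfolding bfree_eq perm_vec_def by metis
      have "?r \<odot>\<^bsub>bfree R n\<^esub> (perm_vec R n t \<ominus>\<^bsub>bfree R n\<^esub> perm_vec R n \<tau>) \<in> J"
        using AU.submoduleE(4)[OF J r eq[OF True]] .
      then show ?thesis
        unfolding F using r True \<tau>
        by (simp add: AU.fun_smult a_minus_def AU.smult_r_distr AU.smult_r_minus)
    next
      case False
      then obtain k where k: "t \<in> Sur n k" "k \<noteq> n" using t by (auto simp: surjections_def)
      \<comment> \<open>Zero is the only admissible label here, so \<open>C\<close> is the zero
        class.\<close>
      have "C = \<zero>\<^bsub>tensor R (bfactors R n t)\<^esub>"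
        using C scalar_values_non_perm[OF k] unfolding ST.carrier_tensor tensor_zero by auto
      then have "?F = \<zero>\<^bsub>bfree R n\<^esub>"
        using FF.direct_sum_in_zero unfolding bfree_eq by simp
      then show ?thesis using subgroup.one_closed[OF submodule.axioms(1)[OF S]] by (simp del: mem_Collect_eq)
    qed
  qed
qed

lemma Gam_index_iff:
  "ts \<in> Gam_index n t k \<longleftrightarrow> length ts = k \<and> (\<forall>j<k. ts ! j \<in> surjections (fibre_size n t (Suc j)))"
  by (auto simp: Gam_index_def listset_iff)

lemma finite_Gam_index: "finite (Gam_index n t k)"
  unfolding Gam_index_def by (intro finite_listset) (auto simp: finite_surjections)

lemma Gam_index_substitution:
  assumes "t \<in> Sur n k" "ts \<in> Gam_index n t k"
  shows "substitution n k t ts (map (\<lambda>j. num_blocks (fibre_size n t (Suc j)) (ts ! j)) [0..<k])"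
  using assms by unfold_locales (auto simp: Gam_index_iff simp flip: surjections_iff)

end

section \<open>Compositions in the free permutad in terms of scalars\<close>

locale free_composition = cring R for R :: "('a, 'm) ring_scheme" (structure) +
  fixes n k :: nat and t :: "nat \<Rightarrow> nat" and Fs :: "((nat \<Rightarrow> nat) \<Rightarrow> ('a list \<Rightarrow> 'a) set) list"
  assumes t: "t \<in> Sur n k" and length_Fs: "length Fs = k"
    and Fs: "j < k \<Longrightarrow> Fs ! j \<in> carrier (bfree R (fibre_size n t (Suc j)))"
begin

interpretation ST: scalar_tensor R "bfactors R n' t'" for n' t'
  by (rule scalar_tensor_bfactors)

interpretation FF: functional_family R "surjections n'" "\<lambda>s. tensor R (bfactors R n' s)" "\<lambda>s. tensor_val R (bfactors R n' s)" for n'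
  by (rule functional_family_bfactors)

interpretation AU: functional R "bfree R n'" "augment R n'" for n'
  by (rule augment_functional)

lemma subst_surj_index: "ts \<in> Gam_index n t k \<Longrightarrow> subst_surj n t ts \<in> surjections n"
  by (rule surjectionsI[OF substitution.subst_surj_Sur[OF Gam_index_substitution[OF t]]])

lemma coord_Fs_closed:
  "ts \<in> Gam_index n t k \<Longrightarrow> j < k \<Longrightarrow> coord R (fibre_size n t (Suc j)) (Fs ! j) (ts ! j) \<in> carrier R"
  using Fs by (intro coord_closed) (auto simp: Gam_index_iff)

lemma Gam_coeff_closed [simp]: "ts \<in> Gam_index n t k \<Longrightarrow> Gam_coeff R n t Fs ts \<in> carrier R"
  unfolding Gam_coeff_def using coord_Fs_closed length_Fs by (intro lprod_closed) auto

text \<open>The concatenated list of factors is the list of factors of the substituted surjection,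
  and the scalars of the separate tensors multiply.\<close>

lemma tensor_concat_Gam:
  assumes ts: "ts \<in> Gam_index n t k"
  shows "tensor_concat R (map (\<lambda>j. factors (binary_gen R) (fibre_size n t (Suc j)) (ts ! j)) [0..<k])
      (map (\<lambda>j. (Fs ! j) (ts ! j)) [0..<k])
    = tensor_level R (bfactors R n (subst_surj n t ts)) (Gam_coeff R n t Fs ts)"
    and "Gam_coeff R n t Fs ts \<in> scalar_values R (bfactors R n (subst_surj n t ts))"
proof -
  let ?Mss = "map (\<lambda>j. factors (binary_gen R) (fibre_size n t (Suc j)) (ts ! j)) [0..<k]"
  let ?Cs = "map (\<lambda>j. (Fs ! j) (ts ! j)) [0..<k]"
  have c: "concat ?Mss = bfactors R n (subst_surj n t ts)"
    unfolding bfactors_def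
    by (rule substitution.factors_subst_surj[OF Gam_index_substitution[OF t ts], symmetric])
  have v: "map (\<lambda>j. tensor_val R (?Mss ! j) (?Cs ! j)) [0..<length ?Mss]
      = map (\<lambda>j. coord R (fibre_size n t (Suc j)) (Fs ! j) (ts ! j)) [0..<length Fs]"
    using length_Fs by (auto simp: coord_def bfactors_def)
  have 1: "length ?Cs = length ?Mss" by simp
  have 2: "scalar_module R N" if "Ms \<in> set ?Mss" "N \<in> set Ms" for Ms N
    using that ST.scalar by (auto simp: bfactors_def)
  have 3: "?Cs ! j \<in> carrier (tensor R (?Mss ! j))" if "j < length ?Mss" for j
    using that bfree_apply[OF Fs] ts by (auto simp: Gam_index_iff bfactors_def)
  have "tensor_concat R ?Mss ?Cs
      = tensor_level R (concat ?Mss) (lprod R (map (\<lambda>j. tensor_val R (?Mss ! j) (?Cs ! j)) [0..<length ?Mss]))"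
    by (rule tensor_concat_eq(1)[OF 1 2 3])
  then show "tensor_concat R ?Mss ?Cs = tensor_level R (bfactors R n (subst_surj n t ts)) (Gam_coeff R n t Fs ts)"
    by (simp only: c v Gam_coeff_def)
  have "lprod R (map (\<lambda>j. tensor_val R (?Mss ! j) (?Cs ! j)) [0..<length ?Mss]) \<in> scalar_values R (concat ?Mss)"
    by (rule tensor_concat_eq(2)[OF 1 2 3])
  then show "Gam_coeff R n t Fs ts \<in> scalar_values R (bfactors R n (subst_surj n t ts))"
    by (simp only: c v Gam_coeff_def)
qed

lemma free_Gam_eq: "free_Gam R (binary_gen R) n t Fs = (\<Oplus>\<^bsub>bfree R n\<^esub>ts\<in>Gam_index n t k. Gam_term R n t Fs ts)"
proof -
  have "Gam_term R n t Fs ts \<in> carrier (bfree R n)" if "ts \<in> Gam_index n t k" for ts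
    unfolding Gam_term_def bfree_eq using tensor_concat_Gam(2)[OF that]
    by (intro FF.direct_sum_in_closed ST.tensor_level_closed)
  then show ?thesis
    unfolding free_Gam_def length_Fs bfree_def[symmetric] Gam_index_def[symmetric]
    by (intro AU.finsum_cong') (auto simp: Gam_term_def free_in_def tensor_concat_Gam(1)[folded bfactors_def] simp flip: bfactors_def)
qed

lemma Gam_term_closed:
  assumes "ts \<in> Gam_index n t k" shows "Gam_term R n t Fs ts \<in> carrier (bfree R n)"
  unfolding Gam_term_def bfree_eq using tensor_concat_Gam(2)[OF assms]
  by (intro FF.direct_sum_in_closed ST.tensor_level_closed)

lemma free_Gam_closed: "free_Gam R (binary_gen R) n t Fs \<in> carrier (bfree R n)"
  unfolding free_Gam_eq using Gam_term_closed by (intro AU.finsum_closed) auto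

lemma augment_Gam_term:
  "ts \<in> Gam_index n t k \<Longrightarrow> augment R n (Gam_term R n t Fs ts) = Gam_coeff R n t Fs ts"
  unfolding Gam_term_def augment_def using tensor_concat_Gam(2)[of ts]
  by (simp add: FF.dsum_fun_in subst_surj_index ST.tensor_level_closed ST.tensor_val_level)

text \<open>Summing over all families of inner surjections expands a product with one sum for each
  argument. The functional sees only the scalars of the terms, not the summands in which they
  land.\<close>

lemma augment_free_Gam:
  "augment R n (free_Gam R (binary_gen R) n t Fs)
    = lprod R (map (\<lambda>j. augment R (fibre_size n t (Suc j)) (Fs ! j)) [0..<k])"
proof -
  let ?As = "map (\<lambda>j. surjections (fibre_size n t (Suc j))) [0..<k]"
  have "augment R n (free_Gam R (binary_gen R) n t Fs) = (\<Oplus>ts\<in>Gam_index n t k. Gam_coeff R n t Fs ts)"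
    unfolding free_Gam_eq using Gam_term_closed
    by (subst AU.fun_finsum) (auto simp: finite_Gam_index augment_Gam_term intro!: finsum_cong')
  also have "\<dots> = (\<Oplus>ts\<in>listset ?As. lprod R (map (\<lambda>j. coord R (fibre_size n t (Suc j)) (Fs ! j) (ts ! j)) [0..<length ?As]))"
    by (simp add: Gam_index_def Gam_coeff_def length_Fs)
  also have "\<dots> = lprod R (map (\<lambda>j. \<Oplus>s\<in>?As ! j. coord R (fibre_size n t (Suc j)) (Fs ! j) s) [0..<length ?As])"
    using Fs by (intro finsum_listset_lprod) (auto simp: finite_surjections coord_closed)
  also have "\<dots> = lprod R (map (\<lambda>j. augment R (fibre_size n t (Suc j)) (Fs ! j)) [0..<k])"
    using Fs by (intro arg_cong[where f = "lprod R"]) (simp add: augment_eq)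
  finally show ?thesis .
qed

end

section \<open>Additivity in one argument and composition of basis elements\<close>

context cring begin

interpretation ST: scalar_tensor R "bfactors R n t" for n t
  by (rule scalar_tensor_bfactors)

interpretation FF: functional_family R "surjections n" "\<lambda>t. tensor R (bfactors R n t)" "\<lambda>t. tensor_val R (bfactors R n t)" for n
  by (rule functional_family_bfactors)

interpretation AU: functional R "bfree R n" "augment R n" for n
  by (rule augment_functional)

text \<open>The coefficients are list products and so additive in each entry; each term of the
  composition is compared through its scalar.\<close>

lemma free_Gam_add:
  assumes fc: "free_composition R n k t Fs" and i: "i < k"
    and F: "F \<in> carrier (bfree R (fibre_size n t (Suc i)))"
    and G: "G \<in> carrier (bfree R (fibre_size n t (Suc i)))"
  shows "free_Gam R (binary_gen R) n t (Fs[i := F \<oplus>\<^bsub>bfree R (fibre_size n t (Suc i))\<^esub> G])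
    = free_Gam R (binary_gen R) n t (Fs[i := F]) \<oplus>\<^bsub>bfree R n\<^esub> free_Gam R (binary_gen R) n t (Fs[i := G])"
proof -
  interpret free_composition R n k t Fs by (rule fc)
  have upd: "free_composition R n k t (Fs[i := H])" if "H \<in> carrier (bfree R (fibre_size n t (Suc i)))" for H
    using that t length_Fs Fs i by unfold_locales (auto simp: nth_list_update)
  let ?B = "bfree R (fibre_size n t (Suc i))"
  have FG: "F \<oplus>\<^bsub>?B\<^esub> G \<in> carrier ?B" using F G by simp
  have coeff: "Gam_coeff R n t (Fs[i := H]) ts
      = lprod R ((map (\<lambda>j. coord R (fibre_size n t (Suc j)) (Fs ! j) (ts ! j)) [0..<k])[i := coord R (fibre_size n t (Suc i)) H (ts ! i)])" for H ts
    unfolding Gam_coeff_def using length_Fs i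
    by (intro arg_cong[where f = "lprod R"] nth_equalityI) (auto simp: nth_list_update)
  have add: "Gam_term R n t (Fs[i := F \<oplus>\<^bsub>?B\<^esub> G]) ts
      = Gam_term R n t (Fs[i := F]) ts \<oplus>\<^bsub>bfree R n\<^esub> Gam_term R n t (Fs[i := G]) ts"
    if ts: "ts \<in> Gam_index n t k" for ts
  proof -
    let ?s = "subst_surj n t ts"
    let ?T = "tensor R (bfactors R n ?s)" and ?L = "tensor_level R (bfactors R n ?s)"
    have tsi: "ts ! i \<in> surjections (fibre_size n t (Suc i))" using ts i by (simp add: Gam_index_iff)
    have "Gam_coeff R n t (Fs[i := F \<oplus>\<^bsub>?B\<^esub> G]) ts = Gam_coeff R n t (Fs[i := F]) ts \<oplus> Gam_coeff R n t (Fs[i := G]) ts"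
      unfolding coeff coord_add[OF F G tsi] using coord_Fs_closed[OF ts] i coord_closed[OF F tsi] coord_closed[OF G tsi]
      by (intro lprod_update_add) auto
    moreover note s = free_composition.tensor_concat_Gam(2)[OF upd[OF FG] ts]
      free_composition.tensor_concat_Gam(2)[OF upd[OF F] ts] free_composition.tensor_concat_Gam(2)[OF upd[OF G] ts]
    ultimately have "?L (Gam_coeff R n t (Fs[i := F \<oplus>\<^bsub>?B\<^esub> G]) ts)
        = ?L (Gam_coeff R n t (Fs[i := F]) ts) \<oplus>\<^bsub>?T\<^esub> ?L (Gam_coeff R n t (Fs[i := G]) ts)"
      by (intro ST.tensor_val_inj[where n = n and t = ?s]) (simp_all add: ST.tensor_level_closed ST.tensor_val_level ST.T.fun_add)
    then show ?thesis
      unfolding Gam_term_def bfree_eq using s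
      by (simp only: FF.direct_sum_in_add[OF subst_surj_index[OF ts]] ST.tensor_level_closed)
  qed
  note closed = free_composition.Gam_term_closed[OF upd]
  let ?t = "\<lambda>H. Gam_term R n t (Fs[i := H])"
  have "(\<Oplus>\<^bsub>bfree R n\<^esub>ts\<in>Gam_index n t k. ?t (F \<oplus>\<^bsub>?B\<^esub> G) ts)
      = (\<Oplus>\<^bsub>bfree R n\<^esub>ts\<in>Gam_index n t k. ?t F ts \<oplus>\<^bsub>bfree R n\<^esub> ?t G ts)"
    using closed[OF F] closed[OF G] by (intro AU.M.finsum_cong' refl add) auto
  also have "\<dots> = (\<Oplus>\<^bsub>bfree R n\<^esub>ts\<in>Gam_index n t k. ?t F ts) \<oplus>\<^bsub>bfree R n\<^esub> (\<Oplus>\<^bsub>bfree R n\<^esub>ts\<in>Gam_index n t k. ?t G ts)"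
    using closed[OF F] closed[OF G] by (intro AU.M.finsum_addf) auto
  finally show ?thesis
    unfolding free_composition.free_Gam_eq[OF upd[OF FG]] free_composition.free_Gam_eq[OF upd[OF F]]
      free_composition.free_Gam_eq[OF upd[OF G]] .
qed

text \<open>The product of coordinates vanishes unless the chosen family is \<open>ts\<close>
  itself, so one term survives. The substitution is again a permutation because the fibre sizes add
  up to \<open>n\<close>.\<close>

lemma free_Gam_perm_vec:
  assumes t: "t \<in> Sur n k" and ts: "length ts = k"
      "\<And>j. j < k \<Longrightarrow> ts ! j \<in> Sur (fibre_size n t (Suc j)) (fibre_size n t (Suc j))"
  shows "free_Gam R (binary_gen R) n t (map (\<lambda>j. perm_vec R (fibre_size n t (Suc j)) (ts ! j)) [0..<k])
      = perm_vec R n (subst_surj n t ts)" (is "free_Gam R _ n t ?Fs = _")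
    and "subst_surj n t ts \<in> Sur n n"
proof -
  interpret free_composition R n k t ?Fs
    using t ts by unfold_locales auto
  have tsI: "ts \<in> Gam_index n t k" using ts by (auto simp: Gam_index_iff intro: surjectionsI)
  have "map (\<lambda>j. num_blocks (fibre_size n t (Suc j)) (ts ! j)) [0..<k] = map (\<lambda>j. fibre_size n t (Suc j)) [0..<k]"
    using ts by simp
  moreover have "sum_list (map (\<lambda>j. fibre_size n t (Suc j)) [0..<k]) = n"
  proof -
    have "sum_list (map (\<lambda>j. fibre_size n t (Suc j)) [0..<k]) = (\<Sum>j\<in>{0..<k}. fibre_size n t (Suc j))"
      by (simp add: sum_list_distinct_conv_sum_set)
    also have "\<dots> = (\<Sum>j\<in>{1..k}. fibre_size n t j)"
      using sum.shift_bounds_Suc_ivl[of "fibre_size n t" 0 k] by (simp add: atLeastLessThanSuc_atLeastAtMost)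
    finally show ?thesis using sum_fibre_size[OF t] by simp
  qed
  ultimately show "subst_surj n t ts \<in> Sur n n"
    using substitution.subst_surj_Sur[OF Gam_index_substitution[OF t tsI]] by (simp only:)
  have coeff: "Gam_coeff R n t ?Fs us = (if us = ts then \<one> else \<zero>)" if us: "us \<in> Gam_index n t k" for us
  proof -
    have c: "coord R (fibre_size n t (Suc j)) (?Fs ! j) (us ! j) = (if us ! j = ts ! j then \<one> else \<zero>)" if "j < k" for j
      using that ts us by (simp add: coord_perm_vec Gam_index_iff)
    let ?cs = "map (\<lambda>j. coord R (fibre_size n t (Suc j)) (?Fs ! j) (us ! j)) [0..<k]"
    show ?thesis
    proof (cases "us = ts")
      case True
      then have "?cs = replicate k \<one>" using c by (intro nth_equalityI) auto
      then show ?thesis using True by (simp add: Gam_coeff_def)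
    next
      case False
      then obtain j where j: "j < k" "us ! j \<noteq> ts ! j"
        using us ts by (metis Gam_index_iff nth_equalityI)
      then have "?cs ! j = \<zero>" using c by simp
      then have "\<zero> \<in> set ?cs" using j(1) nth_mem[of j ?cs] by simp
      then have "lprod R ?cs = \<zero>"
        using coord_Fs_closed[OF us] by (intro lprod_zero) auto
      then show ?thesis using False by (simp add: Gam_coeff_def)
    qed
  qed
  have trm: "Gam_term R n t ?Fs us = (if us = ts then perm_vec R n (subst_surj n t ts) else \<zero>\<^bsub>bfree R n\<^esub>)"
    if "us \<in> Gam_index n t k" for us
    unfolding Gam_term_def coeff[OF that]
    by (cases "us = ts")
      (simp_all add: perm_vec_def bfree_eq FF.direct_sum_in_zero flip: tensor_zero del: direct_sum_simps)
  have "free_Gam R (binary_gen R) n t ?Fs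
      = (\<Oplus>\<^bsub>bfree R n\<^esub>us\<in>Gam_index n t k. if ts = us then perm_vec R n (subst_surj n t ts) else \<zero>\<^bsub>bfree R n\<^esub>)"
    unfolding free_Gam_eq using perm_vec_closed[OF \<open>subst_surj n t ts \<in> Sur n n\<close>] trm by (intro AU.M.finsum_cong') (auto split: if_splits)
  also have "\<dots> = perm_vec R n (subst_surj n t ts)"
    using AU.M.finsum_singleton[OF tsI finite_Gam_index, of "\<lambda>_. perm_vec R n (subst_surj n t ts)"]
      perm_vec_closed[OF \<open>subst_surj n t ts \<in> Sur n n\<close>] by simp
  finally show "free_Gam R (binary_gen R) n t ?Fs = perm_vec R n (subst_surj n t ts)" .
qed

end

section \<open>The ideal generated by the associativity relation\<close>

definition bpermutad :: "('a, 'm) ring_scheme \<Rightarrow> ('a, (nat \<Rightarrow> nat) \<Rightarrow> ('a list \<Rightarrow> 'a) set) permutad" where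
  "bpermutad R = free_permutad R (binary_gen R)"

text \<open>Surjections from \<open>n\<close> points live in arity \<open>n + 1\<close>, hence the
  shift in the grading.\<close>

lemma bpermutad_simps [simp]:
  "grade (bpermutad R) n = bfree R (n - 1)"
  "Gam (bpermutad R) = free_Gam R (binary_gen R)"
  by (simp_all add: bpermutad_def free_permutad_def bfree_def)

lemma permutad_idealD:
  assumes "permutad_ideal R P J" "n \<ge> 1"
  shows "submodule (J n) R (grade P n)"
    and "\<lbrakk>t \<in> Sur n k; xs \<in> tuples (factors (grade P) n t); j < k; xs ! j \<in> J (fibre_size n t (Suc j) + 1)\<rbrakk>
      \<Longrightarrow> Gam P n t xs \<in> J (n + 1)"
  using assms unfolding permutad_ideal_def by blast+

definition augment_level :: "('a, 'm) ring_scheme \<Rightarrow> nat \<Rightarrow> 'a \<Rightarrow> ((nat \<Rightarrow> nat) \<Rightarrow> ('a list \<Rightarrow> 'a) set) set" where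
  "augment_level R n = level (bfree R n) (augment R n)"

context cring begin

interpretation AU: functional R "bfree R n" "augment R n" for n
  by (rule augment_functional)

lemma free_composition_tuples:
  assumes t: "t \<in> Sur n k" and Fs: "Fs \<in> tuples (factors (grade (bpermutad R)) n t)"
  shows "free_composition R n k t Fs"
  using assms by unfold_locales (auto simp: tuples_iff length_factors[OF t] factors_nth[OF t])

lemma augment_kernel_ideal: "permutad_ideal R (bpermutad R) (\<lambda>n. augment_level R (n - 1) \<zero>)"
  unfolding permutad_ideal_def
proof (intro conjI allI impI ballI)
  fix n :: nat
  show "submodule (augment_level R (n - 1) \<zero>) R (grade (bpermutad R) n)"
    unfolding augment_level_def by (simp add: AU.ker_submodule)
  fix k t Fs assume t: "t \<in> Sur n k" and Fs: "Fs \<in> tuples (factors (grade (bpermutad R)) n t)"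
    and ex: "\<exists>j<k. Fs ! j \<in> augment_level R (fibre_size n t (Suc j) + 1 - 1) \<zero>"
  interpret free_composition R n k t Fs by (rule free_composition_tuples[OF t Fs])
  from ex obtain j where j: "j < k" "augment R (fibre_size n t (Suc j)) (Fs ! j) = \<zero>"
    by (auto simp: augment_level_def level_def)
  let ?as = "map (\<lambda>j. augment R (fibre_size n t (Suc j)) (Fs ! j)) [0..<k]"
  have "?as ! j = \<zero>" using j by simp
  then have "\<zero> \<in> set ?as" using j(1) nth_mem[of j ?as] by simp
  moreover have "set ?as \<subseteq> carrier R" using Fs by auto
  ultimately have "lprod R ?as = \<zero>" by (intro lprod_zero)
  then show "Gam (bpermutad R) n t Fs \<in> augment_level R (n + 1 - 1) \<zero>"
    using free_Gam_closed augment_free_Gam by (simp add: augment_level_def level_def)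
qed

lemma generator_eq: "free_gen R (binary_gen R) 2 \<one> = perm_vec R 1 (corolla 1)"
proof -
  interpret ST: scalar_tensor R "bfactors R 1 (corolla 1)" by (rule scalar_tensor_bfactors)
  have "bfactors R 1 (corolla 1) = [regular_module R]"
    using bfactors_perm[of "corolla 1" 1] corolla_Sur[of 1] by simp
  then have "[\<one>] \<in> tuples (bfactors R 1 (corolla 1))" by (simp add: tuples_iff)
  from ST.pure_tensor_eq[OF this] show ?thesis
    by (simp add: free_gen_def free_in_def perm_vec_def bfactors_def)
qed

text \<open>Both fibres are singletons, so each argument is the generator, and substituting corollas
  changes nothing.\<close>

lemma partial_comp_generator:
  assumes "i \<in> {1..2}"
  shows "partial_comp (bpermutad R) 2 2 i (perm_vec R 1 (corolla 1)) (perm_vec R 1 (corolla 1))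
    = perm_vec R 2 (interval_surj 1 1 i)"
proof -
  have t: "interval_surj 1 1 i \<in> Sur 2 2"
    using interval_surj_Sur(1)[of 1 1 i] assms by (simp add: numeral_2_eq_2)
  have f: "fibre_size 2 (interval_surj 1 1 i) (Suc j) = 1" if "j < 2" for j
    using fibre_size_perm[OF t] that by simp
  have "map (\<lambda>j. perm_vec R (fibre_size 2 (interval_surj 1 1 i) (Suc j)) (replicate 2 (corolla 1) ! j)) [0..<2]
      = replicate 2 (perm_vec R 1 (corolla 1))"
    using f by (intro nth_equalityI) auto
  then have "free_Gam R (binary_gen R) 2 (interval_surj 1 1 i) (replicate 2 (perm_vec R 1 (corolla 1)))
      = perm_vec R 2 (subst_surj 2 (interval_surj 1 1 i) (replicate 2 (corolla 1)))"
    using free_Gam_perm_vec(1)[OF t, of "replicate 2 (corolla 1)"] f corolla_Sur[of 1] by simp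
  then show ?thesis
    using subst_surj_corollas[OF t] by (simp add: partial_comp_def Let_def numeral_2_eq_2)
qed

text \<open>The first composite is indexed by the identity of \<open>{1, 2}\<close> and the second
  by the transposition.\<close>

lemma assoc_relator_eq:
  "assoc_relator R = perm_vec R 2 (interval_surj 1 1 1) \<ominus>\<^bsub>bfree R 2\<^esub> perm_vec R 2 (interval_surj 1 1 2)"
  using partial_comp_generator[of 1] partial_comp_generator[of 2]
  by (simp add: assoc_relator_def Let_def generator_eq flip: bpermutad_def)

lemma interval_surj_2: "i \<in> {1..2} \<Longrightarrow> interval_surj 1 1 i \<in> Sur 2 2"
  using interval_surj_Sur(1)[of 1 1 i] by (simp add: numeral_2_eq_2)

text \<open>The argument over \<open>j\<close> is the relator and all others are the generator. This
  composite lies in the ideal, and additivity in that argument evaluates it.\<close>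

lemma ideal_descent:
  assumes J: "permutad_ideal R (bpermutad R) J" and rel: "assoc_relator R \<in> J 3"
    and d: "descent n j p q s"
  shows "perm_vec R n (descent.swapped j p q s) \<ominus>\<^bsub>bfree R n\<^esub> perm_vec R n s \<in> J (n + 1)"
proof -
  interpret descent n j p q s by (rule d)
  let ?t = "merge_values n j s" and ?k = "n - 1" and ?B = "bfree R 2"
  let ?fs = "\<lambda>i. fibre_size n ?t (Suc i)"
  let ?Fs = "\<lambda>r. map (\<lambda>i. perm_vec R (?fs i) (split_blocks n j r ! i)) [0..<?k]"
  let ?G = "free_Gam R (binary_gen R) n ?t"
  let ?r1 = "interval_surj 1 1 1" and ?r2 = "interval_surj 1 1 2"
  have r: "?r1 \<in> Sur 2 2" "?r2 \<in> Sur 2 2" by (simp_all only: interval_surj_2)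
  have j: "j - 1 < ?k" "?fs (j - 1) = 2" using j_bounds fibre_size_merge[of j] by auto
  have ts: "split_blocks n j r ! i \<in> Sur (?fs i) (?fs i)" if "r \<in> Sur 2 2" "i < ?k" for r i
    using that corolla_Sur[of 1] j_bounds fibre_size_merge[of "Suc i"]
    by (auto simp: split_blocks_def nth_list_update)
  have len: "length (split_blocks n j r) = ?k" for r by (simp add: split_blocks_def)
  have G: "?G (?Fs r) = perm_vec R n (subst_surj n ?t (split_blocks n j r))" if "r \<in> Sur 2 2" for r
    by (rule free_Gam_perm_vec(1)[OF merge_Sur len ts[OF that]])
  have fc: "free_composition R n ?k ?t (?Fs ?r2)"
    using merge_Sur ts[OF r(2)] by unfold_locales auto
  have upd: "?Fs r = (?Fs ?r2)[j - 1 := perm_vec R 2 r]" for r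
    using j by (intro nth_equalityI) (auto simp: nth_list_update split_blocks_def)
  have c: "perm_vec R 2 ?r1 \<in> carrier ?B" "perm_vec R 2 ?r2 \<in> carrier ?B" using r by simp_all
  have relc: "assoc_relator R \<in> carrier ?B" unfolding assoc_relator_eq using c by simp
  \<comment> \<open>The difference is rewritten as a sum, the form to which additivity in one
    argument applies.\<close>
  have "perm_vec R 2 ?r1 = assoc_relator R \<oplus>\<^bsub>?B\<^esub> perm_vec R 2 ?r2"
    unfolding assoc_relator_eq using c by (simp add: a_minus_def AU.M.a_assoc AU.M.l_neg)
  then have "?G (?Fs ?r1) = ?G ((?Fs ?r2)[j - 1 := assoc_relator R]) \<oplus>\<^bsub>bfree R n\<^esub> ?G (?Fs ?r2)"
    using free_Gam_add[OF fc j(1), of "assoc_relator R" "perm_vec R 2 ?r2"] relc c j(2) upd by metis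
  then have e: "perm_vec R n swapped = ?G ((?Fs ?r2)[j - 1 := assoc_relator R]) \<oplus>\<^bsub>bfree R n\<^esub> perm_vec R n s"
    unfolding G[OF r(1)] G[OF r(2)] subst_split_id subst_split_swap .
  have tup: "(?Fs ?r2)[j - 1 := assoc_relator R] \<in> tuples (factors (grade (bpermutad R)) n ?t)"
    using free_composition.Fs[OF fc] relc j
    by (auto simp: tuples_iff length_factors[OF merge_Sur] factors_nth[OF merge_Sur] nth_list_update)
  have "n \<ge> 1" using j_bounds by simp
  from permutad_idealD(2)[OF J this merge_Sur tup j(1)]
  have "?G ((?Fs ?r2)[j - 1 := assoc_relator R]) \<in> J (n + 1)"
    using j rel by simp
  moreover have "submodule (J (n + 1)) R (bfree R n)"
    using permutad_idealD(1)[OF J, of "n + 1"] by simp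
  then have "J (n + 1) \<subseteq> carrier (bfree R n)" by (rule AU.submoduleE(1))
  ultimately show ?thesis
    unfolding e using perm_vec_closed[OF \<sigma>] by (auto simp: a_minus_def AU.M.a_assoc AU.M.r_neg)
qed

text \<open>Sorting by induction: a descent leads to a permutation with larger moment that is
  congruent modulo the ideal, and only the identity has no descent.\<close>

lemma ideal_identifies_perms:
  assumes J: "permutad_ideal R (bpermutad R) J" and rel: "assoc_relator R \<in> J 3"
    and s: "s \<in> Sur n n"
  shows "perm_vec R n s \<ominus>\<^bsub>bfree R n\<^esub> perm_vec R n (\<lambda>a\<in>{1..n}. a) \<in> J (n + 1)"
  using s
\<comment> \<open>Each of the \<open>n\<close> terms of the moment is at most \<open>n * n\<close>,
  so the subtraction is exact and a larger moment gives a smaller measure.\<close>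
proof (induction "n * (n * n) - (\<Sum>a\<in>{1..n}. a * s a)" arbitrary: s rule: less_induct)
  case less
  let ?M = "bfree R n" and ?id = "\<lambda>a\<in>{1..n}. a"
  have id: "?id \<in> Sur n n" by (rule SurI) auto
  have sub: "submodule (J (n + 1)) R ?M"
    using permutad_idealD(1)[OF J, of "n + 1"] by simp
  have bound: "(\<Sum>a\<in>{1..n}. a * u a) \<le> n * (n * n)" if "u \<in> Sur n n" for u
  proof -
    have "(\<Sum>a\<in>{1..n}. a * u a) \<le> (\<Sum>a\<in>{1..n}. n * n)"
      using SurD(1)[OF that] by (intro sum_mono mult_le_mono) auto
    then show ?thesis by simp
  qed
  show ?case
  proof (cases "\<exists>p\<in>{1..n}. \<exists>q\<in>{1..n}. s p = Suc (s q) \<and> p < q")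
    case True
    then obtain p q where "p \<in> {1..n}" "q \<in> {1..n}" "s p = Suc (s q)" "p < q" by blast
    then have d: "descent n (s q) p q s" using less.prems by unfold_locales auto
    interpret descent n "s q" p q s by (rule d)
    have "n * (n * n) - (\<Sum>a\<in>{1..n}. a * swapped a) < n * (n * n) - (\<Sum>a\<in>{1..n}. a * s a)"
      using swapped_moment bound[OF swapped_Sur] by linarith
    from less.hyps[OF this swapped_Sur]
    have 1: "perm_vec R n swapped \<ominus>\<^bsub>?M\<^esub> perm_vec R n ?id \<in> J (n + 1)" .
    have 2: "perm_vec R n swapped \<ominus>\<^bsub>?M\<^esub> perm_vec R n s \<in> J (n + 1)"
      by (rule ideal_descent[OF J rel d])
    \<comment> \<open>The exchanged permutation cancels from the two differences.\<close>
    have "(perm_vec R n swapped \<ominus>\<^bsub>?M\<^esub> perm_vec R n ?id) \<ominus>\<^bsub>?M\<^esub> (perm_vec R n swapped \<ominus>\<^bsub>?M\<^esub> perm_vec R n s) \<in> J (n + 1)"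
      using AU.submoduleE(5)[OF sub 1 AU.submoduleE(3)[OF sub 2]] by (simp add: a_minus_def)
    moreover have "(x \<ominus>\<^bsub>?M\<^esub> y) \<ominus>\<^bsub>?M\<^esub> (x \<ominus>\<^bsub>?M\<^esub> z) = z \<ominus>\<^bsub>?M\<^esub> y"
      if "x \<in> carrier ?M" "y \<in> carrier ?M" "z \<in> carrier ?M" for x y z
    proof -
      have "(x \<ominus>\<^bsub>?M\<^esub> y) \<ominus>\<^bsub>?M\<^esub> (x \<ominus>\<^bsub>?M\<^esub> z) = (x \<oplus>\<^bsub>?M\<^esub> \<ominus>\<^bsub>?M\<^esub> x) \<oplus>\<^bsub>?M\<^esub> (z \<oplus>\<^bsub>?M\<^esub> \<ominus>\<^bsub>?M\<^esub> y)"
        using that by (simp add: a_minus_def AU.M.minus_add AU.M.a_ac)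
      then show ?thesis using that by (simp add: a_minus_def AU.M.r_neg)
    qed
    ultimately show ?thesis
      using perm_vec_closed[OF swapped_Sur] perm_vec_closed[OF id] perm_vec_closed[OF less.prems] by simp
  next
    case False
    \<comment> \<open>Equal positions are excluded, since no value is its own successor.\<close>
    have "q < p" if "p \<in> {1..n}" "q \<in> {1..n}" "s p = Suc (s q)" for p q
      using False that by (metis linorder_neqE_nat n_not_Suc_n)
    then have "s = ?id" by (rule perm_without_descent[OF less.prems])
    then show ?thesis
      using perm_vec_closed[OF id] subgroup.one_closed[OF submodule.axioms(1)[OF sub]]
      by (simp add: a_minus_def AU.M.r_neg)
  qed
qed

text \<open>The kernel is one of the ideals in the intersection, and every other one contains it,
  since it identifies all permutations with the identity. Ideals are unconstrained at index 0, hence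
  \<open>n \<ge> 1\<close>.\<close>

lemma generated_ideal_eq:
  assumes "n \<ge> 1"
  shows "generated_ideal R (bpermutad R) (\<lambda>n. if n = 3 then {assoc_relator R} else {}) n
    = augment_level R (n - 1) \<zero>"
proof
  have c: "perm_vec R 2 (interval_surj 1 1 i) \<in> carrier (bfree R 2)"
    "augment R 2 (perm_vec R 2 (interval_surj 1 1 i)) = \<one>" if "i \<in> {1..2}" for i
    using interval_surj_2[OF that] by simp_all
  have "assoc_relator R \<in> augment_level R (3 - 1) \<zero>"
    unfolding assoc_relator_eq augment_level_def level_def using c[of 1] c[of 2]
    by (simp add: AU.fun_diff r_neg a_minus_def AU.fun_add AU.fun_minus)
  then show "generated_ideal R (bpermutad R) (\<lambda>n. if n = 3 then {assoc_relator R} else {}) n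
      \<subseteq> augment_level R (n - 1) \<zero>"
    unfolding generated_ideal_def using augment_kernel_ideal
    by (intro Inter_lower CollectI exI[of _ "\<lambda>n. augment_level R (n - 1) \<zero>"]) (simp add: numeral_3_eq_3)
  show "augment_level R (n - 1) \<zero>
      \<subseteq> generated_ideal R (bpermutad R) (\<lambda>n. if n = 3 then {assoc_relator R} else {}) n"
    unfolding generated_ideal_def
  proof (rule Inter_greatest)
    fix Y assume "Y \<in> {J n |J. permutad_ideal R (bpermutad R) J \<and>
      (\<forall>m. (if m = 3 then {assoc_relator R} else {}) \<subseteq> J m)}"
    then obtain J where Y: "Y = J n" and J: "permutad_ideal R (bpermutad R) J"
      and sub: "\<And>m. (if m = 3 then {assoc_relator R} else {}) \<subseteq> J m" by blast
    have rel: "assoc_relator R \<in> J 3" using sub[of 3] by simp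
    have n: "n - 1 + 1 = n" using assms by simp
    have "submodule (J n) R (bfree R (n - 1))"
      using permutad_idealD(1)[OF J assms] by simp
    then have "level (bfree R (n - 1)) (augment R (n - 1)) \<zero> \<subseteq> J n"
      using ideal_identifies_perms[OF J rel, of _ "n - 1"] unfolding n
      by (intro ker_augment_subset[where \<tau> = "\<lambda>a\<in>{1..n - 1}. a"]) (auto intro!: SurI)
    then show "augment_level R (n - 1) \<zero> \<subseteq> Y" by (simp add: Y augment_level_def)
  qed
qed

end

section \<open>The quotient\<close>

lemma map2_concat:
  assumes "length xss = length yss" "\<And>j. j < length xss \<Longrightarrow> length (xss ! j) = length (yss ! j)"
  shows "map2 f (concat xss) (concat yss) = concat (map2 (map2 f) xss yss)"
  using assms
proof (induction xss yss rule: list_induct2)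
  case (Cons x xs y ys)
  have "length x = length y" using Cons.prems[of 0] by simp
  moreover have "length (xs ! j) = length (ys ! j)" if "j < length xs" for j
    using Cons.prems[of "Suc j"] that by simp
  ultimately show ?case using Cons.IH by simp
qed simp

definition class_val :: "('a, 'm) ring_scheme \<Rightarrow> nat \<Rightarrow> ((nat \<Rightarrow> nat) \<Rightarrow> ('a list \<Rightarrow> 'a) set) set \<Rightarrow> 'a" where
  "class_val R n = level_val (augment R n)"

text \<open>The classes are paired with the list of fibre sizes, so that a concatenation of
  arguments splits along \<open>fibre_sizes_subst_surj\<close>.\<close>

definition class_vals :: "('a, 'm) ring_scheme \<Rightarrow> nat \<Rightarrow> (nat \<Rightarrow> nat)
    \<Rightarrow> ((nat \<Rightarrow> nat) \<Rightarrow> ('a list \<Rightarrow> 'a) set) set list \<Rightarrow> 'a list" where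
  "class_vals R n t Cs = map2 (class_val R) (fibre_sizes n t) Cs"

context cring begin

interpretation AU: functional R "bfree R n" "augment R n" for n
  by (rule augment_functional)

lemma class_val_level [simp]: "r \<in> carrier R \<Longrightarrow> class_val R n (augment_level R n r) = r"
  unfolding class_val_def augment_level_def by (rule AU.level_val_level) (simp add: augment_surj)

lemma grade_permAs:
  assumes "n \<ge> 1"
  shows "grade (permAs R) n = functional.quot R (bfree R (n - 1)) (augment R (n - 1))"
  using generated_ideal_eq[OF assms]
  by (simp add: permAs_def Let_def quotient_permutad_def functional.quot_def[OF augment_functional]
      augment_level_def flip: bpermutad_def)

lemma grade_permAs_Suc: "grade (permAs R) (n + 1) = functional.quot R (bfree R n) (augment R n)"
  using grade_permAs[of "n + 1"] by simp

lemma carrier_permAs: "carrier (grade (permAs R) (n + 1)) = augment_level R n ` carrier R"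
  unfolding grade_permAs_Suc augment_level_def AU.carrier_quot augment_surj ..

lemma permAs_add:
  "r \<in> carrier R \<Longrightarrow> s \<in> carrier R \<Longrightarrow>
    augment_level R n r \<oplus>\<^bsub>grade (permAs R) (n + 1)\<^esub> augment_level R n s = augment_level R n (r \<oplus> s)"
  unfolding grade_permAs_Suc augment_level_def by (rule AU.quot_add) (simp_all add: augment_surj)

lemma permAs_smult:
  "r \<in> carrier R \<Longrightarrow> s \<in> carrier R \<Longrightarrow>
    r \<odot>\<^bsub>grade (permAs R) (n + 1)\<^esub> augment_level R n s = augment_level R n (r \<otimes> s)"
  unfolding grade_permAs_Suc augment_level_def by (rule AU.quot_smult) (simp_all add: augment_surj)

lemma module_permAs: "n \<ge> 1 \<Longrightarrow> module R (grade (permAs R) n)"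
  unfolding grade_permAs by (rule AU.quot_module)

lemma class_val_closed: "C \<in> carrier (grade (permAs R) (n + 1)) \<Longrightarrow> class_val R n C \<in> carrier R"
  unfolding carrier_permAs by auto

lemma augment_level_class_val:
  "C \<in> carrier (grade (permAs R) (n + 1)) \<Longrightarrow> augment_level R n (class_val R n C) = C"
  unfolding carrier_permAs by auto

lemma augment_level_closed: "r \<in> carrier R \<Longrightarrow> augment_level R n r \<in> carrier (grade (permAs R) (n + 1))"
  unfolding carrier_permAs by (rule imageI)

lemma class_val_add:
  "C \<in> carrier (grade (permAs R) (n + 1)) \<Longrightarrow> D \<in> carrier (grade (permAs R) (n + 1)) \<Longrightarrow>
    class_val R n (C \<oplus>\<^bsub>grade (permAs R) (n + 1)\<^esub> D) = class_val R n C \<oplus> class_val R n D"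
  unfolding carrier_permAs by (auto simp: permAs_add simp del: One_nat_def add_Suc_right)

lemma class_val_smult:
  "r \<in> carrier R \<Longrightarrow> C \<in> carrier (grade (permAs R) (n + 1)) \<Longrightarrow>
    class_val R n (r \<odot>\<^bsub>grade (permAs R) (n + 1)\<^esub> C) = r \<otimes> class_val R n C"
  unfolding carrier_permAs by (auto simp: permAs_smult simp del: One_nat_def add_Suc_right)

lemma permAs_tuplesD:
  assumes "t \<in> Sur n k" "Cs \<in> tuples (factors (grade (permAs R)) n t)"
  shows "length Cs = k" "j < k \<Longrightarrow> Cs ! j \<in> carrier (grade (permAs R) (fibre_size n t (Suc j) + 1))"
  using assms by (auto simp: tuples_iff length_factors factors_nth)

lemma class_vals_eq:
  assumes "t \<in> Sur n k" "length Cs = k"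
  shows "class_vals R n t Cs = map (\<lambda>j. class_val R (fibre_size n t (Suc j)) (Cs ! j)) [0..<k]"
  using assms by (intro nth_equalityI) (auto simp: class_vals_def length_fibre_sizes fibre_sizes_nth)

lemma class_vals_closed:
  assumes "t \<in> Sur n k" "Cs \<in> tuples (factors (grade (permAs R)) n t)"
  shows "set (class_vals R n t Cs) \<subseteq> carrier R"
  unfolding class_vals_eq[OF assms(1) permAs_tuplesD(1)[OF assms]]
  using class_val_closed permAs_tuplesD(2)[OF assms] by auto

text \<open>Every list of representatives has a composite of the same value, the product of the
  values of the classes. Hence all cosets in the union that defines the composition agree.\<close>

lemma Gam_permAs:
  assumes t: "t \<in> Sur n k" and Cs: "Cs \<in> tuples (factors (grade (permAs R)) n t)"
  shows "Gam (permAs R) n t Cs = augment_level R n (lprod R (class_vals R n t Cs))"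
proof -
  note D = permAs_tuplesD[OF t Cs]
  have coset: "augment_level R n \<zero> +>\<^bsub>bfree R n\<^esub> free_Gam R (binary_gen R) n t Fs
      = augment_level R n (lprod R (class_vals R n t Cs))" if Fs: "Fs \<in> listset Cs" for Fs
  proof -
    have F: "Fs ! j \<in> carrier (bfree R (fibre_size n t (Suc j)))"
      "augment R (fibre_size n t (Suc j)) (Fs ! j) = class_val R (fibre_size n t (Suc j)) (Cs ! j)" if "j < k" for j
    proof -
      have "Fs ! j \<in> Cs ! j" using Fs D(1) that by (simp add: listset_iff)
      then show "Fs ! j \<in> carrier (bfree R (fibre_size n t (Suc j)))"
        "augment R (fibre_size n t (Suc j)) (Fs ! j) = class_val R (fibre_size n t (Suc j)) (Cs ! j)"
        using augment_level_class_val[OF D(2)[OF that]] by (auto simp: augment_level_def level_def)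
    qed
    interpret free_composition R n k t Fs
      using t Fs D(1) F(1) by unfold_locales (auto simp: listset_iff)
    have "augment R n (free_Gam R (binary_gen R) n t Fs) = lprod R (class_vals R n t Cs)"
      unfolding augment_free_Gam class_vals_eq[OF t D(1)]
      using F(2) by (intro arg_cong[where f = "lprod R"]) simp
    then show ?thesis
      using AU.ker_coset[OF free_Gam_closed] by (simp add: augment_level_def)
  qed
  \<comment> \<open>Classes are nonempty because the sum of coordinates is onto; this keeps the
    union over representatives from being empty.\<close>
  have "C \<noteq> {}" if "C \<in> set Cs" for C
  proof -
    from that obtain j where "j < length Cs" "Cs ! j = C" unfolding in_set_conv_nth by (elim exE conjE)
    then have j: "j < k" "C = Cs ! j" using D(1) by simp_all
    have "C \<in> augment_level R (fibre_size n t (Suc j)) ` carrier R"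
      using D(2)[OF j(1)] j(2) unfolding carrier_permAs by simp
    then obtain r where "r \<in> carrier R" "C = augment_level R (fibre_size n t (Suc j)) r" by (rule imageE)
    moreover from this(1) obtain x where "x \<in> carrier (bfree R (fibre_size n t (Suc j)))"
      "r = augment R (fibre_size n t (Suc j)) x" by (metis augment_surj imageE)
    ultimately show ?thesis by (auto simp: augment_level_def level_def)
  qed
  then have ne: "listset Cs \<noteq> {}" by (rule listset_nonempty)
  have "Gam (permAs R) n t Cs = (\<Union>Fs\<in>listset Cs. augment_level R n \<zero> +>\<^bsub>bfree R n\<^esub> free_Gam R (binary_gen R) n t Fs)"
    using generated_ideal_eq[of "n + 1"]
    by (simp add: permAs_def Let_def quotient_permutad_def flip: bpermutad_def)
  also have "\<dots> = (\<Union>Fs\<in>listset Cs. augment_level R n (lprod R (class_vals R n t Cs)))"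
    using coset by (intro SUP_cong) auto
  finally show ?thesis using ne by simp
qed

lemma class_val_Gam_permAs:
  assumes "t \<in> Sur n k" "Cs \<in> tuples (factors (grade (permAs R)) n t)"
  shows "class_val R n (Gam (permAs R) n t Cs) = lprod R (class_vals R n t Cs)"
    and "Gam (permAs R) n t Cs \<in> carrier (grade (permAs R) (n + 1))"
  using class_vals_closed[OF assms] by (simp_all add: Gam_permAs[OF assms] carrier_permAs del: One_nat_def)

text \<open>The constant function \<open>undefined\<close> is the surjection from the empty set; it
  counts as a permutation, and the empty tensor has the empty product as its value.\<close>

lemma ident_permAs: "ident (permAs R) = augment_level R 0 \<one>"
proof -
  have e: "(\<lambda>_. undefined) \<in> Sur 0 0" by (simp add: Sur_def)
  have b: "bfactors R 0 (\<lambda>_. undefined) = []" using bfactors_perm[OF e] by simp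
  interpret ST: scalar_tensor R "bfactors R 0 (\<lambda>_. undefined)" by (rule scalar_tensor_bfactors)
  have "pure_tensor R [] [] = tensor_level R [] \<one>"
    using ST.pure_tensor_eq[of "[]"] by (simp add: b tuples_iff)
  then have "free_in R (binary_gen R) 0 (\<lambda>_. undefined) (pure_tensor R [] []) = perm_vec R 0 (\<lambda>_. undefined)"
    by (simp add: free_in_def perm_vec_def b flip: bfactors_def)
  then have "ident (permAs R) = augment_level R 0 \<zero> +>\<^bsub>bfree R 0\<^esub> perm_vec R 0 (\<lambda>_. undefined)"
    using generated_ideal_eq[of 1]
    by (simp add: permAs_def Let_def quotient_permutad_def bpermutad_def free_permutad_def bfree_def)
  then show ?thesis
    using AU.ker_coset[OF perm_vec_closed[OF e]] e by (simp add: augment_level_def)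
qed

lemma bij_permAs: "bij_betw (augment_level R n) (carrier R) (carrier (grade (permAs R) (n + 1)))"
  unfolding carrier_permAs
  by (intro inj_on_imp_bij_betw inj_on_inverseI[of _ "class_val R n"]) simp

text \<open>Multiplying the class of value one by \<open>r\<close> gives the class of value
  \<open>r\<close>, so this is \<open>bij_permAs\<close> in another form.\<close>

lemma bij_smult_permAs:
  "bij_betw (\<lambda>r. r \<odot>\<^bsub>grade (permAs R) (n + 1)\<^esub> augment_level R n \<one>) (carrier R) (carrier (grade (permAs R) (n + 1)))"
  using bij_permAs[of n] by (subst bij_betw_cong) (simp_all add: permAs_smult del: One_nat_def)

text \<open>Through \<open>Gam_permAs\<close> each axiom on compositions becomes an identity between
  products of scalars.\<close>

lemma permutad_permAs: "permutad R (permAs R)"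
proof (intro permutad.intro permutad_axioms.intro cring_axioms)
  let ?P = "permAs R"
  show "module R (grade ?P n)" if "n \<ge> 1" for n using that by (rule module_permAs)
  show "ident ?P \<in> carrier (grade ?P 1)"
    using augment_level_closed[of \<one> 0] by (simp add: ident_permAs)
  show "bij_betw (\<lambda>r. r \<odot>\<^bsub>grade ?P 1\<^esub> ident ?P) (carrier R) (carrier (grade ?P 1))"
    using bij_smult_permAs[of 0] by (simp add: ident_permAs)
  fix n :: nat assume n: "n \<ge> 1"
  show "Gam ?P n (corolla n) [\<mu>] = \<mu>" if "\<mu> \<in> carrier (grade ?P (n + 1))" for \<mu>
  proof -
    note c = corolla_Sur[OF n]
    have "[\<mu>] \<in> tuples (factors (grade ?P) n (corolla n))"
      using that fibre_size_corolla[of n] by (simp add: tuples_iff length_factors[OF c] factors_nth[OF c])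
    from Gam_permAs[OF c this] show ?thesis
      using that class_val_closed[OF that] fibre_size_corolla[of n]
      by (simp add: class_vals_eq[OF c] augment_level_class_val)
  qed
  fix t k assume t: "t \<in> Sur n k"
  show "multilinear R (factors (grade ?P) n t) (grade ?P (n + 1)) (Gam ?P n t)"
    unfolding multilinear_def length_factors[OF t]
  proof (intro conjI ballI allI impI)
    let ?T = "tuples (factors (grade ?P) n t)"
    show "Gam ?P n t \<in> ?T \<rightarrow> carrier (grade ?P (n + 1))"
      using class_val_Gam_permAs(2)[OF t] by blast
    fix xs i assume xs: "xs \<in> ?T" and i: "i < k"
    let ?N = "grade ?P (fibre_size n t (Suc i) + 1)" and ?v = "class_val R (fibre_size n t (Suc i))"
    have Ni: "factors (grade ?P) n t ! i = ?N" by (rule factors_nth[OF t i])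
    interpret N: module R ?N by (rule module_permAs) simp
    have upd: "xs[i := x] \<in> ?T" if "x \<in> carrier ?N" for x
      using xs that Ni i by (auto simp: tuples_iff length_factors[OF t] nth_list_update)
    have vals: "class_vals R n t (xs[i := x]) = (class_vals R n t xs)[i := ?v x]" for x
      using permAs_tuplesD(1)[OF t xs] i
      by (intro nth_equalityI) (auto simp: class_vals_eq[OF t] nth_list_update)
    note c = class_vals_closed[OF t xs]
    have len: "i < length (class_vals R n t xs)"
      using i permAs_tuplesD(1)[OF t xs] by (simp add: class_vals_eq[OF t])
    have lc: "lprod R ((class_vals R n t xs)[i := ?v x]) \<in> carrier R" if "x \<in> carrier ?N" for x
      using c class_val_closed[OF that] by (intro lprod_closed set_update_subsetI)
    show "Gam ?P n t (xs[i := x \<oplus>\<^bsub>factors (grade ?P) n t ! i\<^esub> y])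
        = Gam ?P n t (xs[i := x]) \<oplus>\<^bsub>grade ?P (n + 1)\<^esub> Gam ?P n t (xs[i := y])"
      if "x \<in> carrier (factors (grade ?P) n t ! i)" "y \<in> carrier (factors (grade ?P) n t ! i)" for x y
    proof -
      have x: "x \<in> carrier ?N" and y: "y \<in> carrier ?N" using that Ni by simp_all
      show ?thesis
        unfolding Ni Gam_permAs[OF t upd[OF N.a_closed[OF x y]]] Gam_permAs[OF t upd[OF x]] Gam_permAs[OF t upd[OF y]]
          vals class_val_add[OF x y] lprod_update_add[OF c len class_val_closed[OF x] class_val_closed[OF y]]
        by (rule permAs_add[symmetric]) (rule lc[OF x], rule lc[OF y])
    qed
    show "Gam ?P n t (xs[i := r \<odot>\<^bsub>factors (grade ?P) n t ! i\<^esub> x]) = r \<odot>\<^bsub>grade ?P (n + 1)\<^esub> Gam ?P n t (xs[i := x])"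
      if r: "r \<in> carrier R" and "x \<in> carrier (factors (grade ?P) n t ! i)" for r x
    proof -
      have x: "x \<in> carrier ?N" using that Ni by simp
      show ?thesis
        unfolding Ni Gam_permAs[OF t upd[OF N.smult_closed[OF r x]]] Gam_permAs[OF t upd[OF x]]
          vals class_val_smult[OF r x] lprod_update_smult[OF c len r class_val_closed[OF x]]
        by (rule permAs_smult[symmetric]) (rule r, rule lc[OF x])
    qed
  qed
  fix ms :: "nat list" and ts xss
  assume len: "length ms = k" "length ts = k" "length xss = k"
    and ts: "\<And>j. j < k \<Longrightarrow> ts ! j \<in> Sur (fibre_size n t (Suc j)) (ms ! j)"
    and xss: "\<And>j. j < k \<Longrightarrow> xss ! j \<in> tuples (factors (grade ?P) (fibre_size n t (Suc j)) (ts ! j))"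
  interpret substitution n k t ts ms using t len ts by unfold_locales
  let ?s = "subst_surj n t ts" and ?fs = "\<lambda>j. fibre_size n t (Suc j)"
  let ?ys = "map (\<lambda>j. Gam ?P (?fs j) (ts ! j) (xss ! j)) [0..<k]"
  have mem: "concat xss \<in> tuples (factors (grade ?P) n ?s)"
    unfolding factors_subst_surj using len xss by (intro tuples_concat) auto
  have ys: "?ys \<in> tuples (factors (grade ?P) n t)"
    using class_val_Gam_permAs(2)[OF ts xss] by (simp add: tuples_iff length_factors[OF t] factors_nth[OF t])
  \<comment> \<open>Concatenating arguments concatenates their values, since the fibre sizes of the
    substitution are the concatenated fibre sizes.\<close>
  have "class_vals R n ?s (concat xss)
      = concat (map2 (map2 (class_val R)) (map (\<lambda>j. fibre_sizes (?fs j) (ts ! j)) [0..<k]) xss)"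
    unfolding class_vals_def fibre_sizes_subst_surj
    using len permAs_tuplesD(1)[OF ts xss] length_fibre_sizes[OF ts]
    by (intro map2_concat) auto
  also have "map2 (map2 (class_val R)) (map (\<lambda>j. fibre_sizes (?fs j) (ts ! j)) [0..<k]) xss
      = map (\<lambda>j. class_vals R (?fs j) (ts ! j) (xss ! j)) [0..<k]"
    using len by (intro nth_equalityI) (auto simp: class_vals_def)
  finally have "lprod R (class_vals R n ?s (concat xss))
      = lprod R (map (\<lambda>j. lprod R (class_vals R (?fs j) (ts ! j) (xss ! j))) [0..<k])"
    using subsetD[OF class_vals_closed[OF ts xss]]
    by (simp only:) (subst lprod_concat, auto simp: comp_def)
  \<comment> \<open>The products over the separate blocks are the values of the inner
    composites.\<close>
  also have "map (\<lambda>j. lprod R (class_vals R (?fs j) (ts ! j) (xss ! j))) [0..<k] = class_vals R n t ?ys"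
    using class_val_Gam_permAs(1)[OF ts xss] by (simp add: class_vals_eq[OF t])
  finally show "Gam ?P n ?s (concat xss) = Gam ?P n t ?ys"
    using Gam_permAs[OF subst_surj_Sur mem] Gam_permAs[OF t ys] by simp
qed

section \<open>Rank one and the comparison with \<open>As\<close>\<close>

lemma free_rank_one_permAs:
  assumes "n \<ge> 1" shows "free_rank_one R (grade (permAs R) n)"
proof -
  obtain m where n: "n = m + 1" using assms by (metis add.commute le_Suc_ex)
  show ?thesis
    unfolding free_rank_one_def using module_permAs[OF assms] bij_smult_permAs[of m] augment_level_closed[of \<one> m]
    unfolding n by blast
qed

lemma module_iso_permAs:
  assumes "n \<ge> 1"
  shows "module_iso R (grade (permAs R) n) (regular_module R) (class_val R (n - 1))"
proof -
  obtain m where n: "n = m + 1" using assms by (metis add.commute le_Suc_ex)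
  have "bij_betw (class_val R m) (carrier (grade (permAs R) (m + 1))) (carrier R)"
    using augment_level_class_val augment_level_closed class_val_closed
    by (intro bij_betw_byWitness[where f' = "augment_level R m"]) auto
  then show ?thesis
    unfolding n module_iso_def using class_val_add[of _ m] class_val_smult[of _ _ m] by simp
qed

text \<open>The interval is the fibre of 1 and belongs to the inner operation, so the arguments come
  in the order \<open>[y, x]\<close>; commutativity of the ring restores the order of
  \<open>As\<close>.\<close>

lemma partial_comp_permAs:
  assumes "p \<ge> 2" "q \<ge> 2" "i \<in> {1..p}"
    and x: "x \<in> carrier (grade (permAs R) p)" and y: "y \<in> carrier (grade (permAs R) q)"
  shows "class_val R (p + q - 1 - 1) (partial_comp (permAs R) p q i x y)
    = class_val R (p - 1) x \<otimes> class_val R (q - 1) y"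
proof -
  \<comment> \<open>Surjections act on one point fewer than the arity.\<close>
  define m n where "m = p - 1" "n = q - 1"
  have pq: "p = m + 1" "q = n + 1" "m \<ge> 1" "n \<ge> 1" using assms by (auto simp: m_n_def)
  note t = interval_surj_Sur[OF pq(3,4), of i]
  have i: "i \<in> {1..m + 1}" using assms pq by simp
  have f: "fibre_size (m + n) (interval_surj m n i) (Suc 0) = n"
    "fibre_size (m + n) (interval_surj m n i) (Suc (Suc 0)) = m"
    using t(2,3)[OF i] by (simp_all add: numeral_2_eq_2)
  have xy: "x \<in> carrier (grade (permAs R) (m + 1))" "y \<in> carrier (grade (permAs R) (n + 1))"
    using x y pq by simp_all
  have "[y, x] \<in> tuples (factors (grade (permAs R)) (m + n) (interval_surj m n i))"
    using xy f by (auto simp: tuples_iff length_factors[OF t(1)[OF i]] factors_nth[OF t(1)[OF i]] less_Suc_eq numeral_2_eq_2)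
  from class_val_Gam_permAs(1)[OF t(1)[OF i] this]
  have "class_val R (m + n) (Gam (permAs R) (m + n) (interval_surj m n i) [y, x]) = class_val R n y \<otimes> class_val R m x"
    using class_val_closed[OF xy(1)] class_val_closed[OF xy(2)] f
    by (simp add: class_vals_eq[OF t(1)[OF i]] numeral_2_eq_2)
  also have "\<dots> = class_val R m x \<otimes> class_val R n y"
    using class_val_closed[OF xy(1)] class_val_closed[OF xy(2)] by (rule m_comm[rotated])
  finally show ?thesis
    using pq by (simp add: partial_comp_def Let_def)
qed

end

theorem corollary4p7:
  fixes R :: "('a, 'm) ring_scheme"
  assumes "cring R"
  shows "permutad R (permAs R) \<and>
    (\<forall>n\<ge>1. free_rank_one R (grade (permAs R) n)) \<and>
    (\<exists>f. prepermutad_iso R (permutad_prepermutad (permAs R))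
           (operad_prepermutad (As_operad R)) f)"
proof -
  interpret cring R by (rule assms)
  \<comment> \<open>The isomorphism reads off the scalar of a class. The index is 0 because arity 1
    corresponds to surjections of the empty set.\<close>
  have "class_val R 0 (ident (permAs R)) = \<one>\<^bsub>R\<^esub>"
    by (simp add: ident_permAs)
  then have "prepermutad_iso R (permutad_prepermutad (permAs R)) (operad_prepermutad (As_operad R))
      (\<lambda>n. class_val R (n - 1))"
    using module_iso_permAs partial_comp_permAs
    by (simp add: prepermutad_iso_def permutad_prepermutad_def operad_prepermutad_def As_operad_def)
  then show ?thesis using permutad_permAs free_rank_one_permAs by blast
qed

end
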